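(* Let $(\mu_n)_{n\ge 1}$ be a sequence of positive real numbers such that $\lim_{n\to\infty}\frac{\mu_n}{n}=c\ge 0$. For each $n$, let $\nu_n$ be the probability measure on $\mathbb{R}$ (the statistical distribution of the eigenvalues under $\mathbb{P}_{n,\mu_n}$) defined by $\int_{\mathbb{R}}f(t)\,\nu_n(dt)=\int_{H_n}\frac1n\operatorname{tr}(f(x))\,\mathbb{P}_{n,\mu_n}(dx)$ for bounded measurable $f$. Then, after scaling by $\frac{1}{\sqrt n}$, the measure $\nu_n$ converges weakly to the measure $\nu_c$ supported by $S=[-b,-a]\cup[a,b]$ with density (with respect to Lebesgue measure) $$f_c(t)=\frac{1}{\pi|t|}\sqrt{(t^2-a^2)(b^2-t^2)},\qquad t\in S,$$ where $a=\sqrt{1+c-\sqrt{1+2c}}$ and $b=\sqrt{1+c+\sqrt{1+2c}}$. That is, for every bounded continuous function $\varphi$ on $\mathbb{R}$, $$\lim_{n\to\infty}\int_{\mathbb{R}}\varphi\Big(\frac{u}{\sqrt n}\Big)\nu_n(du)=\int_{S}\varphi(u)\,\nu_c(du).$$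
   Context: $H_n=\mathrm{Herm}(n,\mathbb{C})$ is the real vector space of $n\times n$ Hermitian matrices, with inner product $\langle x,y\rangle=\operatorname{tr}(xy)$ and associated Euclidean (Lebesgue) measure $m_n$. For $\mu>-\frac12$, $\mathbb{P}_{n,\mu}$ is the probability measure on $H_n$ given by $$\mathbb{P}_{n,\mu}(dx)=\frac{1}{C_n}|\det(x)|^{2\mu}e^{-\operatorname{tr}(x^2)}m_n(dx),$$ where $C_n$ is the normalizing constant. For a Hermitian matrix $x$ and a function $f$ on $\mathbb{R}$, $f(x)$ is defined by functional calculus, so $\operatorname{tr}(f(x))=\sum_{i=1}^n f(\lambda_i)$ with $\lambda_1,\dots,\lambda_n$ the eigenvalues of $x$. *)

theory Defs
  imports "HOL-Probability.Probability" "Jordan_Normal_Form.Schur_Decomposition"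
begin

definition herm :: "nat \<Rightarrow> complex mat set" where
  "herm n = {x \<in> carrier_mat n n. mat_adjoint x = x}"

definition tr :: "complex mat \<Rightarrow> complex" where
  "tr x = sum_list (diag_mat x)"

definition unitary :: "nat \<Rightarrow> complex mat \<Rightarrow> bool" where
  "unitary n U \<longleftrightarrow> U \<in> carrier_mat n n \<and> mat_adjoint U * U = 1\<^sub>m n \<and> U * mat_adjoint U = 1\<^sub>m n"

definition is_diagonalization :: "nat \<Rightarrow> complex mat \<Rightarrow> complex mat \<Rightarrow> (nat \<Rightarrow> real) \<Rightarrow> bool" where
  "is_diagonalization n x U d \<longleftrightarrow>
     unitary n U \<and> x = U * mat_diag n (\<lambda>i. complex_of_real (d i)) * mat_adjoint U"

(* The result does not depend on the chosen diagonalization: see fun_calc_eq below. *)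
definition fun_calc :: "(real \<Rightarrow> real) \<Rightarrow> complex mat \<Rightarrow> complex mat" where
  "fun_calc f x = (SOME y. \<exists>U d. is_diagonalization (dim_row x) x U d \<and>
     y = U * mat_diag (dim_row x) (\<lambda>i. complex_of_real (f (d i))) * mat_adjoint U)"

lemma mat_adjoint_carrier [simp]:
  "U \<in> carrier_mat n n \<Longrightarrow> mat_adjoint U \<in> carrier_mat n n"
  by (auto simp: mat_adjoint_def)

lemma mat_diag_intertwine:
  fixes W :: "complex mat"
  assumes W: "W \<in> carrier_mat n n"
    and eq: "W * mat_diag n (\<lambda>i. complex_of_real (d i)) = mat_diag n (\<lambda>i. complex_of_real (e i)) * W"
  shows "W * mat_diag n (\<lambda>i. complex_of_real (f (d i)))
    = mat_diag n (\<lambda>i. complex_of_real (f (e i))) * W"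
proof -
  have "W $$ (i,j) * complex_of_real (f (d j)) = complex_of_real (f (e i)) * W $$ (i,j)"
    if "i < n" "j < n" for i j
  proof -
    have "(W * mat_diag n (\<lambda>i. complex_of_real (d i))) $$ (i,j)
        = (mat_diag n (\<lambda>i. complex_of_real (e i)) * W) $$ (i,j)"
      using eq by simp
    then have "W $$ (i,j) = 0 \<or> d j = e i"
      using that by (simp add: mat_diag_mult_left[OF W] mat_diag_mult_right[OF W])
    then show ?thesis by auto
  qed
  then show ?thesis
    by (auto simp: mat_diag_mult_left[OF W] mat_diag_mult_right[OF W] intro!: eq_matI)
qed

lemma unitary_conj_unique:
  assumes U: "is_diagonalization n x U d" and V: "is_diagonalization n x V e"
  shows "U * mat_diag n (\<lambda>i. complex_of_real (f (d i))) * mat_adjoint U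
    = V * mat_diag n (\<lambda>i. complex_of_real (f (e i))) * mat_adjoint V"
proof -
  define D where "D g = mat_diag n (\<lambda>i. complex_of_real (g (d i)))" for g :: "real \<Rightarrow> real"
  define E where "E g = mat_diag n (\<lambda>i. complex_of_real (g (e i)))" for g :: "real \<Rightarrow> real"
  define U' where "U' = mat_adjoint U"
  define V' where "V' = mat_adjoint V"
  have c: "U \<in> carrier_mat n n" "U' \<in> carrier_mat n n" "V \<in> carrier_mat n n" "V' \<in> carrier_mat n n"
    using U V unfolding is_diagonalization_def unitary_def U'_def V'_def by auto
  have D [simp]: "D g \<in> carrier_mat n n" and E [simp]: "E g \<in> carrier_mat n n" for g
    unfolding D_def E_def by auto
  have 1: "U' * U = 1\<^sub>m n" "U * U' = 1\<^sub>m n" "V' * V = 1\<^sub>m n" "V * V' = 1\<^sub>m n"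
    and xx: "U * D (\<lambda>t. t) * U' = V * E (\<lambda>t. t) * V'"
    using U V unfolding is_diagonalization_def unitary_def U'_def V'_def D_def E_def by auto
  note [simp] = c 1
  note [simp] = left_mult_one_mat[where nr=n and nc=n] right_mult_one_mat[where nr=n and nc=n]
  note assoc = assoc_mult_mat[where ?n\<^sub>1.0=n and ?n\<^sub>2.0=n and ?n\<^sub>3.0=n and ?n\<^sub>4.0=n]
  note m = mult_carrier_mat[of _ n n _ n]
  have cancel: "P * (Q * X) = X" if "P \<in> carrier_mat n n" "Q \<in> carrier_mat n n"
    "X \<in> carrier_mat n n" "P * Q = 1\<^sub>m n" for P Q X :: "complex mat"
    using assoc[of P Q X] that by simp
  define W where "W = V' * U"
  have W [simp]: "W \<in> carrier_mat n n" unfolding W_def by (rule m) auto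
  have "W * D (\<lambda>t. t) = V' * (U * D (\<lambda>t. t) * U') * U"
    unfolding W_def by (simp add: assoc m cancel)
  also have "\<dots> = E (\<lambda>t. t) * W"
    unfolding W_def xx by (simp add: assoc m cancel)
  finally have *: "W * D f = E f * W"
    using mat_diag_intertwine[of W n d e f] W unfolding D_def E_def by auto
  have "U = V * W"
    unfolding W_def by (simp add: cancel)
  then have "U * D f * U' = V * (W * D f) * U'"
    by (simp add: assoc m cancel)
  also have "\<dots> = V * E f * (W * U')"
    unfolding * by (simp add: assoc m cancel)
  also have "W * U' = V'"
    unfolding W_def by (simp add: assoc m cancel)
  finally show ?thesis unfolding D_def E_def U'_def V'_def .
qed

lemma fun_calc_eq:
  assumes "is_diagonalization n x U d"
  shows "fun_calc f x = U * mat_diag n (\<lambda>i. complex_of_real (f (d i))) * mat_adjoint U"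
proof -
  have [simp]: "dim_row x = n"
    using assms by (auto simp: is_diagonalization_def unitary_def)
  have "\<exists>V e. is_diagonalization (dim_row x) x V e \<and>
     fun_calc f x = V * mat_diag (dim_row x) (\<lambda>i. complex_of_real (f (e i))) * mat_adjoint V"
    unfolding fun_calc_def by (rule someI_ex) (use assms in auto)
  then show ?thesis
    using unitary_conj_unique[OF assms] by fastforce
qed

(* Coordinates of a Hermitian matrix in an orthonormal basis for <x,y> = tr (x y):
   E_ii, (E_ij + E_ji) / sqrt 2 and i (E_ij - E_ji) / sqrt 2 for i < j;
   u (i,j) and u (j,i) are the coordinates along the last two. See tr_herm_of_coords. *)
definition herm_of_coords :: "nat \<Rightarrow> (nat \<times> nat \<Rightarrow> real) \<Rightarrow> complex mat" where
  "herm_of_coords n u = Matrix.mat n n (\<lambda>(i,j).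
     if i = j then complex_of_real (u (i,i))
     else if i < j then Complex (u (i,j)) (u (j,i)) / complex_of_real (sqrt 2)
     else Complex (u (j,i)) (- u (i,j)) / complex_of_real (sqrt 2))"

lemma tr_herm_of_coords:
  "tr (herm_of_coords n u * herm_of_coords n v)
     = complex_of_real (\<Sum>p\<in>{..<n} \<times> {..<n}. u p * v p)"
proof -
  define h where "h w i j = (if i = j then complex_of_real (w (i,i))
     else if i < j then Complex (w (i,j)) (w (j,i)) / complex_of_real (sqrt 2)
     else Complex (w (j,i)) (- w (i,j)) / complex_of_real (sqrt 2))" for w :: "nat \<times> nat \<Rightarrow> real" and i j
  have s2: "complex_of_real (sqrt 2) * complex_of_real (sqrt 2) = 2"
    by (simp flip: of_real_mult)
  have pair: "h u i j * h v j i + h u j i * h v i j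
      = complex_of_real (u (i,j) * v (i,j)) + complex_of_real (u (j,i) * v (j,i))" for i j
    by (auto simp: h_def s2 complex_eq_iff)
  have "tr (herm_of_coords n u * herm_of_coords n v) = (\<Sum>i<n. \<Sum>j<n. h u i j * h v j i)" (is "_ = ?S")
    by (simp add: tr_def diag_mat_def herm_of_coords_def scalar_prod_def h_def
        sum_list_distinct_conv_sum_set lessThan_atLeast0)
  moreover have "?S = (\<Sum>i<n. \<Sum>j<n. h u j i * h v i j)"
    by (rule sum.swap)
  moreover have "?S + (\<Sum>i<n. \<Sum>j<n. h u j i * h v i j)
      = (\<Sum>i<n. \<Sum>j<n. complex_of_real (u (i,j) * v (i,j)))
        + (\<Sum>i<n. \<Sum>j<n. complex_of_real (u (j,i) * v (j,i)))"
    by (simp only: pair flip: sum.distrib)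
  moreover have "(\<Sum>i<n. \<Sum>j<n. complex_of_real (u (j,i) * v (j,i)))
      = (\<Sum>i<n. \<Sum>j<n. complex_of_real (u (i,j) * v (i,j)))"
    by (rule sum.swap)
  ultimately show ?thesis
    by (simp add: sum.cartesian_product)
qed

definition herm_borel :: "nat \<Rightarrow> complex mat measure" where
  "herm_borel n = vimage_algebra (herm n)
     (\<lambda>x. \<lambda>p\<in>{..<n} \<times> {..<n}. x $$ p) (\<Pi>\<^sub>M p\<in>{..<n} \<times> {..<n}. borel)"

definition herm_lebesgue :: "nat \<Rightarrow> complex mat measure" where
  "herm_lebesgue n = distr (\<Pi>\<^sub>M p\<in>{..<n} \<times> {..<n}. lborel) (herm_borel n) (herm_of_coords n)"

definition weight :: "real \<Rightarrow> complex mat \<Rightarrow> real" where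
  "weight \<mu> x = cmod (Determinant.det x) powr (2 * \<mu>) * exp (- Re (tr (x * x)))"

definition norm_const :: "nat \<Rightarrow> real \<Rightarrow> real" where
  "norm_const n \<mu> = (\<integral>x. weight \<mu> x \<partial>herm_lebesgue n)"

definition ensemble :: "nat \<Rightarrow> real \<Rightarrow> complex mat measure" where
  "ensemble n \<mu> = density (herm_lebesgue n) (\<lambda>x. ennreal (1 / norm_const n \<mu> * weight \<mu> x))"

definition is_statistical_distribution :: "nat \<Rightarrow> real \<Rightarrow> real measure \<Rightarrow> bool" where
  "is_statistical_distribution n \<mu> N \<longleftrightarrow>
     prob_space N \<and> sets N = sets borel \<and>
     (\<forall>f \<in> borel_measurable borel. bounded (range f) \<longrightarrow>
        (\<integral>t. f t \<partial>N) = (\<integral>x. 1 / real n * Re (tr (fun_calc f x)) \<partial>ensemble n \<mu>))"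

definition statistical_distribution :: "nat \<Rightarrow> real \<Rightarrow> real measure" where
  "statistical_distribution n \<mu> = (THE N. is_statistical_distribution n \<mu> N)"

definition edge_a :: "real \<Rightarrow> real" where
  "edge_a c = sqrt (1 + c - sqrt (1 + 2 * c))"

definition edge_b :: "real \<Rightarrow> real" where
  "edge_b c = sqrt (1 + c + sqrt (1 + 2 * c))"

definition limit_support :: "real \<Rightarrow> real set" where
  "limit_support c = {- edge_b c .. - edge_a c} \<union> {edge_a c .. edge_b c}"

(* For c = 0 the point t = 0 lies in the support; there x / 0 = 0 gives the value 0,
   which is irrelevant as {0} is a null set. *)
definition limit_density :: "real \<Rightarrow> real \<Rightarrow> real" where
  "limit_density c t =
     1 / (pi * \<bar>t\<bar>) * sqrt ((t\<^sup>2 - (edge_a c)\<^sup>2) * ((edge_b c)\<^sup>2 - t\<^sup>2))"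

definition limit_measure :: "real \<Rightarrow> real measure" where
  "limit_measure c =
     density lborel (\<lambda>t. ennreal (indicator (limit_support c) t * limit_density c t))"

end

theory Submission
  imports Defs
begin

text \<open>Everything is reduced to moments. Both the mean eigenvalue distribution and the limit measure are
even, and the limit has compact support, so weak convergence follows from convergence of the even
moments (\<open>even_moments_weak_convergence\<close>). The work is to compute the moments on both sides.

The first half expresses the matrix moments through orthogonal polynomials. The classical tool is
Weyl's integration formula: the law of the eigenvalues is the Gaussian weight times
\<open>|\<Prod> x\<^sub>i|^(2\<mu>)\<close> times the squared Vandermonde product. It is obtained here without a change of
variables on the unitary orbits. For \<open>\<mu> = 0\<close>, Gaussian integration by parts shows that the expected
products of traces \<open>tr X^k\<close> satisfy a recursion (the loop or Schwinger-Dyson equations), and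
that the corresponding integrals of power sums against the squared Vandermonde product satisfy the same
recursion (\<open>loop_solution_matrices\<close>, \<open>loop_solution_eigenvalues\<close>). The recursion determines its solution
up to a factor, so both integrals agree, up to a constant, on all polynomials in the traces. By
Newton's identities the determinant is such a polynomial; hence the weights \<open>|det X|^(2m)\<close> with \<open>m\<close> a
natural number are covered. To reach a real exponent \<open>\<mu>\<close>, homogeneity is used: the radial part of
each integral is a Gamma factor, the same on both sides, and on the unit ball \<open>(det X)^2\<close> lies
in \<open>[0, 1]\<close>, where the Weierstrass theorem passes from powers \<open>y^m\<close> to \<open>y^\<mu>\<close>
(\<open>homogeneous_weight_extension\<close>).

The orthogonal polynomials \<open>P\<^sub>j\<close> of the weight \<open>|t|^(2\<mu>) e^(-t^2)\<close> are the generalized Hermite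
polynomials, with the explicit recurrence \<open>P\<^sub>j\<^sub>+\<^sub>1 = t P\<^sub>j - [j]/2 P\<^sub>j\<^sub>-\<^sub>1\<close>, where \<open>[j] = j\<close> for even \<open>j\<close> and
\<open>[j] = j + 2\<mu>\<close> for odd \<open>j\<close>. Writing the Vandermonde product as a determinant in the \<open>P\<^sub>j\<close> gives the moment
of order \<open>2k\<close> as the average over \<open>j < n\<close> of the diagonal entries of the \<open>k\<close>-th power of the
Jacobi matrix of multiplication by \<open>t^2\<close> (\<open>one_point_formula\<close>, \<open>matrix_moment_formula\<close>).

The second half is the asymptotics. Near row \<open>j\<close> with \<open>j / n\<close> close to \<open>s\<close>, the Jacobi matrix divided
by \<open>n\<close> is close to a Toeplitz matrix with symbol
\<open>\<tau>\<^sub>s(\<theta>) = s + c + \<rho>\<^sub>s cos \<theta>\<close>, \<open>\<rho>\<^sub>s^2 = s (s + 2c)\<close>, and so the moments tend to the average of \<open>\<tau>\<^sub>s(\<theta>)^k\<close>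
over \<open>s\<close> in \<open>[0, 1]\<close> and \<open>\<theta>\<close> in \<open>[0, \<pi>]\<close> (\<open>jac_average_tendsto\<close>). The integration over \<open>s\<close> is done by
an exact identity which writes \<open>\<tau>\<^sub>s^k\<close> as an \<open>s\<close>-derivative of \<open>\<rho>\<^sub>s^2 sin^2 \<theta> \<tau>\<^sub>s^(k-1)\<close> plus a
\<open>\<theta>\<close>-derivative of a function that vanishes at \<open>0\<close> and \<open>\<pi>\<close> (\<open>lim_jac_flow\<close>). What remains is an integral
over \<open>\<theta>\<close> at \<open>s = 1\<close>, which the substitution \<open>t^2 = \<tau>\<^sub>1(\<theta>)\<close> turns into the moment of the limit density:
\<open>\<tau>\<^sub>1\<close> runs through \<open>[a^2, b^2]\<close> and \<open>(t^2 - a^2) (b^2 - t^2) = \<rho>\<^sub>1^2 sin^2 \<theta>\<close> (\<open>limit_measure_moment\<close>).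

The mean eigenvalue distribution itself is constructed as a mixture of the uniform distributions
on the spectra, which needs the spectral theorem for Hermitian matrices and the measurability of
symmetric functions of the eigenvalues.\<close>

section \<open>Moments of the weight \<open>|t|^(2\<mu>) e^(-t^2)\<close>\<close>

definition wgauss :: "real \<Rightarrow> real measure" where
  "wgauss \<mu> = density lborel (\<lambda>t. ennreal (\<bar>t\<bar> powr (2 * \<mu>) * exp (- t\<^sup>2)))"

text \<open>The substitution \<open>s = t^2\<close> in the Gamma integral.\<close>

lemma half_line_moment:
  assumes x: "x > 0"
  shows "has_bochner_integral lborel
     (\<lambda>t::real. indicator {0..} t *\<^sub>R (\<bar>t\<bar> powr (2 * x - 1) * exp (- t\<^sup>2))) (Gamma x / 2)"
proof -
  define f where "f = (\<lambda>s::real. s powr (x - 1) / exp s)"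
  have img: "(\<lambda>t::real. t\<^sup>2) ` {0<..} = {0<..}"
  proof (intro equalityI subsetI)
    fix s :: real assume "s \<in> {0<..}"
    then show "s \<in> (\<lambda>t::real. t\<^sup>2) ` {0<..}"
      by (intro image_eqI[of _ _ "sqrt s"]) auto
  qed auto
  have "(f has_integral Gamma x) {0..}"
    unfolding f_def by (rule Gamma_integral_real[OF x])
  then have hi: "(f has_integral Gamma x) {0<..}"
    by (subst has_integral_spike_set_eq[where T="{0..}"])
       (auto intro: negligible_subset[of "{0}"])
  have ab: "f absolutely_integrable_on {0<..}"
    by (rule nonnegative_absolutely_integrable_1)
       (use hi in \<open>auto simp: f_def integrable_on_def\<close>)
  have "f absolutely_integrable_on ((\<lambda>t. t\<^sup>2) ` {0<..}) \<and> integral ((\<lambda>t. t\<^sup>2) ` {0<..}) f = Gamma x"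
    unfolding img using ab hi by (auto simp: integral_unique)
  then have "(\<lambda>t. \<bar>2 * t\<bar> * f (t\<^sup>2)) absolutely_integrable_on {0<..} \<and>
      integral {0<..} (\<lambda>t. \<bar>2 * t\<bar> * f (t\<^sup>2)) = Gamma x"
    by (subst has_absolute_integral_change_of_variables_1')
       (auto intro!: derivative_eq_intros inj_onI simp: power2_eq_iff)
  then have "set_integrable lebesgue {0<..} (\<lambda>t. \<bar>2 * t\<bar> * f (t\<^sup>2))"
    and "(LINT t:{0<..}|lebesgue. \<bar>2 * t\<bar> * f (t\<^sup>2)) = Gamma x"
    by (auto simp: set_lebesgue_integral_eq_integral)
  then have "has_bochner_integral lebesgue (\<lambda>t. indicator {0<..} t *\<^sub>R (\<bar>2 * t\<bar> * f (t\<^sup>2))) (Gamma x)"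
    by (auto simp: has_bochner_integral_iff set_integrable_def set_lebesgue_integral_def)
  then have "has_bochner_integral lborel (\<lambda>t. indicator {0<..} t *\<^sub>R (\<bar>2 * t\<bar> * f (t\<^sup>2))) (Gamma x)"
    by (auto simp: has_bochner_integral_iff integrable_completion integral_completion f_def)
  then have "has_bochner_integral lborel (\<lambda>t. (indicator {0<..} t *\<^sub>R (\<bar>2 * t\<bar> * f (t\<^sup>2))) * (1/2)) (Gamma x * (1/2))"
    by (rule has_bochner_integral_mult_left)
  moreover have "(indicator {0<..} t *\<^sub>R (\<bar>2 * t\<bar> * f (t\<^sup>2))) * (1/2) =
      indicator {0..} t *\<^sub>R (\<bar>t\<bar> powr (2 * x - 1) * exp (- t\<^sup>2))" for t :: real
  proof (cases "t > 0")
    case True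
    have "t * (t\<^sup>2) powr (x - 1) = t powr 1 * (t powr 2) powr (x - 1)"
      using True by simp
    also have "\<dots> = t powr (2 * x - 1)"
      using True unfolding powr_powr powr_add[symmetric] by (simp add: algebra_simps)
    finally show ?thesis using True by (simp add: f_def exp_minus field_simps)
  next
    case False
    then show ?thesis by (auto simp: indicator_def)
  qed
  ultimately show ?thesis by simp
qed

lemma wgauss_moment_lborel:
  assumes \<mu>: "\<mu> \<ge> 0"
  shows "has_bochner_integral lborel (\<lambda>t. \<bar>t\<bar> powr (2 * \<mu>) * exp (- t\<^sup>2) * t ^ k)
     (if even k then Gamma (\<mu> + (real k + 1) / 2) else 0)"
proof -
  define x where "x = \<mu> + (real k + 1) / 2"
  have x: "x > 0" using \<mu> by (simp add: x_def add_nonneg_pos)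
  have *: "has_bochner_integral lborel (\<lambda>t. indicator {0..} t *\<^sub>R (\<bar>t\<bar> powr (2 * \<mu>) * exp (- t\<^sup>2) * t ^ k)) (Gamma x / 2)"
  proof -
    have "AE t in lborel. t \<noteq> (0::real)" by (rule AE_lborel_singleton)
    then have ae: "AE t in lborel. indicator {0..} t *\<^sub>R (\<bar>t\<bar> powr (2 * x - 1) * exp (- t\<^sup>2)) =
       indicator {0..} t *\<^sub>R (\<bar>t\<bar> powr (2 * \<mu>) * exp (- t\<^sup>2) * t ^ k)"
    proof eventually_elim
      case (elim t)
      show ?case
      proof (cases "t > 0")
        case True
        have "t powr (2 * x - 1) = t powr (2 * \<mu>) * t powr (real k)"
          using True unfolding powr_add[symmetric] by (simp add: x_def add_divide_distrib)
        also have "t powr (real k) = t ^ k" using True by (rule powr_realpow)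
        finally show ?thesis using True by simp
      next
        case False then show ?thesis using elim by auto
      qed
    qed
    show ?thesis
      using half_line_moment[OF x]
      by (subst (asm) has_bochner_integral_cong_AE[OF _ _ ae]) auto
  qed
  show ?thesis
  proof (cases "even k")
    case True
    then show ?thesis
      using has_bochner_integral_even_function[OF *] by (simp add: x_def)
  next
    case False
    then show ?thesis
      using has_bochner_integral_odd_function[OF *] by simp
  qed
qed

definition mom :: "real \<Rightarrow> nat \<Rightarrow> real" where
  "mom \<mu> k = (if even k then Gamma (\<mu> + (real k + 1) / 2) else 0)"

lemma wgauss_moment:
  assumes \<mu>: "\<mu> \<ge> 0"
  shows "has_bochner_integral (wgauss \<mu>) (\<lambda>t. t ^ k) (mom \<mu> k)"
  unfolding wgauss_def mom_def
  using wgauss_moment_lborel[OF \<mu>]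
  by (intro has_bochner_integral_density) auto

lemma mom_odd: "odd k \<Longrightarrow> mom \<mu> k = 0"
  by (simp add: mom_def)

lemma mom_even_rec:
  assumes "\<mu> \<ge> 0" "even k"
  shows "mom \<mu> (k + 2) = (real k + 1 + 2 * \<mu>) / 2 * mom \<mu> k"
proof -
  have "\<mu> + (real k + 1) / 2 > 0" using assms by (simp add: field_simps add_nonneg_pos)
  then have "\<mu> + (real k + 1) / 2 \<notin> \<int>\<^sub>\<le>\<^sub>0" by (auto elim!: nonpos_Ints_cases)
  then have "Gamma (\<mu> + (real k + 1) / 2 + 1) = (\<mu> + (real k + 1) / 2) * Gamma (\<mu> + (real k + 1) / 2)"
    by (rule Gamma_plus1)
  then show ?thesis using assms by (simp add: mom_def field_simps)
qed

lemma mom_0_pos: "\<mu> \<ge> 0 \<Longrightarrow> mom \<mu> 0 > 0"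
  by (simp add: mom_def Gamma_real_pos add_nonneg_pos)

lemma sets_wgauss [simp, measurable_cong]: "sets (wgauss \<mu>) = sets borel"
  by (simp add: wgauss_def)

lemma space_wgauss [simp]: "space (wgauss \<mu>) = UNIV"
  by (simp add: wgauss_def)

lemma finite_measure_wgauss: "\<mu> \<ge> 0 \<Longrightarrow> finite_measure (wgauss \<mu>)"
proof
  assume "\<mu> \<ge> 0"
  from wgauss_moment[OF this, of 0] have "integrable (wgauss \<mu>) (\<lambda>t. 1::real)"
    by (auto simp: has_bochner_integral_iff)
  then show "emeasure (wgauss \<mu>) (space (wgauss \<mu>)) \<noteq> \<infinity>"
    by (subst (asm) integrable_iff_bounded) simp
qed

lemma wgauss_poly:
  fixes q :: "real poly"
  assumes \<mu>: "\<mu> \<ge> 0"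
  shows "has_bochner_integral (wgauss \<mu>) (poly q) (\<Sum>i\<le>degree q. coeff q i * mom \<mu> i)"
proof -
  have "poly q = (\<lambda>t. \<Sum>i\<le>degree q. coeff q i * t ^ i)" by (simp add: poly_altdef fun_eq_iff)
  then show ?thesis
    using wgauss_moment[OF \<mu>]
    by (auto intro!: has_bochner_integral_sum has_bochner_integral_mult_right)
qed

section \<open>Polynomial functions and Gaussian integration by parts\<close>

text \<open>Polynomial functions \<open>F\<close> of the coordinates in \<open>I\<close>, carried along with the family \<open>F'\<close> of their partial
derivatives. Keeping \<open>F'\<close> as an explicit function makes the later identities purely algebraic.\<close>

inductive pfun :: "'i set \<Rightarrow> (('i \<Rightarrow> real) \<Rightarrow> complex) \<Rightarrow> ('i \<Rightarrow> ('i \<Rightarrow> real) \<Rightarrow> complex) \<Rightarrow> bool"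
  for I where
  pfun_const: "pfun I (\<lambda>u. c) (\<lambda>p u. 0)"
| pfun_coord: "i \<in> I \<Longrightarrow> pfun I (\<lambda>u. of_real (u i)) (\<lambda>p u. if p = i then 1 else 0)"
| pfun_add: "pfun I F F' \<Longrightarrow> pfun I G G' \<Longrightarrow> pfun I (\<lambda>u. F u + G u) (\<lambda>p u. F' p u + G' p u)"
| pfun_mult: "pfun I F F' \<Longrightarrow> pfun I G G' \<Longrightarrow>
    pfun I (\<lambda>u. F u * G u) (\<lambda>p u. F' p u * G u + F u * G' p u)"

lemma pfun_sum:
  assumes "\<And>s. s \<in> S \<Longrightarrow> pfun I (F s) (F' s)"
  shows "pfun I (\<lambda>u. \<Sum>s\<in>S. F s u) (\<lambda>p u. \<Sum>s\<in>S. F' s p u)"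
proof (cases "finite S")
  case True
  then show ?thesis using assms
  proof (induction S)
    case empty show ?case using pfun_const[of I 0] by simp
  next
    case (insert s S)
    then show ?case using pfun_add[of I "F s" "F' s" "\<lambda>u. \<Sum>s\<in>S. F s u" "\<lambda>p u. \<Sum>s\<in>S. F' s p u"]
      by simp
  qed
next
  case False
  then show ?thesis using pfun_const[of I 0] by simp
qed

lemma pfun_partial: "pfun I F F' \<Longrightarrow> \<exists>F''. pfun I (F' p) F''"
proof (induction rule: pfun.induct)
  case (pfun_const c) show ?case by (auto intro: pfun.pfun_const)
next
  case (pfun_coord i) show ?case by (auto intro: pfun.pfun_const)
next
  case (pfun_add F F' G G') then show ?case by (blast intro: pfun.pfun_add)
next
  case (pfun_mult F F' G G')
  then obtain F'' G'' where "pfun I (F' p) F''" "pfun I (G' p) G''" by blast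
  from pfun.pfun_add[OF pfun.pfun_mult[OF this(1) pfun_mult(2)] pfun.pfun_mult[OF pfun_mult(1) this(2)]]
  show ?case by blast
qed

lemma pfun_measurable:
  "pfun I F F' \<Longrightarrow> F \<in> borel_measurable (\<Pi>\<^sub>M i\<in>I. wgauss \<mu>)"
proof (induction rule: pfun.induct)
  case (pfun_coord i)
  have "(\<lambda>u. u i) \<in> measurable (\<Pi>\<^sub>M i\<in>I. wgauss \<mu>) (wgauss \<mu>)"
    by (rule measurable_component_singleton[OF pfun_coord])
  then have "(\<lambda>u. u i) \<in> borel_measurable (\<Pi>\<^sub>M i\<in>I. wgauss \<mu>)"
    by (simp cong: measurable_cong_sets)
  then show ?case by measurable
qed auto

lemma prod_one_plus_ge_1:
  assumes "finite I"
  shows "1 \<le> (\<Prod>i\<in>I. 1 + (u i)\<^sup>2 :: real)"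
  using assms by (intro prod_ge_1) auto

text \<open>A bound of product form, so that integrability reduces to one-dimensional moments.\<close>

lemma pfun_growth:
  assumes I: "finite I"
  shows "pfun I F F' \<Longrightarrow> \<exists>C m. C \<ge> 0 \<and> (\<forall>u. norm (F u) \<le> C * (\<Prod>i\<in>I. 1 + (u i)\<^sup>2) ^ m)"
proof (induction rule: pfun.induct)
  case (pfun_const c) show ?case by (rule exI[of _ "norm c"], rule exI[of _ 0]) simp
next
  case (pfun_coord i)
  have "\<bar>u i\<bar> \<le> (\<Prod>i\<in>I. 1 + (u i)\<^sup>2)" for u :: "'a \<Rightarrow> real"
  proof -
    have "0 \<le> (\<bar>u i\<bar> - 1)\<^sup>2" by simp
    then have "\<bar>u i\<bar> \<le> 1 + (u i)\<^sup>2" unfolding power2_diff by simp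
    also have "\<dots> = (1 + (u i)\<^sup>2) * 1" by simp
    also have "\<dots> \<le> (1 + (u i)\<^sup>2) * (\<Prod>i\<in>I-{i}. 1 + (u i)\<^sup>2)"
      by (rule mult_left_mono[OF prod_one_plus_ge_1]) (use I in auto)
    also have "\<dots> = (\<Prod>i\<in>I. 1 + (u i)\<^sup>2)"
      using I pfun_coord by (simp add: prod.remove)
    finally show ?thesis .
  qed
  then show ?case by (intro exI[of _ 1]) auto
next
  case (pfun_add F F' G G')
  then obtain C m D l where CD: "C \<ge> 0" "D \<ge> 0"
    and F: "\<And>u. norm (F u) \<le> C * (\<Prod>i\<in>I. 1 + (u i)\<^sup>2) ^ m"
    and G: "\<And>u. norm (G u) \<le> D * (\<Prod>i\<in>I. 1 + (u i)\<^sup>2) ^ l" by metis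
  have "norm (F u + G u) \<le> (C + D) * (\<Prod>i\<in>I. 1 + (u i)\<^sup>2) ^ (max m l)" for u
  proof -
    have "norm (F u + G u) \<le> norm (F u) + norm (G u)" by (rule norm_triangle_ineq)
    also have "norm (F u) \<le> C * (\<Prod>i\<in>I. 1 + (u i)\<^sup>2) ^ (max m l)"
      by (rule order.trans[OF F mult_left_mono[OF power_increasing]])
         (use CD prod_one_plus_ge_1[OF I] in auto)
    also have "norm (G u) \<le> D * (\<Prod>i\<in>I. 1 + (u i)\<^sup>2) ^ (max m l)"
      by (rule order.trans[OF G mult_left_mono[OF power_increasing]])
         (use CD prod_one_plus_ge_1[OF I] in auto)
    finally show ?thesis by (simp add: distrib_right)
  qed
  then show ?case using CD by (intro exI[of _ "C + D"] exI[of _ "max m l"]) auto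
next
  case (pfun_mult F F' G G')
  then obtain C m D l where CD: "C \<ge> 0" "D \<ge> 0"
    and F: "\<And>u. norm (F u) \<le> C * (\<Prod>i\<in>I. 1 + (u i)\<^sup>2) ^ m"
    and G: "\<And>u. norm (G u) \<le> D * (\<Prod>i\<in>I. 1 + (u i)\<^sup>2) ^ l" by metis
  have "norm (F u * G u) \<le> (C * D) * (\<Prod>i\<in>I. 1 + (u i)\<^sup>2) ^ (m + l)" for u
    using mult_mono[OF F G, of u u] CD prod_one_plus_ge_1[OF I, of u]
    by (simp add: norm_mult power_add mult_ac)
  then show ?case using CD by (intro exI[of _ "C * D"] exI[of _ "m + l"]) auto
qed

lemma pfun_integrable:
  assumes I: "finite I" and \<mu>: "\<mu> \<ge> 0" and F: "pfun I F F'"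
  shows "integrable (\<Pi>\<^sub>M i\<in>I. wgauss \<mu>) F"
proof -
  interpret product_sigma_finite "\<lambda>_::'a. wgauss \<mu>"
    unfolding product_sigma_finite_def
    by (auto intro: finite_measure.axioms(1) finite_measure_wgauss[OF \<mu>])
  obtain C m where C: "C \<ge> 0" and b: "\<And>u. norm (F u) \<le> C * (\<Prod>i\<in>I. 1 + (u i)\<^sup>2) ^ m"
    using pfun_growth[OF I F] by metis
  have "integrable (wgauss \<mu>) (poly ([:1, 0, 1:] ^ m :: real poly))"
    using wgauss_poly[OF \<mu>] by (auto simp: has_bochner_integral_iff)
  then have "integrable (wgauss \<mu>) (\<lambda>t. (1 + t\<^sup>2) ^ m)"
    by (simp add: poly_power[abs_def] power2_eq_square cong: integrable_cong)
  then have "integrable (\<Pi>\<^sub>M i\<in>I. wgauss \<mu>) (\<lambda>u. \<Prod>i\<in>I. (1 + (u i)\<^sup>2) ^ m)"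
    by (intro product_integrable_prod) (use I in auto)
  then have "integrable (\<Pi>\<^sub>M i\<in>I. wgauss \<mu>) (\<lambda>u. C * (\<Prod>i\<in>I. 1 + (u i)\<^sup>2) ^ m)"
    by (simp add: prod_power_distrib)
  then show ?thesis
    by (rule Bochner_Integration.integrable_bound)
       (use pfun_measurable[OF F] C in \<open>auto intro!: AE_I2 order.trans[OF b] mult_left_mono simp: abs_mult\<close>)
qed

text \<open>Along each coordinate line the function is an honest polynomial, with \<open>F'\<close> as its derivative; this
is what reduces integration by parts to one variable.\<close>

lemma pfun_slice:
  "pfun I F F' \<Longrightarrow> \<exists>q. \<forall>t. F (u(p := t)) = poly q (of_real t) \<and>
      F' p (u(p := t)) = poly (pderiv q) (of_real t)"
proof (induction rule: pfun.induct)
  case (pfun_const c) show ?case by (rule exI[of _ "[:c:]"]) auto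
next
  case (pfun_coord i)
  show ?case
  proof (cases "i = p")
    case True then show ?thesis by (intro exI[of _ "[:0, 1:]"]) (auto simp: pderiv_pCons)
  next
    case False then show ?thesis by (intro exI[of _ "[:of_real (u i):]"]) auto
  qed
next
  case (pfun_add F F' G G')
  then obtain q r where "\<forall>t. F (u(p := t)) = poly q (of_real t) \<and> F' p (u(p := t)) = poly (pderiv q) (of_real t)"
    "\<forall>t. G (u(p := t)) = poly r (of_real t) \<and> G' p (u(p := t)) = poly (pderiv r) (of_real t)" by metis
  then show ?case by (intro exI[of _ "q + r"]) (simp add: pderiv_add del: fun_upd_apply)
next
  case (pfun_mult F F' G G')
  then obtain q r where "\<forall>t. F (u(p := t)) = poly q (of_real t) \<and> F' p (u(p := t)) = poly (pderiv q) (of_real t)"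
    "\<forall>t. G (u(p := t)) = poly r (of_real t) \<and> G' p (u(p := t)) = poly (pderiv r) (of_real t)" by metis
  then show ?case by (intro exI[of _ "q * r"]) (simp add: pderiv_mult del: fun_upd_apply)
qed

text \<open>Both sides are linear in the coefficients, so this is the moment recursion
\<open>m\<^sub>i\<^sub>+\<^sub>2 = (i + 1)/2 m\<^sub>i\<close> of the Gaussian.\<close>

lemma gauss_stein_poly:
  fixes q :: "complex poly"
  shows "(\<integral>t. of_real t * poly q (of_real t) \<partial>wgauss 0) = 1/2 * (\<integral>t. poly (pderiv q) (of_real t) \<partial>wgauss 0)"
proof -
  have m: "has_bochner_integral (wgauss 0) (\<lambda>t. complex_of_real (t ^ k)) (of_real (mom 0 k))" for k
    by (rule has_bochner_integral_of_real[OF wgauss_moment]) simp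
  have 1: "(\<integral>t. of_real t * poly q (of_real t) \<partial>wgauss 0) = (\<Sum>i\<le>degree q. coeff q i * of_real (mom 0 (Suc i)))"
  proof -
    have eq: "(\<lambda>t. complex_of_real t * poly q (of_real t)) = (\<lambda>t. \<Sum>i\<le>degree q. coeff q i * of_real (t ^ Suc i))"
      by (simp add: poly_altdef fun_eq_iff sum_distrib_left mult_ac)
    show ?thesis unfolding eq
      by (intro has_bochner_integral_integral_eq has_bochner_integral_sum has_bochner_integral_mult_right m)
  qed
  have 2: "(\<integral>t. poly (pderiv q) (of_real t) \<partial>wgauss 0) = (\<Sum>i<degree q. of_nat (Suc i) * coeff q (Suc i) * of_real (mom 0 i))"
  proof -
    have "poly (pderiv q) x = (\<Sum>i<degree q. of_nat (Suc i) * coeff q (Suc i) * x ^ i)" for x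
    proof (cases "degree q = 0")
      case True then show ?thesis by (auto elim!: degree_eq_zeroE)
    next
      case False
      then have "{..degree q - 1} = {..<degree q}" by auto
      then show ?thesis by (simp add: poly_altdef degree_pderiv coeff_pderiv)
    qed
    then have "(\<lambda>t. poly (pderiv q) (complex_of_real t)) = (\<lambda>t. \<Sum>i<degree q. of_nat (Suc i) * coeff q (Suc i) * of_real (t ^ i))"
      by (simp add: fun_eq_iff)
    then show ?thesis using m
      by (auto intro!: has_bochner_integral_integral_eq has_bochner_integral_sum has_bochner_integral_mult_right
        simp del: of_real_power)
  qed
  have r: "mom 0 (Suc (Suc i)) = real (Suc i) / 2 * mom 0 i" for i
    using mom_even_rec[of 0 i] mom_odd[of i 0] mom_odd[of "Suc (Suc i)" 0] by (cases "even i") auto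
  have "(\<Sum>i\<le>degree q. coeff q i * of_real (mom 0 (Suc i))) =
      (\<Sum>i<degree q. coeff q (Suc i) * of_real (mom 0 (Suc (Suc i))))"
    by (simp add: sum.atMost_shift mom_odd)
  also have "\<dots> = 1/2 * (\<Sum>i<degree q. of_nat (Suc i) * coeff q (Suc i) * of_real (mom 0 i))"
    unfolding r by (simp add: sum_distrib_left mult_ac sum_divide_distrib del: of_nat_Suc)
  finally show ?thesis using 1 2 by simp
qed

lemma gauss_stein:
  assumes I: "finite I" and F: "pfun I F F'" and p: "p \<in> I"
  shows "(\<integral>u. of_real (u p) * F u \<partial>(\<Pi>\<^sub>M i\<in>I. wgauss 0)) = 1/2 * (\<integral>u. F' p u \<partial>(\<Pi>\<^sub>M i\<in>I. wgauss 0))"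
proof -
  interpret product_sigma_finite "\<lambda>_::'a. wgauss 0"
    unfolding product_sigma_finite_def
    by (auto intro: finite_measure.axioms(1) finite_measure_wgauss)
  define J where "J = I - {p}"
  have J: "finite J" "p \<notin> J" "insert p J = I" using I p by (auto simp: J_def)
  obtain F'' where F'': "pfun I (F' p) F''" using pfun_partial[OF F] by blast
  have int1: "integrable (\<Pi>\<^sub>M i\<in>insert p J. wgauss 0) (\<lambda>u. of_real (u p) * F u)"
    unfolding J by (rule pfun_integrable[OF I _ pfun_mult[OF pfun_coord[OF p] F]]) simp
  have int2: "integrable (\<Pi>\<^sub>M i\<in>insert p J. wgauss 0) (F' p)"
    unfolding J by (rule pfun_integrable[OF I _ F'']) simp
  have inner: "(\<integral>t. of_real ((u(p := t)) p) * F (u(p := t)) \<partial>wgauss 0) = 1/2 * (\<integral>t. F' p (u(p := t)) \<partial>wgauss 0)" for u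
  proof -
    obtain q where "\<forall>t. F (u(p := t)) = poly q (of_real t) \<and> F' p (u(p := t)) = poly (pderiv q) (of_real t)"
      using pfun_slice[OF F] by metis
    then show ?thesis by (simp add: gauss_stein_poly)
  qed
  show ?thesis
    using product_integral_insert[OF J(1,2) int1] product_integral_insert[OF J(1,2) int2]
    unfolding J inner by simp
qed

section \<open>Loop equations and the uniqueness of their solution\<close>

definition tmon :: "(nat \<Rightarrow> 'a :: comm_monoid_mult) \<Rightarrow> nat list \<Rightarrow> 'a" where
  "tmon t L = prod_list (map t L)"

lemma tmon_simps [simp]: "tmon t [] = 1" "tmon t (a # L) = t a * tmon t L"
  by (simp_all add: tmon_def)

text \<open>The Leibniz rule for a derivation \<open>D\<close> with \<open>D t\<^sub>a = a t\<^bsub>a - 1 + k\<^esub>\<close>: the monomial with index list \<open>L\<close>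
has as derivative the sum of \<open>c\<close> times the monomial of \<open>M\<close> over the pairs \<open>(c, M)\<close>. For
\<open>a = 0\<close> the coefficient vanishes, so that the truncated difference \<open>a - 1\<close> is harmless.\<close>

fun grad_terms :: "nat \<Rightarrow> nat list \<Rightarrow> (nat \<times> nat list) list" where
  "grad_terms k [] = []"
| "grad_terms k (a # L) = (a, (a - 1 + k) # L) # map (\<lambda>(c, M). (c, a # M)) (grad_terms k L)"

text \<open>The loop equations for a functional \<open>\<Phi>\<close> on monomials in symbols \<open>t\<^sub>0, t\<^sub>1, \<dots>\<close>. To be
thought of as \<open>\<Phi> [a, b, \<dots>] = E (tr X^a tr X^b \<dots>)\<close> for a random \<open>n \<times> n\<close> matrix with Gaussian weight; the
third clause expresses \<open>E (tr X^(k+1) \<dots>)\<close> by integration by parts.\<close>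

definition loop_solution :: "nat \<Rightarrow> (nat list \<Rightarrow> complex) \<Rightarrow> bool" where
  "loop_solution n \<Phi> \<longleftrightarrow>
     (\<forall>L L'. mset L = mset L' \<longrightarrow> \<Phi> L = \<Phi> L') \<and>
     (\<forall>L. \<Phi> (0 # L) = of_nat n * \<Phi> L) \<and>
     (\<forall>k L. 2 * \<Phi> (Suc k # L) = (\<Sum>a<k. \<Phi> (a # (k - 1 - a) # L)) +
        (\<Sum>(c, M)\<leftarrow>grad_terms k L. of_nat c * \<Phi> M))"

lemma grad_terms_degree: "(c, M) \<in> set (grad_terms k L) \<Longrightarrow> sum_list M \<le> sum_list L + k"
proof (induction L arbitrary: c M)
  case (Cons a L)
  then consider "M = (a - 1 + k) # L" | M' where "M = a # M'" "(c, M') \<in> set (grad_terms k L)"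
    by auto
  then show ?case using Cons.IH by cases fastforce+
qed simp

text \<open>The third loop equation replaces a monomial containing some \<open>t\<^bsub>k+1\<^esub>\<close> by monomials of smaller total
degree, and the first two remove the remaining factors \<open>t\<^sub>0\<close>.\<close>

lemma loop_solution_zero:
  assumes X: "loop_solution n X" and X0: "X [] = 0"
  shows "X L = 0"
proof (induction "sum_list L" arbitrary: L rule: less_induct)
  case less
  have IH: "X M = 0" if "sum_list M < sum_list L" for M using less that by blast
  show ?case
  proof (cases "\<exists>k. Suc k \<in> set L")
    case True
    then obtain k where k: "Suc k \<in> set L" by blast
    define R where "R = remove1 (Suc k) L"
    have m: "mset L = mset (Suc k # R)" using k by (simp add: R_def)
    then have s: "sum_list L = Suc k + sum_list R"
      by (metis sum_mset_sum_list sum_list.Cons)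
    have "X L = X (Suc k # R)" using X m unfolding loop_solution_def by blast
    moreover have "2 * X (Suc k # R) = (\<Sum>a<k. X (a # (k - 1 - a) # R)) +
        (\<Sum>(c, M)\<leftarrow>grad_terms k R. of_nat c * X M)"
      using X unfolding loop_solution_def by blast
    moreover have "(\<Sum>a<k. X (a # (k - 1 - a) # R)) = 0"
      by (intro sum.neutral ballI IH) (auto simp: s)
    moreover have "(\<lambda>(c, M). of_nat c * X M) x = 0" if "x \<in> set (grad_terms k R)" for x
      using IH[of "snd x"] grad_terms_degree[of "fst x" "snd x" k R] s that
      by (simp add: case_prod_unfold)
    then have "map (\<lambda>(c, M). of_nat c * X M) (grad_terms k R) = map (\<lambda>_. 0) (grad_terms k R)"
      by (intro map_cong refl)
    then have "(\<Sum>(c, M)\<leftarrow>grad_terms k R. of_nat c * X M) = 0" by (simp only: sum_list_0)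
    ultimately show ?thesis by simp
  next
    case False
    then have "\<forall>x\<in>set L. x = 0" by (metis not0_implies_Suc)
    then show ?thesis
    proof (induction L)
      case Nil show ?case by (rule X0)
    next
      case (Cons a L)
      then have "a = 0" "X L = 0" by auto
      moreover have "X (0 # L) = of_nat n * X L" using X unfolding loop_solution_def by blast
      ultimately show ?case by simp
    qed
  qed
qed

lemma loop_solution_unique:
  assumes \<Phi>: "loop_solution n \<Phi>" and \<Psi>: "loop_solution n \<Psi>"
  shows "\<Phi> L * \<Psi> [] = \<Psi> L * \<Phi> []"
proof -
  define X where "X L = \<Phi> L * \<Psi> [] - \<Psi> L * \<Phi> []" for L
  have "loop_solution n X"
    unfolding loop_solution_def
  proof (intro conjI allI impI)
    fix L L' :: "nat list" assume "mset L = mset L'"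
    then have "\<Phi> L = \<Phi> L'" "\<Psi> L = \<Psi> L'"
      using \<Phi> \<Psi> unfolding loop_solution_def by blast+
    then show "X L = X L'" unfolding X_def by simp
  next
    fix L
    have "\<Phi> (0 # L) = of_nat n * \<Phi> L" "\<Psi> (0 # L) = of_nat n * \<Psi> L"
      using \<Phi> \<Psi> unfolding loop_solution_def by blast+
    then show "X (0 # L) = of_nat n * X L" unfolding X_def by (simp add: algebra_simps)
  next
    fix k L
    have 1: "2 * \<Phi> (Suc k # L) = (\<Sum>a<k. \<Phi> (a # (k - 1 - a) # L)) + (\<Sum>(c, M)\<leftarrow>grad_terms k L. of_nat c * \<Phi> M)"
      using \<Phi> unfolding loop_solution_def by blast
    have 2: "2 * \<Psi> (Suc k # L) = (\<Sum>a<k. \<Psi> (a # (k - 1 - a) # L)) + (\<Sum>(c, M)\<leftarrow>grad_terms k L. of_nat c * \<Psi> M)"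
      using \<Psi> unfolding loop_solution_def by blast
    have s: "(\<Sum>(c, M)\<leftarrow>T. of_nat c * X M) = (\<Sum>(c, M)\<leftarrow>T. of_nat c * \<Phi> M) * \<Psi> []
       - (\<Sum>(c, M)\<leftarrow>T. of_nat c * \<Psi> M) * \<Phi> []" for T :: "(nat \<times> nat list) list"
      by (induction T) (auto simp: X_def algebra_simps)
    have "2 * X (Suc k # L) = (2 * \<Phi> (Suc k # L)) * \<Psi> [] - (2 * \<Psi> (Suc k # L)) * \<Phi> []"
      by (simp add: X_def algebra_simps)
    then show "2 * X (Suc k # L) = (\<Sum>a<k. X (a # (k - 1 - a) # L)) + (\<Sum>(c, M)\<leftarrow>grad_terms k L. of_nat c * X M)"
      unfolding 1 2 s by (simp add: X_def sum_subtractf sum_distrib_left sum_distrib_right algebra_simps)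
  qed
  moreover have "X [] = 0" by (simp add: X_def)
  ultimately have "X L = 0" by (rule loop_solution_zero)
  then show ?thesis by (simp add: X_def)
qed

text \<open>The loop equations come from integrating by parts along the vector fields \<open>V k\<close>, against a
polynomial weight \<open>W\<close>. Three identities are needed: pairing \<open>V k\<close> with the position gives \<open>t\<^bsub>k+1\<^esub>\<close>, its
action on the \<open>t\<^sub>a\<close> is the derivation above, and the divergence of \<open>W V k\<close> splits into products \<open>t\<^sub>a t\<^bsub>k-1-a\<^esub>\<close>.
For matrices \<open>V k\<close> is \<open>X \<mapsto> X^k\<close> with \<open>W = 1\<close>; for eigenvalues it is \<open>x\<^sub>i \<mapsto> x\<^sub>i^k\<close> with \<open>W\<close> the squared
Vandermonde product.\<close>

lemma gauss_loop_solution: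
  fixes t :: "nat \<Rightarrow> ('i \<Rightarrow> real) \<Rightarrow> complex"
  assumes I: "finite I"
    and t: "\<And>k. pfun I (t k) (t' k)"
    and W: "pfun I W W'"
    and V: "\<And>k p. p \<in> I \<Longrightarrow> pfun I (V k p) (V' k p)"
    and t0: "\<And>u. t 0 u = of_nat n"
    and euler: "\<And>k u. (\<Sum>p\<in>I. of_real (u p) * V k p u) = t (Suc k) u"
    and grad: "\<And>k a u. (\<Sum>p\<in>I. V k p u * t' a p u) = of_nat a * t (a - 1 + k) u"
    and diver: "\<And>k u. (\<Sum>p\<in>I. V k p u * W' p u) + W u * (\<Sum>p\<in>I. V' k p p u)
        = W u * (\<Sum>a<k. t a u * t (k - 1 - a) u)"
  shows "loop_solution n (\<lambda>L. \<integral>u. W u * tmon (\<lambda>k. t k u) L \<partial>(\<Pi>\<^sub>M i\<in>I. wgauss 0))"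
proof -
  let ?G = "\<Pi>\<^sub>M i\<in>I. wgauss 0"
  \<comment> \<open>The action of the vector fields on monomials, by the Leibniz rule.\<close>
  have mon: "\<exists>m'. pfun I (\<lambda>u. tmon (\<lambda>k. t k u) L) m' \<and>
      (\<forall>k u. (\<Sum>p\<in>I. V k p u * m' p u) = (\<Sum>(c, M)\<leftarrow>grad_terms k L. of_nat c * tmon (\<lambda>k. t k u) M))" for L
  proof (induction L)
    case Nil
    show ?case by (rule exI[of _ "\<lambda>p u. 0"]) (simp add: pfun_const)
  next
    case (Cons a L)
    from Cons.IH obtain m' where m': "pfun I (\<lambda>u. tmon (\<lambda>k. t k u) L) m'"
      and g: "\<forall>k u. (\<Sum>p\<in>I. V k p u * m' p u) = (\<Sum>(c, M)\<leftarrow>grad_terms k L. of_nat c * tmon (\<lambda>k. t k u) M)" by (elim exE conjE)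
    have "pfun I (\<lambda>u. tmon (\<lambda>k. t k u) (a # L)) (\<lambda>p u. t' a p u * tmon (\<lambda>k. t k u) L + t a u * m' p u)"
      using pfun_mult[OF t[of a] m'] by simp
    moreover have "(\<Sum>p\<in>I. V k p u * (t' a p u * tmon (\<lambda>k. t k u) L + t a u * m' p u))
       = (\<Sum>(c, M)\<leftarrow>grad_terms k (a # L). of_nat c * tmon (\<lambda>k. t k u) M)" for k u
    proof -
      have "(\<Sum>p\<in>I. V k p u * (t' a p u * tmon (\<lambda>k. t k u) L + t a u * m' p u)) =
        (\<Sum>p\<in>I. V k p u * t' a p u) * tmon (\<lambda>k. t k u) L + t a u * (\<Sum>p\<in>I. V k p u * m' p u)"
        by (simp add: sum_distrib_left sum_distrib_right sum.distrib distrib_left distrib_right mult_ac add_ac)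
      also have "\<dots> = of_nat a * t (a - 1 + k) u * tmon (\<lambda>k. t k u) L
         + (\<Sum>(c, M)\<leftarrow>map (\<lambda>(c, M). (c, a # M)) (grad_terms k L). of_nat c * tmon (\<lambda>k. t k u) M)"
        unfolding grad g[rule_format]
        by (simp add: sum_list_const_mult[symmetric] o_def case_prod_unfold mult_ac)
      finally show ?thesis by (simp add: mult_ac)
    qed
    ultimately show ?case by (intro exI conjI allI)
  qed
  have int: "integrable ?G (\<lambda>u. W u * tmon (\<lambda>k. t k u) L)" for L
  proof -
    obtain m' where m': "pfun I (\<lambda>u. tmon (\<lambda>k. t k u) L) m'" using mon[of L] by (elim exE conjE)
    show ?thesis by (rule pfun_integrable[OF I order.refl pfun_mult[OF W m']])
  qed
  show ?thesis
    unfolding loop_solution_def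
  proof (intro conjI allI impI)
    fix L L' :: "nat list" assume "mset L = mset L'"
    then have "mset (map f L) = mset (map f L')" for f :: "nat \<Rightarrow> complex" by simp
    then have "tmon f L = tmon f L'" for f :: "nat \<Rightarrow> complex"
      unfolding tmon_def by (metis prod_mset_prod_list)
    then show "(\<integral>u. W u * tmon (\<lambda>k. t k u) L \<partial>?G) = (\<integral>u. W u * tmon (\<lambda>k. t k u) L' \<partial>?G)" by simp
  next
    fix L
    show "(\<integral>u. W u * tmon (\<lambda>k. t k u) (0 # L) \<partial>?G) = of_nat n * (\<integral>u. W u * tmon (\<lambda>k. t k u) L \<partial>?G)"
      by (simp add: t0 mult.left_commute)
  next
    fix k L
    let ?m = "\<lambda>u L. tmon (\<lambda>k. t k u) L"
    obtain m' where m': "pfun I (\<lambda>u. ?m u L) m'"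
      and g: "\<forall>k u. (\<Sum>p\<in>I. V k p u * m' p u) = (\<Sum>(c, M)\<leftarrow>grad_terms k L. of_nat c * ?m u M)"
      using mon[of L] by (elim exE conjE)
    \<comment> \<open>The partial derivatives of the component \<open>p\<close> of the vector field \<open>W m V k\<close>, where \<open>m\<close> is the monomial of \<open>L\<close>.\<close>
    define H' where "H' p = (\<lambda>q u. V' k p q u * (W u * ?m u L) + V k p u * (W' q u * ?m u L + W u * m' q u))" for p
    have H: "pfun I (\<lambda>u. V k p u * (W u * ?m u L)) (H' p)" if "p \<in> I" for p
      unfolding H'_def by (rule pfun_mult[OF V[OF that] pfun_mult[OF W m']])
    have Hi: "integrable ?G (H' p p)" if "p \<in> I" for p
      using pfun_partial[OF H[OF that], of p] pfun_integrable[OF I order.refl] by blast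
    have Hi': "integrable ?G (\<lambda>u. of_real (u p) * (V k p u * (W u * ?m u L)))" if "p \<in> I" for p
      by (rule pfun_integrable[OF I order.refl pfun_mult[OF pfun_coord[OF that] H[OF that]]])
    have "W u * ?m u (Suc k # L) = (\<Sum>p\<in>I. of_real (u p) * (V k p u * (W u * ?m u L)))" for u
      by (simp add: euler[symmetric] sum_distrib_left sum_distrib_right mult_ac)
    then have "2 * (\<integral>u. W u * ?m u (Suc k # L) \<partial>?G) = 2 * (\<Sum>p\<in>I. \<integral>u. of_real (u p) * (V k p u * (W u * ?m u L)) \<partial>?G)"
      using Hi' by (simp add: Bochner_Integration.integral_sum)
    also have "\<dots> = (\<Sum>p\<in>I. \<integral>u. H' p p u \<partial>?G)"
    proof -
      have "2 * (\<integral>u. of_real (u p) * (V k p u * (W u * ?m u L)) \<partial>?G) = (\<integral>u. H' p p u \<partial>?G)" if "p \<in> I" for p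
        unfolding gauss_stein[OF I H[OF that] that] by simp
      then show ?thesis by (simp add: sum_distrib_left)
    qed
    also have "\<dots> = (\<integral>u. (\<Sum>p\<in>I. H' p p u) \<partial>?G)"
      using Hi by (simp add: Bochner_Integration.integral_sum)
    also have "(\<lambda>u. \<Sum>p\<in>I. H' p p u) = (\<lambda>u. (\<Sum>a<k. W u * ?m u (a # (k - 1 - a) # L)) +
        (\<Sum>(c, M)\<leftarrow>grad_terms k L. of_nat c * (W u * ?m u M)))"
    proof
      fix u
      have "(\<Sum>p\<in>I. H' p p u) = ((\<Sum>p\<in>I. V k p u * W' p u) + W u * (\<Sum>p\<in>I. V' k p p u)) * ?m u L
         + W u * (\<Sum>p\<in>I. V k p u * m' p u)"
        unfolding H'_def
        by (simp add: sum_distrib_left sum_distrib_right sum.distrib distrib_left distrib_right mult_ac add_ac)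
      also have "\<dots> = (\<Sum>a<k. W u * ?m u (a # (k - 1 - a) # L)) +
        (\<Sum>(c, M)\<leftarrow>grad_terms k L. of_nat c * (W u * ?m u M))"
        unfolding diver g[rule_format]
        by (simp add: sum_distrib_left sum_distrib_right sum_list_const_mult[symmetric] case_prod_unfold mult_ac)
      finally show "(\<Sum>p\<in>I. H' p p u) = \<dots>" .
    qed
    also have "(\<integral>u. (\<Sum>a<k. W u * ?m u (a # (k - 1 - a) # L)) +
        (\<Sum>(c, M)\<leftarrow>grad_terms k L. of_nat c * (W u * ?m u M)) \<partial>?G) =
        (\<Sum>a<k. \<integral>u. W u * ?m u (a # (k - 1 - a) # L) \<partial>?G) +
        (\<Sum>(c, M)\<leftarrow>grad_terms k L. of_nat c * (\<integral>u. W u * ?m u M \<partial>?G))"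
    proof -
      have l: "has_bochner_integral ?G (\<lambda>u. \<Sum>(c, M)\<leftarrow>T. of_nat c * (W u * ?m u M))
          (\<Sum>(c, M)\<leftarrow>T. of_nat c * (\<integral>u. W u * ?m u M \<partial>?G))" for T :: "(nat \<times> nat list) list"
      proof (induction T)
        case (Cons x T)
        show ?case
          using has_bochner_integral_add[OF has_bochner_integral_mult_right[OF has_bochner_integral_integrable[OF int]] Cons]
          by (simp add: case_prod_unfold)
      qed auto
      have s: "has_bochner_integral ?G (\<lambda>u. \<Sum>a<k. W u * ?m u (a # (k - 1 - a) # L))
         (\<Sum>a<k. \<integral>u. W u * ?m u (a # (k - 1 - a) # L) \<partial>?G)"
        by (intro has_bochner_integral_sum has_bochner_integral_integrable int)
      show ?thesis
        by (rule has_bochner_integral_integral_eq[OF has_bochner_integral_add[OF s l]])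
    qed
    finally show "2 * (\<integral>u. W u * ?m u (Suc k # L) \<partial>?G) =
        (\<Sum>a<k. \<integral>u. W u * ?m u (a # (k - 1 - a) # L) \<partial>?G) +
        (\<Sum>(c, M)\<leftarrow>grad_terms k L. of_nat c * (\<integral>u. W u * ?m u M \<partial>?G))" .
  qed
qed

section \<open>Loop equations for Gaussian Hermitian matrices\<close>

text \<open>The entries of \<open>herm_of_coords\<close> as functions of the coordinate vector, for all index pairs and without
a matrix size, so that they fall under \<open>pfun\<close>.\<close>

definition hent :: "nat \<Rightarrow> nat \<Rightarrow> (nat \<times> nat \<Rightarrow> real) \<Rightarrow> complex" where
  "hent i j u = (if i = j then complex_of_real (u (i,i))
     else if i < j then Complex (u (i,j)) (u (j,i)) / complex_of_real (sqrt 2)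
     else Complex (u (j,i)) (- u (i,j)) / complex_of_real (sqrt 2))"

text \<open>The entries of the \<open>p\<close>-th element of the orthonormal basis of Hermitian matrices.\<close>

definition hcoef :: "nat \<times> nat \<Rightarrow> nat \<Rightarrow> nat \<Rightarrow> complex" where
  "hcoef p i j = hent i j (\<lambda>q. if q = p then 1 else 0)"

lemma hcoef_diag: "hcoef (a, a) c d = (if c = a \<and> d = a then 1 else 0)"
  by (auto simp: hcoef_def hent_def complex_eq_iff)

lemma hcoef_upper:
  "a < b \<Longrightarrow> hcoef (a, b) c d =
    (if c = a \<and> d = b \<or> c = b \<and> d = a then 1 / complex_of_real (sqrt 2) else 0)"
  by (auto simp: hcoef_def hent_def complex_eq_iff)

lemma hcoef_lower:
  "a < b \<Longrightarrow> hcoef (b, a) c d =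
    (if c = a \<and> d = b then \<i> / complex_of_real (sqrt 2)
     else if c = b \<and> d = a then - \<i> / complex_of_real (sqrt 2) else 0)"
  by (auto simp: hcoef_def hent_def complex_eq_iff)

lemma hcoef_support: "p \<notin> {(a, b), (b, a)} \<Longrightarrow> hcoef p a b = 0"
  by (auto simp: hcoef_def hent_def complex_eq_iff)

lemma hent_expand:
  assumes "i < n" "j < n"
  shows "hent i j u = (\<Sum>p\<in>{..<n}\<times>{..<n}. of_real (u p) * hcoef p i j)"
proof -
  have "(\<Sum>p\<in>{..<n}\<times>{..<n}. of_real (u p) * hcoef p i j) = (\<Sum>p\<in>{(i, j), (j, i)}. of_real (u p) * hcoef p i j)"
    by (rule sum.mono_neutral_right) (use assms hcoef_support in auto)
  also have "\<dots> = hent i j u"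
  proof (cases i j rule: linorder_cases)
    case equal then show ?thesis by (simp add: hcoef_diag hent_def)
  next
    case less then show ?thesis
      by (simp add: hcoef_upper hcoef_lower hent_def complex_eq_iff)
  next
    case greater then show ?thesis
      by (simp add: hcoef_upper hcoef_lower hent_def complex_eq_iff)
  qed
  finally show ?thesis ..
qed

lemma pfun_hent:
  assumes "i < n" "j < n"
  shows "pfun ({..<n}\<times>{..<n}) (hent i j) (\<lambda>p u. if p \<in> {..<n}\<times>{..<n} then hcoef p i j else 0)"
proof -
  have "pfun ({..<n}\<times>{..<n}) (\<lambda>u. \<Sum>q\<in>{..<n}\<times>{..<n}. of_real (u q) * hcoef q i j)
     (\<lambda>p u. \<Sum>q\<in>{..<n}\<times>{..<n}. (if p = q then 1 else 0) * hcoef q i j + of_real (u q) * 0)"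
    by (intro pfun_sum pfun_mult pfun_coord pfun_const)
  moreover have "(\<Sum>q\<in>{..<n}\<times>{..<n}. (if p = q then 1 else 0) * hcoef q i j + of_real (u q) * 0) =
     (if p \<in> {..<n}\<times>{..<n} then hcoef p i j else 0)" for p and u :: "nat \<times> nat \<Rightarrow> real"
  proof -
    have "(\<Sum>q\<in>{..<n}\<times>{..<n}. (if p = q then 1 else 0) * hcoef q i j + of_real (u q) * 0) =
      (\<Sum>q\<in>{..<n}\<times>{..<n}. if p = q then hcoef q i j else 0)"
      by (intro sum.cong refl) simp
    then show ?thesis by simp
  qed
  moreover have "hent i j = (\<lambda>u. \<Sum>q\<in>{..<n}\<times>{..<n}. of_real (u q) * hcoef q i j)"
    using hent_expand[OF assms] by (simp add: fun_eq_iff)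
  ultimately show ?thesis by (simp only:)
qed

text \<open>Completeness of the orthonormal basis: \<open>\<Sum>\<^sub>p (E\<^sub>p)\<^bsub>ab\<^esub> (E\<^sub>p)\<^bsub>cd\<^esub>\<close> is the kernel of the trace form. Every
sum over coordinate directions in the loop equations collapses by this identity.\<close>

lemma hcoef_complete:
  assumes "a < n" "b < n" "c < n" "d < n"
  shows "(\<Sum>p\<in>{..<n}\<times>{..<n}. hcoef p a b * hcoef p c d) = (if a = d \<and> b = c then 1 else 0)"
proof -
  let ?I = "{..<n}\<times>{..<n}"
  let ?s = "complex_of_real (sqrt 2)"
  have s: "?s * ?s = 2" by (simp flip: of_real_mult)
  have s0: "1 / ?s * (1 / ?s) = 1/2" "\<i> / ?s * (\<i> / ?s) = -1/2" "\<i> / ?s * (- \<i> / ?s) = 1/2"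
    "- \<i> / ?s * (\<i> / ?s) = 1/2" "- \<i> / ?s * (- \<i> / ?s) = -1/2"
    by (simp_all add: s)
  have "(\<Sum>p\<in>?I. hcoef p a b * hcoef p c d) = (\<Sum>p\<in>{(a, b), (b, a)}. hcoef p a b * hcoef p c d)"
    by (rule sum.mono_neutral_right) (use assms hcoef_support in auto)
  also have "\<dots> = (if a = d \<and> b = c then 1 else 0)"
  proof (cases a b rule: linorder_cases)
    case equal then show ?thesis by (simp add: hcoef_diag)
  next
    case less
    then have "(\<Sum>p\<in>{(a, b), (b, a)}. hcoef p a b * hcoef p c d) =
        1 / ?s * hcoef (a, b) c d + \<i> / ?s * hcoef (b, a) c d"
      by (simp add: hcoef_upper hcoef_lower)
    also have "\<dots> = (if a = d \<and> b = c then 1 else 0)"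
      unfolding hcoef_upper[OF less] hcoef_lower[OF less] using less s0 by auto
    finally show ?thesis .
  next
    case greater
    then have "(\<Sum>p\<in>{(a, b), (b, a)}. hcoef p a b * hcoef p c d) =
        - \<i> / ?s * hcoef (a, b) c d + 1 / ?s * hcoef (b, a) c d"
      by (simp add: hcoef_upper hcoef_lower)
    also have "\<dots> = (if a = d \<and> b = c then 1 else 0)"
      unfolding hcoef_upper[OF greater] hcoef_lower[OF greater] using greater s0 by auto
    finally show ?thesis .
  qed
  finally show ?thesis .
qed

lemma hcoef_contract:
  "(\<Sum>p\<in>{..<n}\<times>{..<n}. \<Sum>i<n. \<Sum>j<n. \<Sum>c<n. \<Sum>d<n. hcoef p i j * (hcoef p c d * F i j c d)) = (\<Sum>i<n. \<Sum>j<n. F i j j i)"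
proof -
  have "(\<Sum>p\<in>{..<n}\<times>{..<n}. \<Sum>i<n. \<Sum>j<n. \<Sum>c<n. \<Sum>d<n. hcoef p i j * (hcoef p c d * F i j c d)) =
     (\<Sum>i<n. \<Sum>j<n. \<Sum>c<n. \<Sum>d<n. \<Sum>p\<in>{..<n}\<times>{..<n}. hcoef p i j * (hcoef p c d * F i j c d))"
    by (subst sum.swap, rule sum.cong[OF refl], subst sum.swap, rule sum.cong[OF refl],
        subst sum.swap, rule sum.cong[OF refl], subst sum.swap, rule refl)
  also have "\<dots> = (\<Sum>i<n. \<Sum>j<n. \<Sum>c<n. \<Sum>d<n. (if i = d \<and> j = c then 1 else 0) * F i j c d)"
  proof (intro sum.cong refl)
    fix i j c d assume "i \<in> {..<n}" "j \<in> {..<n}" "c \<in> {..<n}" "d \<in> {..<n}"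
    then have "(\<Sum>p\<in>{..<n}\<times>{..<n}. hcoef p i j * hcoef p c d) = (if i = d \<and> j = c then 1 else 0)"
      by (intro hcoef_complete) auto
    then show "(\<Sum>p\<in>{..<n}\<times>{..<n}. hcoef p i j * (hcoef p c d * F i j c d)) = (if i = d \<and> j = c then 1 else 0) * F i j c d"
      by (simp only: mult.assoc[symmetric] sum_distrib_right[symmetric])
  qed
  also have "\<dots> = (\<Sum>i<n. \<Sum>j<n. F i j j i)"
  proof (intro sum.cong refl)
    fix i j assume ij: "i \<in> {..<n}" "j \<in> {..<n}"
    have "(\<Sum>c<n. \<Sum>d<n. (if i = d \<and> j = c then 1 else 0) * F i j c d) =
       (\<Sum>c<n. if j = c then (\<Sum>d<n. if i = d then F i j c d else 0) else 0)"
    proof (rule sum.cong[OF refl])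
      fix c
      show "(\<Sum>d<n. (if i = d \<and> j = c then 1 else 0) * F i j c d) =
          (if j = c then (\<Sum>d<n. if i = d then F i j c d else 0) else 0)"
        by (cases "j = c") (simp_all add: if_distrib[of "\<lambda>x. x * _"] cong: if_cong)
    qed
    also have "\<dots> = F i j j i" using ij by simp
    finally show "(\<Sum>c<n. \<Sum>d<n. (if i = d \<and> j = c then 1 else 0) * F i j c d) = F i j j i" .
  qed
  finally show ?thesis .
qed

text \<open>Entries of the matrix powers, by recursion on entries rather than as a power in a ring of matrices,
so that their partial derivatives are available through \<open>pfun\<close>.\<close>

fun hpow :: "nat \<Rightarrow> nat \<Rightarrow> nat \<Rightarrow> nat \<Rightarrow> (nat \<times> nat \<Rightarrow> real) \<Rightarrow> complex" where
  "hpow n 0 i j u = (if i = j then 1 else 0)"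
| "hpow n (Suc k) i j u = (\<Sum>l<n. hent i l u * hpow n k l j u)"

text \<open>The product rule \<open>\<partial>\<^sub>p X^k = \<Sum>\<^sub>a X^a E\<^sub>p X^(k-1-a)\<close>.\<close>

definition hpow_deriv :: "nat \<Rightarrow> nat \<Rightarrow> nat \<Rightarrow> nat \<Rightarrow> nat \<times> nat \<Rightarrow> (nat \<times> nat \<Rightarrow> real) \<Rightarrow> complex" where
  "hpow_deriv n k i j p u = (\<Sum>a<k. \<Sum>c<n. \<Sum>d<n. hpow n a i c u * hcoef p c d * hpow n (k - 1 - a) d j u)"

lemma hpow_add:
  assumes "i < n"
  shows "(\<Sum>c<n. hpow n a i c u * hpow n b c j u) = hpow n (a + b) i j u"
  using assms
proof (induction a arbitrary: i)
  case 0
  have "(\<Sum>c<n. hpow n 0 i c u * hpow n b c j u) = (\<Sum>c<n. if i = c then hpow n b c j u else 0)"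
    by (intro sum.cong refl) simp
  then show ?case using 0 by simp
next
  case (Suc a)
  have "(\<Sum>c<n. hpow n (Suc a) i c u * hpow n b c j u) =
      (\<Sum>l<n. \<Sum>c<n. hent i l u * (hpow n a l c u * hpow n b c j u))"
    by (subst sum.swap) (simp add: sum_distrib_right mult.assoc)
  also have "\<dots> = (\<Sum>l<n. hent i l u * (\<Sum>c<n. hpow n a l c u * hpow n b c j u))"
    by (simp add: sum_distrib_left)
  also have "\<dots> = hpow n (Suc a + b) i j u"
    using Suc.IH by simp
  finally show ?case .
qed

lemma pfun_hpow:
  assumes "i < n" "j < n"
  shows "pfun ({..<n}\<times>{..<n}) (hpow n k i j) (\<lambda>p u. if p \<in> {..<n}\<times>{..<n} then hpow_deriv n k i j p u else 0)"
  using assms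
proof (induction k arbitrary: i)
  case 0
  have "hpow n 0 i j = (\<lambda>u. if i = j then 1 else 0)" by (simp add: fun_eq_iff)
  moreover have "(\<lambda>p u. if p \<in> {..<n}\<times>{..<n} then hpow_deriv n 0 i j p u else 0) = (\<lambda>p u. 0)"
    by (simp add: fun_eq_iff hpow_deriv_def)
  ultimately show ?case using pfun_const[of _ "if i = j then 1 else 0"] by (simp only:)
next
  case (Suc k)
  let ?I = "{..<n}\<times>{..<n}"
  have "pfun ?I (\<lambda>u. \<Sum>l<n. hent i l u * hpow n k l j u)
     (\<lambda>p u. \<Sum>l<n. (if p \<in> ?I then hcoef p i l else 0) * hpow n k l j u
         + hent i l u * (if p \<in> ?I then hpow_deriv n k l j p u else 0))"
    by (intro pfun_sum pfun_mult pfun_hent Suc.IH) (use Suc.prems in auto)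
  moreover have "(\<Sum>l<n. (if p \<in> ?I then hcoef p i l else 0) * hpow n k l j u
         + hent i l u * (if p \<in> ?I then hpow_deriv n k l j p u else 0)) =
     (if p \<in> ?I then hpow_deriv n (Suc k) i j p u else 0)" for p u
  proof (cases "p \<in> ?I")
    case True
    have 1: "(\<Sum>c<n. \<Sum>d<n. hpow n 0 i c u * hcoef p c d * hpow n k d j u) = (\<Sum>l<n. hcoef p i l * hpow n k l j u)"
    proof -
      have "(\<Sum>c<n. \<Sum>d<n. hpow n 0 i c u * hcoef p c d * hpow n k d j u) =
         (\<Sum>c<n. if i = c then (\<Sum>d<n. hcoef p c d * hpow n k d j u) else 0)"
        by (intro sum.cong refl) simp
      then show ?thesis using Suc.prems by simp
    qed
    have 2: "(\<Sum>c<n. \<Sum>d<n. hpow n (Suc a) i c u * hcoef p c d * hpow n (k - 1 - a) d j u) =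
       (\<Sum>l<n. hent i l u * (\<Sum>c<n. \<Sum>d<n. hpow n a l c u * hcoef p c d * hpow n (k - 1 - a) d j u))" for a
    proof -
      have "(\<Sum>c<n. \<Sum>d<n. hpow n (Suc a) i c u * hcoef p c d * hpow n (k - 1 - a) d j u) =
        (\<Sum>c<n. \<Sum>d<n. \<Sum>l<n. hent i l u * (hpow n a l c u * hcoef p c d * hpow n (k - 1 - a) d j u))"
        by (simp add: sum_distrib_right mult.assoc)
      also have "\<dots> = (\<Sum>c<n. \<Sum>l<n. \<Sum>d<n. hent i l u * (hpow n a l c u * hcoef p c d * hpow n (k - 1 - a) d j u))"
        by (rule sum.cong[OF refl], rule sum.swap)
      also have "\<dots> = (\<Sum>l<n. \<Sum>c<n. \<Sum>d<n. hent i l u * (hpow n a l c u * hcoef p c d * hpow n (k - 1 - a) d j u))"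
        by (rule sum.swap)
      finally show ?thesis by (simp add: sum_distrib_left)
    qed
    have "hpow_deriv n (Suc k) i j p u = (\<Sum>c<n. \<Sum>d<n. hpow n 0 i c u * hcoef p c d * hpow n k d j u) +
       (\<Sum>a<k. \<Sum>c<n. \<Sum>d<n. hpow n (Suc a) i c u * hcoef p c d * hpow n (k - 1 - a) d j u)"
      unfolding hpow_deriv_def sum.lessThan_Suc_shift by simp
    also have "\<dots> = (\<Sum>l<n. hcoef p i l * hpow n k l j u) + (\<Sum>l<n. hent i l u * hpow_deriv n k l j p u)"
      unfolding 1 2 hpow_deriv_def by (subst sum.swap) (simp add: sum_distrib_left)
    finally show ?thesis using True by (simp add: sum.distrib)
  qed simp
  moreover have "hpow n (Suc k) i j = (\<lambda>u. \<Sum>l<n. hent i l u * hpow n k l j u)"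
    by (simp add: fun_eq_iff)
  ultimately show ?case by (simp only:)
qed

definition htr :: "nat \<Rightarrow> nat \<Rightarrow> (nat \<times> nat \<Rightarrow> real) \<Rightarrow> complex" where
  "htr n k u = (\<Sum>i<n. hpow n k i i u)"

text \<open>For the vector field \<open>X \<mapsto> X^k\<close>, completeness of the basis gives the divergence
\<open>\<Sum>\<^sub>a tr X^a tr X^(k-1-a)\<close> and the derivative \<open>a tr X^(a-1+k)\<close> of \<open>tr X^a\<close>. The factor \<open>1\<close> in the integrand is the weight \<open>W\<close>.\<close>

theorem loop_solution_matrices:
  "loop_solution n (\<lambda>L. \<integral>u. 1 * tmon (\<lambda>k. htr n k u) L \<partial>(\<Pi>\<^sub>M p\<in>{..<n}\<times>{..<n}. wgauss 0))"
proof -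
  let ?I = "{..<n}\<times>{..<n}"
  let ?V = "\<lambda>k p u. \<Sum>i<n. \<Sum>j<n. hcoef p i j * hpow n k j i u"
  let ?V' = "\<lambda>k p q u. \<Sum>i<n. \<Sum>j<n. 0 * hpow n k j i u + hcoef p i j * (if q \<in> ?I then hpow_deriv n k j i q u else 0)"
  \<comment> \<open>Cyclicity of the trace: the derivative of \<open>tr X^a\<close> in direction \<open>E\<^sub>p\<close> is \<open>a tr (E\<^sub>p X^(a-1))\<close>.\<close>
  have t': "(\<Sum>l<n. hpow_deriv n a l l p u) = of_nat a * ?V (a - 1) p u" for a p u
  proof -
    have "(\<Sum>l<n. hpow_deriv n a l l p u) = (\<Sum>b<a. \<Sum>l<n. \<Sum>c<n. \<Sum>d<n. hpow n b l c u * hcoef p c d * hpow n (a - 1 - b) d l u)"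
      unfolding hpow_deriv_def by (rule sum.swap)
    also have "\<dots> = (\<Sum>b<a. ?V (a - 1) p u)"
    proof (rule sum.cong[OF refl])
      fix b assume b: "b \<in> {..<a}"
      have "(\<Sum>l<n. \<Sum>c<n. \<Sum>d<n. hpow n b l c u * hcoef p c d * hpow n (a - 1 - b) d l u) =
        (\<Sum>c<n. \<Sum>l<n. \<Sum>d<n. hpow n b l c u * hcoef p c d * hpow n (a - 1 - b) d l u)"
        by (rule sum.swap)
      also have "\<dots> = (\<Sum>c<n. \<Sum>d<n. \<Sum>l<n. hpow n b l c u * hcoef p c d * hpow n (a - 1 - b) d l u)"
        by (rule sum.cong[OF refl], rule sum.swap)
      also have "\<dots> = (\<Sum>c<n. \<Sum>d<n. hcoef p c d * (\<Sum>l<n. hpow n (a - 1 - b) d l u * hpow n b l c u))"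
        by (simp add: sum_distrib_left mult_ac)
      also have "\<dots> = ?V (a - 1) p u"
        using b by (intro sum.cong refl) (auto simp: hpow_add)
      finally show "(\<Sum>l<n. \<Sum>c<n. \<Sum>d<n. hpow n b l c u * hcoef p c d * hpow n (a - 1 - b) d l u) = ?V (a - 1) p u" .
    qed
    finally show ?thesis by simp
  qed
  show ?thesis
  proof (rule gauss_loop_solution[where V="?V" and V'="?V'" and W'="\<lambda>p u. 0"])
    show "finite ?I" by simp
    show "pfun ?I (htr n k) (\<lambda>p u. \<Sum>i<n. if p \<in> ?I then hpow_deriv n k i i p u else 0)" for k
      unfolding htr_def[abs_def] by (intro pfun_sum pfun_hpow) auto
    show "pfun ?I (\<lambda>u. 1) (\<lambda>p u. 0)" by (rule pfun_const)
    show "pfun ?I (?V k p) (?V' k p)" for k p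
      by (intro pfun_sum pfun_mult pfun_const pfun_hpow) auto
    show "htr n 0 u = of_nat n" for u by (simp add: htr_def)
    show "(\<Sum>p\<in>?I. of_real (u p) * ?V k p u) = htr n (Suc k) u" for k u
    proof -
      have "(\<Sum>p\<in>?I. of_real (u p) * ?V k p u) = (\<Sum>p\<in>?I. \<Sum>i<n. \<Sum>j<n. of_real (u p) * hcoef p i j * hpow n k j i u)"
        by (simp add: sum_distrib_left mult.assoc)
      also have "\<dots> = (\<Sum>i<n. \<Sum>p\<in>?I. \<Sum>j<n. of_real (u p) * hcoef p i j * hpow n k j i u)"
        by (rule sum.swap)
      also have "\<dots> = (\<Sum>i<n. \<Sum>j<n. \<Sum>p\<in>?I. of_real (u p) * hcoef p i j * hpow n k j i u)"
        by (rule sum.cong[OF refl], rule sum.swap)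
      also have "\<dots> = (\<Sum>i<n. \<Sum>j<n. hent i j u * hpow n k j i u)"
        by (intro sum.cong refl) (simp add: hent_expand[of _ n] sum_distrib_right)
      finally show ?thesis by (simp add: htr_def)
    qed
    show "(\<Sum>p\<in>?I. ?V k p u * (\<Sum>i<n. if p \<in> ?I then hpow_deriv n a i i p u else 0)) = of_nat a * htr n (a - 1 + k) u" for k a u
    proof -
      have "(\<Sum>p\<in>?I. ?V k p u * (\<Sum>i<n. if p \<in> ?I then hpow_deriv n a i i p u else 0)) =
         (\<Sum>p\<in>?I. ?V k p u * (of_nat a * ?V (a - 1) p u))"
        by (intro sum.cong refl) (simp only: if_True t')
      also have "\<dots> = of_nat a * (\<Sum>p\<in>?I. \<Sum>i<n. \<Sum>j<n. \<Sum>c<n. \<Sum>d<n. hcoef p i j * (hcoef p c d * (hpow n k j i u * hpow n (a - 1) d c u)))"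
      proof -
        have pr: "(\<Sum>i<n. \<Sum>j<n. A i j) * (\<Sum>c<n. \<Sum>d<n. B c d) = (\<Sum>i<n. \<Sum>j<n. \<Sum>c<n. \<Sum>d<n. A i j * B c d)"
          for A B :: "nat \<Rightarrow> nat \<Rightarrow> complex"
          by (simp only: sum_distrib_right) (simp only: sum_distrib_left)
        have "?V k p u * (of_nat a * ?V (a - 1) p u) = of_nat a * (?V k p u * ?V (a - 1) p u)" for p
          by (simp only: mult.left_commute)
        then show ?thesis
          unfolding pr by (simp only: sum_distrib_left[symmetric] mult_ac)
      qed
      also have "\<dots> = of_nat a * (\<Sum>i<n. \<Sum>j<n. hpow n k j i u * hpow n (a - 1) i j u)"
        unfolding hcoef_contract ..
      also have "(\<Sum>i<n. \<Sum>j<n. hpow n k j i u * hpow n (a - 1) i j u) = (\<Sum>i<n. hpow n (a - 1 + k) i i u)"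
        by (intro sum.cong refl) (simp add: hpow_add[symmetric] mult.commute)
      finally show ?thesis by (simp add: htr_def)
    qed
    show "(\<Sum>p\<in>?I. ?V k p u * 0) + 1 * (\<Sum>p\<in>?I. ?V' k p p u) = 1 * (\<Sum>a<k. htr n a u * htr n (k - 1 - a) u)" for k u
    proof -
      have "(\<Sum>p\<in>?I. ?V' k p p u) = (\<Sum>p\<in>?I. \<Sum>i<n. \<Sum>j<n. \<Sum>a<k. \<Sum>c<n. \<Sum>d<n.
          hcoef p i j * (hcoef p c d * (hpow n a j c u * hpow n (k - 1 - a) d i u)))"
        by (intro sum.cong refl) (simp add: hpow_deriv_def sum_distrib_left mult_ac)
      also have "\<dots> = (\<Sum>p\<in>?I. \<Sum>i<n. \<Sum>a<k. \<Sum>j<n. \<Sum>c<n. \<Sum>d<n.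
          hcoef p i j * (hcoef p c d * (hpow n a j c u * hpow n (k - 1 - a) d i u)))"
        by (rule sum.cong[OF refl], rule sum.cong[OF refl], rule sum.swap)
      also have "\<dots> = (\<Sum>p\<in>?I. \<Sum>a<k. \<Sum>i<n. \<Sum>j<n. \<Sum>c<n. \<Sum>d<n.
          hcoef p i j * (hcoef p c d * (hpow n a j c u * hpow n (k - 1 - a) d i u)))"
        by (rule sum.cong[OF refl], rule sum.swap)
      also have "\<dots> = (\<Sum>a<k. \<Sum>p\<in>?I. \<Sum>i<n. \<Sum>j<n. \<Sum>c<n. \<Sum>d<n.
          hcoef p i j * (hcoef p c d * (hpow n a j c u * hpow n (k - 1 - a) d i u)))"
        by (rule sum.swap)
      also have "\<dots> = (\<Sum>a<k. \<Sum>i<n. \<Sum>j<n. hpow n a j j u * hpow n (k - 1 - a) i i u)"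
        unfolding hcoef_contract ..
      also have "\<dots> = (\<Sum>a<k. htr n a u * htr n (k - 1 - a) u)"
        unfolding htr_def sum_product by (rule sum.cong[OF refl], rule sum.swap)
      finally show ?thesis by simp
    qed
  qed
qed

section \<open>Loop equations for the squared Vandermonde weight\<close>

definition power_sum :: "nat \<Rightarrow> nat \<Rightarrow> (nat \<Rightarrow> real) \<Rightarrow> complex" where
  "power_sum n k x = (\<Sum>i<n. of_real (x i) ^ k)"

text \<open>The squared Vandermonde product as a complex function, since \<open>pfun\<close> is complex-valued.\<close>

definition vdm2 :: "nat \<Rightarrow> (nat \<Rightarrow> real) \<Rightarrow> complex" where
  "vdm2 n x = (\<Prod>(i, j)\<in>{(i, j). i < j \<and> j < n}. (of_real (x j) - of_real (x i))\<^sup>2)"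

lemma finite_pairs: "finite {(i, j). i < j \<and> j < (n::nat)}"
  by (rule finite_subset[of _ "{..<n} \<times> {..<n}"]) auto

lemma pfun_power_coord:
  assumes "i \<in> I"
  shows "pfun I (\<lambda>u. of_real (u i) ^ k) (\<lambda>p u. if p = i then of_nat k * of_real (u i) ^ (k - 1) else 0)"
proof (induction k)
  case 0
  have "(\<lambda>p u. if p = i then of_nat 0 * complex_of_real (u i) ^ (0 - 1) else 0) = (\<lambda>p u. 0)"
    by (simp add: fun_eq_iff)
  then show ?case using pfun_const[of I 1] by (simp only: power_0)
next
  case (Suc k)
  have *: "(\<lambda>p u. (if p = i then 1 else 0) * of_real (u i) ^ k +
        complex_of_real (u i) * (if p = i then of_nat k * of_real (u i) ^ (k - 1) else 0))
     = (\<lambda>p u. if p = i then of_nat (Suc k) * of_real (u i) ^ (Suc k - 1) else 0)"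
    by (cases k) (auto simp: fun_eq_iff algebra_simps)
  show ?case using pfun_mult[OF pfun_coord[OF assms] Suc] unfolding * by simp
qed

lemma sum_offdiag:
  fixes g :: "nat \<Rightarrow> nat \<Rightarrow> complex"
  shows "(\<Sum>i<n. \<Sum>j<n. g i j) = (\<Sum>i<n. g i i) + (\<Sum>(i, j)\<in>{(i, j). i < j \<and> j < n}. g i j + g j i)"
proof (induction n)
  case (Suc n)
  have S: "{(i, j). i < j \<and> j < Suc n} = {(i, j). i < j \<and> j < n} \<union> (\<lambda>i. (i, n)) ` {..<n}"
    by (auto simp: less_Suc_eq)
  have "(\<Sum>(i, j)\<in>{(i, j). i < j \<and> j < Suc n}. g i j + g j i) =
      (\<Sum>(i, j)\<in>{(i, j). i < j \<and> j < n}. g i j + g j i) + (\<Sum>i<n. g i n + g n i)"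
    unfolding S
    by (subst sum.union_disjoint) (auto simp: finite_pairs sum.reindex inj_on_def)
  then show ?case using Suc by (simp add: sum.distrib algebra_simps)
qed simp

text \<open>Each factor contributes \<open>2 (x\<^sub>j^k - x\<^sub>i^k) / (x\<^sub>j - x\<^sub>i)\<close> to the logarithmic derivative along
\<open>x\<^sub>p \<mapsto> x\<^sub>p^k\<close>. The statement is proved for products over arbitrary sets of pairs, one factor at a time.\<close>

lemma power_vector_field_vdm2:
  "\<exists>W'. pfun {..<n} (vdm2 n) W' \<and> (\<forall>k u. (\<Sum>p<n. of_real (u p) ^ k * W' p u) =
     vdm2 n u * (\<Sum>(i, j)\<in>{(i, j). i < j \<and> j < n}. 2 * (\<Sum>a<k. of_real (u i) ^ (k - 1 - a) * of_real (u j) ^ a)))"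
proof -
  let ?h = "\<lambda>k u (i, j). 2 * (\<Sum>a<k. complex_of_real (u i) ^ (k - 1 - a) * of_real (u j) ^ a)"
  let ?f = "\<lambda>u (i, j). (complex_of_real (u j) - of_real (u i))\<^sup>2"
  have "\<exists>W'. pfun {..<n} (\<lambda>u. \<Prod>x\<in>S. ?f u x) W' \<and> (\<forall>k u. (\<Sum>p<n. of_real (u p) ^ k * W' p u) =
     (\<Prod>x\<in>S. ?f u x) * (\<Sum>x\<in>S. ?h k u x))"
    if "finite S" "S \<subseteq> {(i, j). i < j \<and> j < n}" for S :: "(nat \<times> nat) set"
    using that
  proof (induction S)
    case empty
    then show ?case using pfun_const[of "{..<n}" 1] by (intro exI[of _ "\<lambda>p u. 0"]) simp
  next
    case (insert x S)
    then have "S \<subseteq> {(i, j). i < j \<and> j < n}" by simp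
    from insert.IH[OF this] obtain W' where W: "pfun {..<n} (\<lambda>u. \<Prod>x\<in>S. ?f u x) W'"
      and W': "\<forall>k u. (\<Sum>p<n. of_real (u p) ^ k * W' p u) = (\<Prod>x\<in>S. ?f u x) * (\<Sum>x\<in>S. ?h k u x)"
      by (elim exE conjE)
    obtain i j where x: "x = (i, j)" and ij: "i < j" "j < n" using insert.prems by auto
    let ?e = "\<lambda>p u. ((if p = j then 1 else 0) + ((0::complex) * of_real (u i) + (-1) * (if p = i then 1 else 0)))"
    let ?d = "\<lambda>u. of_real (u j) + (-1) * complex_of_real (u i)"
    have d: "pfun {..<n} ?d ?e"
      using ij by (intro pfun_add pfun_mult pfun_const pfun_coord) auto
    have f: "?f u x = ?d u * ?d u" for u by (simp add: x power2_eq_square)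
    have P: "pfun {..<n} (\<lambda>u. ?d u * ?d u * (\<Prod>x\<in>S. ?f u x))
        (\<lambda>p u. (?e p u * ?d u + ?d u * ?e p u) * (\<Prod>x\<in>S. ?f u x) + (?d u * ?d u) * W' p u)"
      by (rule pfun_mult[OF pfun_mult[OF d d] W])
    have e: "(\<Sum>p<n. of_real (u p) ^ k * ?e p u) = ?d u * (\<Sum>a<k. of_real (u i) ^ (k - 1 - a) * of_real (u j) ^ a)" for k and u :: "nat \<Rightarrow> real"
    proof -
      have "(\<Sum>p<n. of_real (u p) ^ k * ?e p u) = (\<Sum>p<n. (if p = j then complex_of_real (u p) ^ k else 0) - (if p = i then of_real (u p) ^ k else 0))"
        by (intro sum.cong) auto
      also have "\<dots> = of_real (u j) ^ k - of_real (u i) ^ k"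
        using ij by (simp add: sum_subtractf sum.delta)
      also have "\<dots> = (of_real (u j) - of_real (u i)) * (\<Sum>a<k. of_real (u i) ^ (k - Suc a) * of_real (u j) ^ a)"
        by (rule power_diff_sumr2)
      finally show ?thesis by simp
    qed
    have "(\<Sum>p<n. of_real (u p) ^ k * ((?e p u * ?d u + ?d u * ?e p u) * (\<Prod>x\<in>S. ?f u x) + (?d u * ?d u) * W' p u))
       = (?d u * ?d u * (\<Prod>x\<in>S. ?f u x)) * (\<Sum>x\<in>insert x S. ?h k u x)" for k u
    proof -
      have "(\<Sum>p<n. of_real (u p) ^ k * ((?e p u * ?d u + ?d u * ?e p u) * (\<Prod>x\<in>S. ?f u x) + (?d u * ?d u) * W' p u))
        = (\<Sum>p<n. 2 * ?d u * (\<Prod>x\<in>S. ?f u x) * (of_real (u p) ^ k * ?e p u) + ?d u * ?d u * (of_real (u p) ^ k * W' p u))"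
        by (intro sum.cong refl) (simp only: algebra_simps mult_2)
      also have "\<dots> = 2 * ?d u * (\<Prod>x\<in>S. ?f u x) * (\<Sum>p<n. of_real (u p) ^ k * ?e p u) + ?d u * ?d u * (\<Sum>p<n. of_real (u p) ^ k * W' p u)"
        by (simp only: sum.distrib sum_distrib_left)
      also have "\<dots> = (?d u * ?d u * (\<Prod>x\<in>S. ?f u x)) * (?h k u x + (\<Sum>x\<in>S. ?h k u x))"
        unfolding e W'[rule_format] x prod.case by (simp only: algebra_simps)
      also have "\<dots> = (?d u * ?d u * (\<Prod>x\<in>S. ?f u x)) * (\<Sum>x\<in>insert x S. ?h k u x)"
        using insert.hyps by simp
      finally show ?thesis .
    qed
    moreover have "(\<Prod>x\<in>insert x S. ?f u x) = ?d u * ?d u * (\<Prod>x\<in>S. ?f u x)" for u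
      using insert.hyps f by simp
    ultimately show ?case using P by (simp only:) (intro exI conjI allI)
  qed
  from this[OF finite_pairs order.refl] show ?thesis
    by (simp add: vdm2_def[abs_def] case_prod_unfold)
qed

text \<open>The off-diagonal terms of \<open>\<Sum>\<^sub>a p\<^sub>a p\<^bsub>k-1-a\<^esub> = \<Sum>\<^sub>a \<Sum>\<^bsub>i,j\<^esub> x\<^sub>i^a x\<^sub>j^(k-1-a)\<close> are the logarithmic
derivative of the Vandermonde square, and the diagonal terms are the divergence \<open>\<Sum>\<^sub>i k x\<^sub>i^(k-1)\<close>.\<close>

theorem loop_solution_eigenvalues:
  "loop_solution n (\<lambda>L. \<integral>u. vdm2 n u * tmon (\<lambda>k. power_sum n k u) L \<partial>(\<Pi>\<^sub>M i\<in>{..<n}. wgauss 0))"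
proof -
  obtain W' where W: "pfun {..<n} (vdm2 n) W'"
    and W': "\<forall>k u. (\<Sum>p<n. of_real (u p) ^ k * W' p u) =
     vdm2 n u * (\<Sum>(i, j)\<in>{(i, j). i < j \<and> j < n}. 2 * (\<Sum>a<k. of_real (u i) ^ (k - 1 - a) * of_real (u j) ^ a))"
    using power_vector_field_vdm2[of n] by (elim exE conjE)
  show ?thesis
  proof (rule gauss_loop_solution[where V="\<lambda>k p u. of_real (u p) ^ k"])
    show "pfun {..<n} (power_sum n k) (\<lambda>p u. \<Sum>i<n. if p = i then of_nat k * of_real (u i) ^ (k - 1) else 0)" for k
      unfolding power_sum_def[abs_def] by (intro pfun_sum pfun_power_coord) auto
    show "pfun {..<n} (vdm2 n) W'" by (rule W)
    show "pfun {..<n} (\<lambda>u. of_real (u p) ^ k) (\<lambda>q u. if q = p then of_nat k * of_real (u p) ^ (k - 1) else 0)" if "p \<in> {..<n}" for k p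
      by (rule pfun_power_coord[OF that])
    show "power_sum n 0 u = of_nat n" for u by (simp add: power_sum_def)
    show "(\<Sum>p<n. complex_of_real (u p) * complex_of_real (u p) ^ k) = power_sum n (Suc k) u" for k u
      by (simp add: power_sum_def)
    show "(\<Sum>p<n. of_real (u p) ^ k * (\<Sum>i<n. if p = i then of_nat a * of_real (u i) ^ (a - 1) else 0))
      = of_nat a * power_sum n (a - 1 + k) u" for k a u
      by (simp add: power_sum_def sum_distrib_left power_add mult_ac)
    show "(\<Sum>p<n. of_real (u p) ^ k * W' p u) +
        vdm2 n u * (\<Sum>p<n. if p = p then of_nat k * of_real (u p) ^ (k - 1) else 0) =
        vdm2 n u * (\<Sum>a<k. power_sum n a u * power_sum n (k - 1 - a) u)" for k u
    proof -
      let ?u = "\<lambda>i. complex_of_real (u i)"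
      \<comment> \<open>The divided difference of \<open>x \<mapsto> x^k\<close>, symmetric in \<open>i\<close> and \<open>j\<close>.\<close>
      define g where "g i j = (\<Sum>a<k. ?u i ^ a * ?u j ^ (k - 1 - a))" for i j
      have sym: "g j i = g i j" for i j
        unfolding g_def
        by (rule sum.reindex_bij_witness[of _ "\<lambda>a. k - 1 - a" "\<lambda>a. k - 1 - a"]) (auto simp: mult.commute)
      have gg: "g i j + g j i = 2 * g j i" for i j
        using sym[of i j] by simp
      have "(\<Sum>a<k. power_sum n a u * power_sum n (k - 1 - a) u) = (\<Sum>a<k. \<Sum>i<n. \<Sum>j<n. ?u i ^ a * ?u j ^ (k - 1 - a))"
        by (simp add: power_sum_def sum_product)
      also have "\<dots> = (\<Sum>i<n. \<Sum>j<n. g i j)"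
        unfolding g_def by (subst sum.swap, rule sum.cong[OF refl], rule sum.swap)
      also have "\<dots> = (\<Sum>i<n. g i i) + (\<Sum>(i, j)\<in>{(i, j). i < j \<and> j < n}. 2 * g j i)"
        unfolding sum_offdiag gg ..
      also have "(\<Sum>i<n. g i i) = (\<Sum>p<n. of_nat k * ?u p ^ (k - 1))"
        by (intro sum.cong refl) (simp add: g_def power_add[symmetric])
      finally show ?thesis
        unfolding W'[rule_format] by (simp add: g_def algebra_simps)
    qed
  qed simp
qed

section \<open>Polynomials in the power sums\<close>

text \<open>Polynomials in countably many symbols \<open>t\<^sub>0, t\<^sub>1, \<dots>\<close>, represented by their evaluation maps. One \<open>f\<close> can
then be evaluated both at the traces of a matrix and at the power sums of a vector.\<close>

inductive trace_poly :: "((nat \<Rightarrow> complex) \<Rightarrow> complex) \<Rightarrow> bool" where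
  tp_const: "trace_poly (\<lambda>t. c)"
| tp_var: "trace_poly (\<lambda>t. t k)"
| tp_add: "trace_poly f \<Longrightarrow> trace_poly g \<Longrightarrow> trace_poly (\<lambda>t. f t + g t)"
| tp_mult: "trace_poly f \<Longrightarrow> trace_poly g \<Longrightarrow> trace_poly (\<lambda>t. f t * g t)"

lemma trace_poly_sum: "(\<And>s. s \<in> S \<Longrightarrow> trace_poly (f s)) \<Longrightarrow> trace_poly (\<lambda>t. \<Sum>s\<in>S. f s t)"
  by (induction S rule: infinite_finite_induct) (simp_all add: tp_const tp_add)

lemma trace_poly_power: "trace_poly f \<Longrightarrow> trace_poly (\<lambda>t. f t ^ k)"
  by (induction k) (auto intro: tp_const tp_mult simp: tp_const[of 1])

lemma tmon_append: "tmon t (L @ M) = tmon t L * tmon t M"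
  by (simp add: tmon_def)

lemma trace_poly_monomials:
  "trace_poly f \<Longrightarrow> \<exists>T. \<forall>t. f t = (\<Sum>(c, L)\<leftarrow>T. c * tmon t L)"
proof (induction rule: trace_poly.induct)
  case (tp_const c) show ?case by (rule exI[of _ "[(c, [])]"]) simp
next
  case (tp_var k) show ?case by (rule exI[of _ "[(1, [k])]"]) simp
next
  case (tp_add f g)
  then obtain T U where "\<forall>t. f t = (\<Sum>(c, L)\<leftarrow>T. c * tmon t L)" "\<forall>t. g t = (\<Sum>(c, L)\<leftarrow>U. c * tmon t L)" by blast
  then show ?case by (intro exI[of _ "T @ U"]) simp
next
  case (tp_mult f g)
  then obtain T U where T: "\<forall>t. f t = (\<Sum>(c, L)\<leftarrow>T. c * tmon t L)" and U: "\<forall>t. g t = (\<Sum>(c, L)\<leftarrow>U. c * tmon t L)" by blast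
  have 1: "(\<Sum>(d, M)\<leftarrow>map (\<lambda>(d, M). (c * d, L @ M)) U. d * tmon t M) = c * tmon t L * g t" for c L t
    unfolding U[rule_format] by (induction U) (auto simp: tmon_append algebra_simps)
  have "(\<Sum>(c, L)\<leftarrow>concat (map (\<lambda>(c, L). map (\<lambda>(d, M). (c * d, L @ M)) U) T). c * tmon t L) = f t * g t" for t
    unfolding T[rule_format]
  proof (induction T)
    case (Cons x T)
    then show ?case using 1[where c="fst x" and L="snd x" and t=t] by (simp add: case_prod_unfold distrib_right)
  qed simp
  then show ?case by (intro exI[of _ "concat (map (\<lambda>(c, L). map (\<lambda>(d, M). (c * d, L @ M)) U) T)"]) simp
qed

text \<open>Uniqueness of the loop equations extended by linearity: two models of the equations give the same
integrals, up to the ratio of their total masses.\<close>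

lemma loop_solution_trace_poly:
  fixes t :: "nat \<Rightarrow> ('i \<Rightarrow> real) \<Rightarrow> complex" and s :: "nat \<Rightarrow> ('j \<Rightarrow> real) \<Rightarrow> complex"
  assumes A: "loop_solution n (\<lambda>L. \<integral>u. W u * tmon (\<lambda>k. t k u) L \<partial>A)"
    and B: "loop_solution n (\<lambda>L. \<integral>u. X u * tmon (\<lambda>k. s k u) L \<partial>B)"
    and iA: "\<And>L. integrable A (\<lambda>u. W u * tmon (\<lambda>k. t k u) L)"
    and iB: "\<And>L. integrable B (\<lambda>u. X u * tmon (\<lambda>k. s k u) L)"
    and f: "trace_poly f"
  shows "integrable A (\<lambda>u. W u * f (\<lambda>k. t k u))" "integrable B (\<lambda>u. X u * f (\<lambda>k. s k u))"
    "(\<integral>u. W u * f (\<lambda>k. t k u) \<partial>A) * (\<integral>u. X u \<partial>B) = (\<integral>u. X u * f (\<lambda>k. s k u) \<partial>B) * (\<integral>u. W u \<partial>A)"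
proof -
  obtain T where T: "\<forall>t. f t = (\<Sum>(c, L)\<leftarrow>T. c * tmon t L)" using trace_poly_monomials[OF f] by blast
  have hA: "has_bochner_integral A (\<lambda>u. W u * (\<Sum>(c, L)\<leftarrow>T. c * tmon (\<lambda>k. t k u) L))
     (\<Sum>(c, L)\<leftarrow>T. c * (\<integral>u. W u * tmon (\<lambda>k. t k u) L \<partial>A))"
  proof (induction T)
    case (Cons x T)
    show ?case
      using has_bochner_integral_add[OF has_bochner_integral_mult_right[OF has_bochner_integral_integrable[OF iA], of "fst x" "snd x"] Cons]
      by (simp add: case_prod_unfold algebra_simps)
  qed (simp add: has_bochner_integral_zero)
  have hB: "has_bochner_integral B (\<lambda>u. X u * (\<Sum>(c, L)\<leftarrow>T. c * tmon (\<lambda>k. s k u) L))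
     (\<Sum>(c, L)\<leftarrow>T. c * (\<integral>u. X u * tmon (\<lambda>k. s k u) L \<partial>B))"
  proof (induction T)
    case (Cons x T)
    show ?case
      using has_bochner_integral_add[OF has_bochner_integral_mult_right[OF has_bochner_integral_integrable[OF iB], of "fst x" "snd x"] Cons]
      by (simp add: case_prod_unfold algebra_simps)
  qed (simp add: has_bochner_integral_zero)
  show "integrable A (\<lambda>u. W u * f (\<lambda>k. t k u))" "integrable B (\<lambda>u. X u * f (\<lambda>k. s k u))"
    using hA hB unfolding T[rule_format] by (auto simp: has_bochner_integral_iff)
  have e: "(\<integral>u. W u * tmon (\<lambda>k. t k u) L \<partial>A) * (\<integral>u. X u \<partial>B) = (\<integral>u. X u * tmon (\<lambda>k. s k u) L \<partial>B) * (\<integral>u. W u \<partial>A)" for L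
    using loop_solution_unique[OF A B, of L] by simp
  have "(\<Sum>(c, L)\<leftarrow>T. c * (\<integral>u. W u * tmon (\<lambda>k. t k u) L \<partial>A)) * (\<integral>u. X u \<partial>B) =
      (\<Sum>(c, L)\<leftarrow>T. c * (\<integral>u. X u * tmon (\<lambda>k. s k u) L \<partial>B)) * (\<integral>u. W u \<partial>A)"
    by (induction T) (auto simp: distrib_right mult.assoc e)
  then show "(\<integral>u. W u * f (\<lambda>k. t k u) \<partial>A) * (\<integral>u. X u \<partial>B) = (\<integral>u. X u * f (\<lambda>k. s k u) \<partial>B) * (\<integral>u. W u \<partial>A)"
    unfolding T[rule_format] has_bochner_integral_integral_eq[OF hA] has_bochner_integral_integral_eq[OF hB] .
qed

text \<open>The generating function of the elementary symmetric polynomials.\<close>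

definition esym_fps :: "nat \<Rightarrow> (nat \<Rightarrow> complex) \<Rightarrow> complex fps" where
  "esym_fps n x = (\<Prod>i<n. 1 + fps_const (x i) * fps_X)"

lemma esym_fps_Suc_nth:
  "fps_nth (esym_fps (Suc n) x) (Suc m) = fps_nth (esym_fps n x) (Suc m) + x n * fps_nth (esym_fps n x) m"
proof -
  have "esym_fps (Suc n) x = esym_fps n x + fps_const (x n) * (fps_X * esym_fps n x)"
    by (simp add: esym_fps_def algebra_simps)
  then show ?thesis by simp
qed

text \<open>Newton's identities, as the logarithmic derivative of the generating function.\<close>

lemma esym_fps_deriv:
  "fps_deriv (esym_fps n x) = esym_fps n x * Abs_fps (\<lambda>m. (-1) ^ m * (\<Sum>i<n. x i ^ Suc m))"
proof (induction n)
  case 0 show ?case by (simp add: esym_fps_def fps_eq_iff)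
next
  case (Suc n)
  let ?l = "1 + fps_const (x n) * fps_X"
  let ?g = "Abs_fps (\<lambda>m. (-1) ^ m * x n ^ Suc m)"
  let ?S = "Abs_fps (\<lambda>m. (-1) ^ m * (\<Sum>i<n. x i ^ Suc m))"
  have g: "?l * ?g = fps_const (x n)"
  proof (rule fps_ext)
    fix m show "fps_nth (?l * ?g) m = fps_nth (fps_const (x n)) m"
      by (cases m) (simp_all add: distrib_right mult.assoc)
  qed
  have S: "Abs_fps (\<lambda>m. (-1) ^ m * (\<Sum>i<Suc n. x i ^ Suc m)) = ?S + ?g"
    by (simp add: fps_eq_iff algebra_simps)
  have "fps_deriv (esym_fps (Suc n) x) = fps_deriv (esym_fps n x * ?l)"
    by (simp add: esym_fps_def)
  also have "\<dots> = esym_fps n x * fps_const (x n) + fps_deriv (esym_fps n x) * ?l"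
    by simp
  also have "\<dots> = esym_fps n x * (?l * ?g) + esym_fps n x * ?S * ?l"
    by (simp only: g Suc)
  also have "\<dots> = esym_fps n x * ?l * (?S + ?g)"
    by (simp only: algebra_simps)
  also have "esym_fps n x * ?l = esym_fps (Suc n) x" by (simp add: esym_fps_def)
  finally show ?case unfolding S .
qed

text \<open>The polynomial does not depend on \<open>x\<close>; this is what lets the same \<open>f\<close> represent the determinant
of a matrix and the product of the eigenvalues.\<close>

lemma esym_trace_poly:
  "\<exists>f. trace_poly f \<and> (\<forall>(n::nat) x. fps_nth (esym_fps n x) k = f (\<lambda>j. \<Sum>i<n. x i ^ j))"
proof (induction k rule: less_induct)
  case (less k)
  show ?case
  proof (cases k)
    case 0
    have "fps_nth (esym_fps n x) 0 = 1" for n x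
      by (induction n) (simp_all add: esym_fps_def)
    then show ?thesis unfolding 0 by (intro exI[of _ "\<lambda>t. 1"] conjI tp_const) auto
  next
    case (Suc m)
    have "\<exists>F. \<forall>i\<le>m. trace_poly (F i) \<and> (\<forall>(n::nat) x. fps_nth (esym_fps n x) i = F i (\<lambda>j. \<Sum>i<n. x i ^ j))"
      using less[unfolded Suc less_Suc_eq_le] by (intro choice) blast
    then obtain F where F: "\<And>i. i \<le> m \<Longrightarrow> trace_poly (F i)"
      and Fe: "\<And>i n x. i \<le> m \<Longrightarrow> fps_nth (esym_fps n x) i = F i (\<lambda>j. \<Sum>i<n. x i ^ j)" by blast
    define f where "f t = inverse (of_nat (Suc m)) * (\<Sum>i=0..m. F i t * ((-1) ^ (m - i) * t (Suc (m - i))))" for t :: "nat \<Rightarrow> complex"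
    have "trace_poly f"
      unfolding f_def[abs_def] by (intro tp_mult tp_const trace_poly_sum tp_var F) auto
    moreover have "fps_nth (esym_fps n x) k = f (\<lambda>j. \<Sum>i<n. x i ^ j)" for n x
    proof -
      have "of_nat (Suc m) * fps_nth (esym_fps n x) (Suc m) = fps_nth (fps_deriv (esym_fps n x)) m"
        by simp
      also have "\<dots> = (\<Sum>i=0..m. F i (\<lambda>j. \<Sum>i<n. x i ^ j) * ((-1) ^ (m - i) * (\<Sum>l<n. x l ^ Suc (m - i))))"
        unfolding esym_fps_deriv fps_mult_nth by (intro sum.cong refl) (simp add: Fe)
      finally show ?thesis unfolding f_def Suc
        by (metis (no_types, lifting) mult.assoc left_inverse mult_1 of_nat_neq_0)
    qed
    ultimately show ?thesis by blast
  qed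
qed

lemma esym_top: "fps_nth (esym_fps n x) n = (\<Prod>i<n. x i)"
proof -
  have z: "\<forall>m>n. fps_nth (esym_fps n x) m = 0" for n
  proof (induction n)
    case 0 then show ?case by (simp add: esym_fps_def)
  next
    case (Suc n)
    show ?case
    proof (intro allI impI)
      fix m assume "m > Suc n"
      then obtain l where "m = Suc l" "l > n" by (cases m) auto
      then show "fps_nth (esym_fps (Suc n) x) m = 0" using Suc by (simp add: esym_fps_Suc_nth)
    qed
  qed
  show ?thesis
  proof (induction n)
    case 0 then show ?case by (simp add: esym_fps_def)
  next
    case (Suc n) then show ?case using z[of n] by (simp add: esym_fps_Suc_nth mult.commute)
  qed
qed

lemma product_trace_poly:
  "\<exists>f. trace_poly f \<and> (\<forall>x. (\<Prod>i<(n::nat). x i) = f (\<lambda>j. \<Sum>i<n. x i ^ j))"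
  using esym_trace_poly[of n] esym_top[of n] by metis

section \<open>Homogeneity and real powers of the determinant\<close>

lemma wgauss_0: "wgauss 0 = density lborel (\<lambda>t. ennreal (exp (- t\<^sup>2)))"
  unfolding wgauss_def
proof (rule density_cong)
  show "AE t in lborel. ennreal (\<bar>t\<bar> powr (2 * 0) * exp (- t\<^sup>2)) = ennreal (exp (- t\<^sup>2))"
    using AE_lborel_singleton[of 0] by eventually_elim auto
qed auto

lemma product_sigma_finite_lborel: "product_sigma_finite (\<lambda>_::'i. lborel :: real measure)"
  unfolding product_sigma_finite_def by (auto intro: sigma_finite_lborel)

lemma PiM_density_lborel:
  fixes g :: "real \<Rightarrow> real"
  assumes I: "finite I" and g [measurable]: "g \<in> borel_measurable borel" and pos: "\<And>t. g t \<ge> 0"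
    and sf: "sigma_finite_measure (density lborel (\<lambda>t. ennreal (g t)))"
  shows "(\<Pi>\<^sub>M i\<in>I. density lborel (\<lambda>t. ennreal (g t))) =
     density (\<Pi>\<^sub>M i\<in>I. lborel) (\<lambda>u. ennreal (\<Prod>i\<in>I. g (u i)))"
proof -
  interpret L: product_sigma_finite "\<lambda>_::'a. lborel :: real measure" by (rule product_sigma_finite_lborel)
  interpret D: product_sigma_finite "\<lambda>_::'a. density lborel (\<lambda>t. ennreal (g t))"
    unfolding product_sigma_finite_def using sf by auto
  have gm [measurable]: "(\<lambda>u. \<Prod>i\<in>I. g (u i)) \<in> borel_measurable (\<Pi>\<^sub>M i\<in>I. lborel)"
    by measurable
  show ?thesis
  proof (rule D.PiM_eqI[symmetric, OF I])
    show "sets (density (\<Pi>\<^sub>M i\<in>I. lborel) (\<lambda>u. ennreal (\<Prod>i\<in>I. g (u i)))) =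
        sets (\<Pi>\<^sub>M i\<in>I. density lborel (\<lambda>t. ennreal (g t)))"
      unfolding sets_density by (rule sets_PiM_cong) auto
    fix A :: "'a \<Rightarrow> real set" assume "\<And>i. i \<in> I \<Longrightarrow> A i \<in> sets (density lborel (\<lambda>t. ennreal (g t)))"
    then have A [measurable]: "\<And>i. i \<in> I \<Longrightarrow> A i \<in> sets borel" by simp
    have PA: "(\<Pi>\<^sub>E i\<in>I. A i) \<in> sets (\<Pi>\<^sub>M i\<in>I. lborel)"
      using A by (intro sets_PiM_I_finite I) auto
    have "emeasure (density (\<Pi>\<^sub>M i\<in>I. lborel) (\<lambda>u. ennreal (\<Prod>i\<in>I. g (u i)))) (\<Pi>\<^sub>E i\<in>I. A i) =
      (\<integral>\<^sup>+u. ennreal (\<Prod>i\<in>I. g (u i)) * indicator (\<Pi>\<^sub>E i\<in>I. A i) u \<partial>(\<Pi>\<^sub>M i\<in>I. lborel))"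
      by (rule emeasure_density) (use PA in auto)
    also have "\<dots> = (\<integral>\<^sup>+u. (\<Prod>i\<in>I. ennreal (g (u i)) * indicator (A i) (u i)) \<partial>(\<Pi>\<^sub>M i\<in>I. lborel))"
    proof (rule nn_integral_cong)
      fix u :: "'a \<Rightarrow> real" assume u: "u \<in> space (\<Pi>\<^sub>M i\<in>I. lborel)"
      have "indicator (\<Pi>\<^sub>E i\<in>I. A i) u = (\<Prod>i\<in>I. indicator (A i) (u i) :: ennreal)"
      proof (cases "u \<in> (\<Pi>\<^sub>E i\<in>I. A i)")
        case True then show ?thesis by (auto simp: PiE_iff)
      next
        case False
        then obtain i where "i \<in> I" "u i \<notin> A i" using u by (auto simp: PiE_iff space_PiM)
        then have "(\<Prod>i\<in>I. indicator (A i) (u i) :: ennreal) = 0"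
          using I by (intro prod_zero) (auto intro!: bexI[of _ i])
        then show ?thesis using False by simp
      qed
      then show "ennreal (\<Prod>i\<in>I. g (u i)) * indicator (\<Pi>\<^sub>E i\<in>I. A i) u =
         (\<Prod>i\<in>I. ennreal (g (u i)) * indicator (A i) (u i))"
        by (simp add: prod.distrib prod_ennreal pos)
    qed
    also have "\<dots> = (\<Prod>i\<in>I. \<integral>\<^sup>+t. ennreal (g t) * indicator (A i) t \<partial>lborel)"
      by (rule L.product_nn_integral_prod[OF I]) measurable
    also have "\<dots> = (\<Prod>i\<in>I. emeasure (density lborel (\<lambda>t. ennreal (g t))) (A i))"
      by (intro prod.cong refl emeasure_density[symmetric]) auto
    finally show "emeasure (density (\<Pi>\<^sub>M i\<in>I. lborel) (\<lambda>u. ennreal (\<Prod>i\<in>I. g (u i)))) (\<Pi>\<^sub>E i\<in>I. A i) =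
       (\<Prod>i\<in>I. emeasure (density lborel (\<lambda>t. ennreal (g t))) (A i))" .
  qed
qed

lemma nn_integral_PiM_lborel_scale:
  fixes f :: "('i \<Rightarrow> real) \<Rightarrow> ennreal"
  assumes I: "finite I" and r: "r \<noteq> 0"
    and f: "f \<in> borel_measurable (\<Pi>\<^sub>M i\<in>I. lborel)"
  shows "(\<integral>\<^sup>+u. f u \<partial>(\<Pi>\<^sub>M i\<in>I. lborel)) = ennreal (\<bar>r\<bar> ^ card I) * (\<integral>\<^sup>+u. f (\<lambda>i\<in>I. r * u i) \<partial>(\<Pi>\<^sub>M i\<in>I. lborel))"
proof -
  interpret L: product_sigma_finite "\<lambda>_::'i. lborel :: real measure" by (rule product_sigma_finite_lborel)
  let ?L = "\<Pi>\<^sub>M i\<in>I. lborel :: real measure"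
  define S where "S = (\<lambda>u::'i \<Rightarrow> real. \<lambda>i\<in>I. r * u i)"
  have S [measurable]: "S \<in> measurable ?L ?L" unfolding S_def by measurable
  have "density (distr ?L ?L S) (\<lambda>_. ennreal (\<bar>r\<bar> ^ card I)) = ?L"
  proof (rule L.PiM_eqI[OF I])
    fix A :: "'i \<Rightarrow> real set" assume "\<And>i. i \<in> I \<Longrightarrow> A i \<in> sets lborel"
    then have A [measurable]: "\<And>i. i \<in> I \<Longrightarrow> A i \<in> sets borel" by simp
    have PA: "(\<Pi>\<^sub>E i\<in>I. A i) \<in> sets ?L" using A by (intro sets_PiM_I_finite I) auto
    have v: "S -` (\<Pi>\<^sub>E i\<in>I. A i) \<inter> space ?L = (\<Pi>\<^sub>E i\<in>I. {t. r * t \<in> A i})"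
      by (auto simp: S_def space_PiM PiE_iff extensional_def)
    have one: "ennreal \<bar>r\<bar> * emeasure lborel {t. r * t \<in> B} = emeasure lborel B" if B [measurable]: "B \<in> sets borel" for B
    proof -
      have "emeasure lborel B = emeasure (density (distr lborel borel ((*) r)) (\<lambda>_. \<bar>r\<bar>)) B"
        using lborel_distr_mult'[OF r] by simp
      also have "\<dots> = ennreal \<bar>r\<bar> * emeasure (distr lborel borel ((*) r)) B"
        by (subst emeasure_density_const) auto
      also have "emeasure (distr lborel borel ((*) r)) B = emeasure lborel ((*) r -` B \<inter> space lborel)"
        by (rule emeasure_distr) auto
      also have "(*) r -` B \<inter> space lborel = {t. r * t \<in> B}" by auto
      finally show ?thesis ..
    qed
    have "emeasure (density (distr ?L ?L S) (\<lambda>_. ennreal (\<bar>r\<bar> ^ card I))) (\<Pi>\<^sub>E i\<in>I. A i) =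
       ennreal (\<bar>r\<bar> ^ card I) * emeasure ?L (\<Pi>\<^sub>E i\<in>I. {t. r * t \<in> A i})"
      using PA by (simp add: emeasure_density_const emeasure_distr v)
    also have "emeasure ?L (\<Pi>\<^sub>E i\<in>I. {t. r * t \<in> A i}) = (\<Prod>i\<in>I. emeasure lborel {t. r * t \<in> A i})"
      by (rule L.emeasure_PiM[OF I]) measurable
    also have "ennreal (\<bar>r\<bar> ^ card I) * \<dots> = (\<Prod>i\<in>I. ennreal \<bar>r\<bar> * emeasure lborel {t. r * t \<in> A i})"
      using r by (simp add: prod.distrib ennreal_power)
    also have "\<dots> = (\<Prod>i\<in>I. emeasure lborel (A i))"
      by (intro prod.cong refl one A)
    finally show "emeasure (density (distr ?L ?L S) (\<lambda>_. ennreal (\<bar>r\<bar> ^ card I))) (\<Pi>\<^sub>E i\<in>I. A i) = (\<Prod>i\<in>I. emeasure lborel (A i))" .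
  qed simp
  then have "(\<integral>\<^sup>+u. f u \<partial>?L) = (\<integral>\<^sup>+u. f u \<partial>density (distr ?L ?L S) (\<lambda>_. ennreal (\<bar>r\<bar> ^ card I)))" by simp
  also have "\<dots> = (\<integral>\<^sup>+u. ennreal (\<bar>r\<bar> ^ card I) * f u \<partial>distr ?L ?L S)"
    by (rule nn_integral_density) (use f in auto)
  also have "\<dots> = (\<integral>\<^sup>+u. ennreal (\<bar>r\<bar> ^ card I) * f (S u) \<partial>?L)"
    by (rule nn_integral_distr) (use f in auto)
  also have "\<dots> = ennreal (\<bar>r\<bar> ^ card I) * (\<integral>\<^sup>+u. f (S u) \<partial>?L)"
    by (rule nn_integral_cmult) (use f in measurable)
  finally show ?thesis by (simp add: S_def)
qed

definition sqnorm :: "'i set \<Rightarrow> ('i \<Rightarrow> real) \<Rightarrow> real" where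
  "sqnorm I u = (\<Sum>i\<in>I. (u i)\<^sup>2)"

lemma sqnorm_measurable [measurable]: "sqnorm I \<in> borel_measurable (\<Pi>\<^sub>M i\<in>I. lborel)"
  unfolding sqnorm_def[abs_def] by measurable

lemma nn_integral_exp_tail: "(\<integral>\<^sup>+R. ennreal (exp (- R)) * indicator {q..} R \<partial>lborel) = ennreal (exp (- q :: real))"
proof -
  have "((\<lambda>x::real. - exp (- x)) \<longlongrightarrow> 0) at_top" by real_asymp
  then have "(\<integral>\<^sup>+R. ennreal (exp (- R)) * indicator {q..} R \<partial>lborel) = ennreal (0 - (- exp (- q)))"
    by (intro nn_integral_FTC_atLeast) (auto intro!: derivative_eq_intros)
  then show ?thesis by simp
qed

lemma nn_integral_Gamma:
  assumes "s > - 1"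
  shows "(\<integral>\<^sup>+R. ennreal (exp (- R) * R powr s) * indicator {0<..} R \<partial>lborel) = ennreal (Gamma (s + 1))"
proof -
  have "((\<lambda>t. t powr s / exp t) has_integral Gamma (s + 1)) {0..}"
    using Gamma_integral_real[of "s + 1"] assms by simp
  then have "((\<lambda>t. t powr s / exp t) has_integral Gamma (s + 1)) {0<..}"
    by (subst has_integral_spike_set_eq[where T="{0..}"])
       (auto intro: negligible_subset[of "{0}"])
  then have "((\<lambda>t. if t \<in> {0<..} then t powr s / exp t else 0) has_integral Gamma (s + 1)) UNIV"
    by (subst has_integral_restrict_UNIV)
  then have "(\<integral>\<^sup>+t. ennreal (if t \<in> {0<..} then t powr s / exp t else 0) \<partial>lborel) = ennreal (Gamma (s + 1))"
    by (intro nn_integral_has_integral_lborel) auto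
  moreover have "ennreal (if t \<in> {0<..} then t powr s / exp t else 0) = ennreal (exp (- t) * t powr s) * indicator {0<..} t" for t
    by (auto simp: exp_minus field_simps)
  ultimately show ?thesis by simp
qed

text \<open>Write \<open>e^(-q)\<close> as the integral of \<open>e^(-R)\<close> over \<open>R \<ge> q\<close> and exchange the integrals. By homogeneity the
integral of \<open>h\<close> over the ball of radius \<open>sqrt R\<close> is \<open>R^((N+d)/2)\<close> times that over the unit ball, with \<open>N\<close> the dimension,
and the integral over \<open>R\<close> is a Gamma value. Thus the Gaussian integral depends on \<open>h\<close> only through the unit ball.\<close>

lemma gauss_radial:
  fixes h :: "('i \<Rightarrow> real) \<Rightarrow> real"
  assumes I: "finite I" and h [measurable]: "h \<in> borel_measurable (\<Pi>\<^sub>M i\<in>I. lborel)"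
    and pos: "\<And>u. h u \<ge> 0" and d: "d \<ge> 0"
    and hom: "\<And>r u. r > 0 \<Longrightarrow> h (\<lambda>i\<in>I. r * u i) = r powr d * h u"
  shows "(\<integral>\<^sup>+u. ennreal (h u * exp (- sqnorm I u)) \<partial>(\<Pi>\<^sub>M i\<in>I. lborel)) =
    ennreal (Gamma ((real (card I) + d) / 2 + 1)) *
      (\<integral>\<^sup>+u. ennreal (h u) * indicator {u. sqnorm I u \<le> 1} u \<partial>(\<Pi>\<^sub>M i\<in>I. lborel))"
proof -
  interpret L: product_sigma_finite "\<lambda>_::'i. lborel :: real measure" by (rule product_sigma_finite_lborel)
  interpret F: finite_product_sigma_finite "\<lambda>_::'i. lborel :: real measure" I by standard (rule I)
  let ?L = "\<Pi>\<^sub>M i\<in>I. lborel :: real measure"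
  interpret P: pair_sigma_finite ?L "lborel :: real measure" ..
  define \<kappa> where "\<kappa> = (\<integral>\<^sup>+u. ennreal (h u) * indicator {u. sqnorm I u \<le> 1} u \<partial>?L)"
  define s where "s = (real (card I) + d) / 2"
  \<comment> \<open>Scaling to the ball of radius \<open>sqrt R\<close>.\<close>
  have ball: "(\<integral>\<^sup>+u. ennreal (h u) * (if sqnorm I u \<le> R then 1 else 0) \<partial>?L) = ennreal (R powr s) * \<kappa>" if R: "R > 0" for R
  proof -
    have r: "sqrt R > 0" and r0: "sqrt R \<noteq> 0" using R by simp_all
    have sq: "sqnorm I (\<lambda>i\<in>I. sqrt R * u i) = R * sqnorm I u" for u
      using R by (simp add: sqnorm_def power_mult_distrib sum_distrib_left)
    have "(\<integral>\<^sup>+u. ennreal (h u) * (if sqnorm I u \<le> R then 1 else 0) \<partial>?L) =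
       ennreal (\<bar>sqrt R\<bar> ^ card I) * (\<integral>\<^sup>+u. ennreal (h (\<lambda>i\<in>I. sqrt R * u i)) *
          (if sqnorm I (\<lambda>i\<in>I. sqrt R * u i) \<le> R then 1 else 0) \<partial>?L)"
      by (rule nn_integral_PiM_lborel_scale[OF I r0]) measurable
    also have "(\<integral>\<^sup>+u. ennreal (h (\<lambda>i\<in>I. sqrt R * u i)) * (if sqnorm I (\<lambda>i\<in>I. sqrt R * u i) \<le> R then 1 else 0) \<partial>?L)
        = (\<integral>\<^sup>+u. ennreal (sqrt R powr d) * (ennreal (h u) * indicator {u. sqnorm I u \<le> 1} u) \<partial>?L)"
      unfolding hom[OF r] sq using R pos by (intro nn_integral_cong) (auto simp: ennreal_mult indicator_def)
    also have "\<dots> = ennreal (sqrt R powr d) * \<kappa>"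
      unfolding \<kappa>_def by (rule nn_integral_cmult) measurable
    also have "ennreal (\<bar>sqrt R\<bar> ^ card I) * (ennreal (sqrt R powr d) * \<kappa>) = ennreal (sqrt R ^ card I * sqrt R powr d) * \<kappa>"
      using R by (simp add: ennreal_mult mult.assoc)
    also have "sqrt R ^ card I * sqrt R powr d = R powr s"
      using R by (simp add: powr_half_sqrt[symmetric] powr_powr powr_add[symmetric] s_def powr_realpow[symmetric] add_divide_distrib)
    finally show ?thesis .
  qed
  have "(\<integral>\<^sup>+u. ennreal (h u * exp (- sqnorm I u)) \<partial>?L) =
     (\<integral>\<^sup>+u. (\<integral>\<^sup>+R. ennreal (h u) * (ennreal (exp (- R)) * (if sqnorm I u \<le> R then 1 else 0)) \<partial>lborel) \<partial>?L)"
  proof (rule nn_integral_cong)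
    fix u
    have "(\<integral>\<^sup>+R. ennreal (h u) * (ennreal (exp (- R)) * (if sqnorm I u \<le> R then 1 else 0)) \<partial>lborel) =
       ennreal (h u) * (\<integral>\<^sup>+R. ennreal (exp (- R)) * (if sqnorm I u \<le> R then 1 else 0) \<partial>lborel)"
      by (rule nn_integral_cmult) measurable
    also have "(\<integral>\<^sup>+R. ennreal (exp (- R)) * (if sqnorm I u \<le> R then 1 else 0) \<partial>lborel) =
       (\<integral>\<^sup>+R. ennreal (exp (- R)) * indicator {sqnorm I u..} R \<partial>lborel)"
      by (intro nn_integral_cong) (auto simp: indicator_def)
    finally show "ennreal (h u * exp (- sqnorm I u)) = (\<integral>\<^sup>+R. ennreal (h u) * (ennreal (exp (- R)) * (if sqnorm I u \<le> R then 1 else 0)) \<partial>lborel)"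
      unfolding nn_integral_exp_tail using pos[of u] by (simp add: ennreal_mult)
  qed
  also have "\<dots> = (\<integral>\<^sup>+R. (\<integral>\<^sup>+u. ennreal (h u) * (ennreal (exp (- R)) * (if sqnorm I u \<le> R then 1 else 0)) \<partial>?L) \<partial>lborel)"
    by (rule P.Fubini'[symmetric]) measurable
  also have "\<dots> = (\<integral>\<^sup>+R. (ennreal (exp (- R) * R powr s) * indicator {0<..} R) * \<kappa> \<partial>lborel)"
  proof (rule nn_integral_cong_AE)
    show "AE R in lborel. (\<integral>\<^sup>+u. ennreal (h u) * (ennreal (exp (- R)) * (if sqnorm I u \<le> R then 1 else 0)) \<partial>?L)
        = (ennreal (exp (- R) * R powr s) * indicator {0<..} R) * \<kappa>"
      using AE_lborel_singleton[of 0]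
    proof eventually_elim
      case (elim R)
      show ?case
      proof (cases "R > 0")
        case True
        have "(\<integral>\<^sup>+u. ennreal (h u) * (ennreal (exp (- R)) * (if sqnorm I u \<le> R then 1 else 0)) \<partial>?L) =
           (\<integral>\<^sup>+u. ennreal (exp (- R)) * (ennreal (h u) * (if sqnorm I u \<le> R then 1 else 0)) \<partial>?L)"
          by (simp only: mult.left_commute)
        also have "\<dots> = ennreal (exp (- R)) * (\<integral>\<^sup>+u. ennreal (h u) * (if sqnorm I u \<le> R then 1 else 0) \<partial>?L)"
          by (rule nn_integral_cmult) measurable
        finally show ?thesis unfolding ball[OF True] using True by (simp add: ennreal_mult mult.assoc)
      next
        case False
        have "sqnorm I u \<ge> 0" for u by (simp add: sqnorm_def sum_nonneg)
        then have "\<not> sqnorm I u \<le> R" for u using False elim by (smt (verit))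
        then show ?thesis using False by simp
      qed
    qed
  qed
  also have "\<dots> = ennreal (Gamma (s + 1)) * \<kappa>"
    using d by (subst nn_integral_multc) (auto simp: nn_integral_Gamma s_def)
  finally show ?thesis by (simp add: s_def \<kappa>_def)
qed

text \<open>Weierstrass approximation: bounded variables are determined by their moments.\<close>

lemma hausdorff_moments:
  fixes X :: "'a \<Rightarrow> real" and Y :: "'b \<Rightarrow> real"
  assumes A: "finite_measure A" and B: "finite_measure B"
    and X [measurable]: "X \<in> borel_measurable A" and Y [measurable]: "Y \<in> borel_measurable B"
    and X01: "AE x in A. X x \<in> {0..1}" and Y01: "AE x in B. Y x \<in> {0..1}"
    and mom: "\<And>m. a * (\<integral>x. X x ^ m \<partial>A) = b * (\<integral>x. Y x ^ m \<partial>B)"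
    and f: "continuous_on {0..1} f" and fm [measurable]: "f \<in> borel_measurable borel"
  shows "a * (\<integral>x. f (X x) \<partial>A) = b * (\<integral>x. f (Y x) \<partial>B)"
proof -
  interpret A: finite_measure A by fact
  interpret B: finite_measure B by fact
  have pi: "integrable A (\<lambda>x. X x ^ m)" "integrable B (\<lambda>x. Y x ^ m)" for m
    by (rule A.integrable_const_bound[of _ 1], use X01 in \<open>auto simp: power_le_one\<close>)
       (rule B.integrable_const_bound[of _ 1], use Y01 in \<open>auto simp: power_le_one\<close>)
  obtain K where K: "\<And>t. t \<in> {0..1} \<Longrightarrow> norm (f t) \<le> K"
    using compact_imp_bounded[OF compact_continuous_image[OF f compact_Icc]]
    unfolding bounded_iff by (metis imageI)
  have fi: "integrable A (\<lambda>x. f (X x))" "integrable B (\<lambda>x. f (Y x))"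
    by (rule A.integrable_const_bound[of _ K], use X01 in eventually_elim, use K in auto)
       (rule B.integrable_const_bound[of _ K], use Y01 in eventually_elim, use K in auto)
  define C where "C = \<bar>a\<bar> * measure A (space A) + \<bar>b\<bar> * measure B (space B)"
  have "\<bar>a * (\<integral>x. f (X x) \<partial>A) - b * (\<integral>x. f (Y x) \<partial>B)\<bar> \<le> e * C" if e: "e > 0" for e
  proof -
    obtain g where g: "real_polynomial_function g" and gf: "\<And>t. t \<in> {0..1} \<Longrightarrow> \<bar>f t - g t\<bar> < e"
      using Stone_Weierstrass_real_polynomial_function[OF compact_Icc f e] by metis
    obtain c n where gs: "g = (\<lambda>t. \<Sum>i\<le>n. c i * t ^ i)"
      using real_polynomial_function_imp_sum[OF g] by metis
    have gi: "has_bochner_integral A (\<lambda>x. g (X x)) (\<Sum>i\<le>n. c i * (\<integral>x. X x ^ i \<partial>A))"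
      "has_bochner_integral B (\<lambda>x. g (Y x)) (\<Sum>i\<le>n. c i * (\<integral>x. Y x ^ i \<partial>B))"
      unfolding gs by (intro has_bochner_integral_sum has_bochner_integral_mult_right has_bochner_integral_integrable pi)+
    have "a * (c i * (\<integral>x. X x ^ i \<partial>A)) = b * (c i * (\<integral>x. Y x ^ i \<partial>B))" for i
      by (simp only: mult.left_commute[of a] mult.left_commute[of b] mom)
    then have eq: "a * (\<integral>x. g (X x) \<partial>A) = b * (\<integral>x. g (Y x) \<partial>B)"
      unfolding gi[THEN has_bochner_integral_integral_eq] sum_distrib_left by (simp only:)
    have gA: "integrable A (\<lambda>x. g (X x))" and gB: "integrable B (\<lambda>x. g (Y x))"
      using gi by (auto simp: has_bochner_integral_iff)
    have "\<bar>(\<integral>x. f (X x) \<partial>A) - (\<integral>x. g (X x) \<partial>A)\<bar> = \<bar>\<integral>x. f (X x) - g (X x) \<partial>A\<bar>"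
      using fi gA by simp
    also have "\<dots> \<le> (\<integral>x. \<bar>f (X x) - g (X x)\<bar> \<partial>A)" by (rule integral_abs_bound)
    also have "\<dots> \<le> (\<integral>x. e \<partial>A)"
      using X01 gf fi gA by (intro integral_mono_AE integrable_abs Bochner_Integration.integrable_diff) (auto intro: less_imp_le)
    finally have dA: "\<bar>(\<integral>x. f (X x) \<partial>A) - (\<integral>x. g (X x) \<partial>A)\<bar> \<le> e * measure A (space A)" by (simp add: mult.commute)
    have "\<bar>(\<integral>x. f (Y x) \<partial>B) - (\<integral>x. g (Y x) \<partial>B)\<bar> = \<bar>\<integral>x. f (Y x) - g (Y x) \<partial>B\<bar>"
      using fi gB by simp
    also have "\<dots> \<le> (\<integral>x. \<bar>f (Y x) - g (Y x)\<bar> \<partial>B)" by (rule integral_abs_bound)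
    also have "\<dots> \<le> (\<integral>x. e \<partial>B)"
      using Y01 gf fi gB by (intro integral_mono_AE integrable_abs Bochner_Integration.integrable_diff) (auto intro: less_imp_le)
    finally have dB: "\<bar>(\<integral>x. f (Y x) \<partial>B) - (\<integral>x. g (Y x) \<partial>B)\<bar> \<le> e * measure B (space B)" by (simp add: mult.commute)
    have "\<bar>a * (\<integral>x. f (X x) \<partial>A) - b * (\<integral>x. f (Y x) \<partial>B)\<bar> =
       \<bar>a * ((\<integral>x. f (X x) \<partial>A) - (\<integral>x. g (X x) \<partial>A)) - b * ((\<integral>x. f (Y x) \<partial>B) - (\<integral>x. g (Y x) \<partial>B))\<bar>"
      using eq by (simp add: algebra_simps)
    also have "\<dots> \<le> \<bar>a\<bar> * \<bar>(\<integral>x. f (X x) \<partial>A) - (\<integral>x. g (X x) \<partial>A)\<bar> + \<bar>b\<bar> * \<bar>(\<integral>x. f (Y x) \<partial>B) - (\<integral>x. g (Y x) \<partial>B)\<bar>"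
      by (rule order.trans[OF abs_triangle_ineq4]) (simp add: abs_mult)
    also have "\<dots> \<le> \<bar>a\<bar> * (e * measure A (space A)) + \<bar>b\<bar> * (e * measure B (space B))"
      using dA dB by (intro add_mono mult_left_mono) auto
    finally show ?thesis by (simp add: C_def algebra_simps)
  qed
  note bound = this
  have "\<bar>a * (\<integral>x. f (X x) \<partial>A) - b * (\<integral>x. f (Y x) \<partial>B)\<bar> \<le> 0 + e" if "e > 0" for e
  proof -
    have C: "C \<ge> 0" by (simp add: C_def)
    have "\<bar>a * (\<integral>x. f (X x) \<partial>A) - b * (\<integral>x. f (Y x) \<partial>B)\<bar> \<le> e / (C + 1) * C"
      using \<open>e > 0\<close> C by (intro bound) auto
    also have "\<dots> \<le> e" using \<open>e > 0\<close> C by (simp add: field_simps)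
    finally show ?thesis by simp
  qed
  then have "\<bar>a * (\<integral>x. f (X x) \<partial>A) - b * (\<integral>x. f (Y x) \<partial>B)\<bar> \<le> 0" by (rule field_le_epsilon)
  then show ?thesis by simp
qed

text \<open>Two integrals over spaces of different dimensions that are proportional for all weights \<open>D^(2m)\<close> with \<open>m\<close>
a natural number are proportional with the same constants for \<open>|D|^(2\<mu>)\<close>. By
\<open>gauss_radial\<close> each integral is a Gamma factor times an integral of \<open>(D^2)^m\<close> over the unit ball; the
Gamma factors agree because dimension plus degree is the same on both sides, and on the ball
\<open>D^2\<close> has values in \<open>[0, 1]\<close>, so \<open>hausdorff_moments\<close> applies to \<open>y \<mapsto> y^\<mu>\<close>.\<close>

lemma homogeneous_weight_extension:
  fixes h1 D1 :: "('i \<Rightarrow> real) \<Rightarrow> real" and h2 D2 :: "('j \<Rightarrow> real) \<Rightarrow> real"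
  assumes I: "finite I" and J: "finite J"
    and h1 [measurable]: "h1 \<in> borel_measurable (\<Pi>\<^sub>M i\<in>I. lborel)"
    and D1 [measurable]: "D1 \<in> borel_measurable (\<Pi>\<^sub>M i\<in>I. lborel)"
    and h2 [measurable]: "h2 \<in> borel_measurable (\<Pi>\<^sub>M i\<in>J. lborel)"
    and D2 [measurable]: "D2 \<in> borel_measurable (\<Pi>\<^sub>M i\<in>J. lborel)"
    and pos1: "\<And>u. h1 u \<ge> 0" and pos2: "\<And>u. h2 u \<ge> 0"
    and hom1: "\<And>r u. r > 0 \<Longrightarrow> h1 (\<lambda>i\<in>I. r * u i) = r powr d1 * h1 u"
    and hom2: "\<And>r u. r > 0 \<Longrightarrow> h2 (\<lambda>i\<in>J. r * u i) = r powr d2 * h2 u"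
    and homD1: "\<And>r u. r > 0 \<Longrightarrow> D1 (\<lambda>i\<in>I. r * u i) = r ^ e * D1 u"
    and homD2: "\<And>r u. r > 0 \<Longrightarrow> D2 (\<lambda>i\<in>J. r * u i) = r ^ e * D2 u"
    and le1: "\<And>u. sqnorm I u \<le> 1 \<Longrightarrow> \<bar>D1 u\<bar> \<le> 1" and le2: "\<And>u. sqnorm J u \<le> 1 \<Longrightarrow> \<bar>D2 u\<bar> \<le> 1"
    and d: "d1 \<ge> 0" "d2 \<ge> 0" "real (card I) + d1 = real (card J) + d2"
    and z: "z1 \<ge> 0" "z2 \<ge> 0"
    and fin1: "(\<integral>\<^sup>+u. ennreal (h1 u * exp (- sqnorm I u)) \<partial>(\<Pi>\<^sub>M i\<in>I. lborel)) < \<infinity>"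
    and fin2: "(\<integral>\<^sup>+u. ennreal (h2 u * exp (- sqnorm J u)) \<partial>(\<Pi>\<^sub>M i\<in>J. lborel)) < \<infinity>"
    and eq: "\<And>m::nat. ennreal z2 * (\<integral>\<^sup>+u. ennreal (h1 u * D1 u ^ (2 * m) * exp (- sqnorm I u)) \<partial>(\<Pi>\<^sub>M i\<in>I. lborel))
       = ennreal z1 * (\<integral>\<^sup>+u. ennreal (h2 u * D2 u ^ (2 * m) * exp (- sqnorm J u)) \<partial>(\<Pi>\<^sub>M i\<in>J. lborel))"
    and \<mu>: "\<mu> > 0"
  shows "ennreal z2 * (\<integral>\<^sup>+u. ennreal (h1 u * \<bar>D1 u\<bar> powr (2 * \<mu>) * exp (- sqnorm I u)) \<partial>(\<Pi>\<^sub>M i\<in>I. lborel))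
       = ennreal z1 * (\<integral>\<^sup>+u. ennreal (h2 u * \<bar>D2 u\<bar> powr (2 * \<mu>) * exp (- sqnorm J u)) \<partial>(\<Pi>\<^sub>M i\<in>J. lborel))"
proof -
  let ?LI = "\<Pi>\<^sub>M i\<in>I. lborel :: real measure" and ?LJ = "\<Pi>\<^sub>M i\<in>J. lborel :: real measure"
  define A where "A = density ?LI (\<lambda>u. ennreal (h1 u) * indicator {u. sqnorm I u \<le> 1} u)"
  define B where "B = density ?LJ (\<lambda>u. ennreal (h2 u) * indicator {u. sqnorm J u \<le> 1} u)"
  \<comment> \<open>The radial factor for a weight of degree \<open>e'\<close>; it is the same on both sides by the balance of dimension and degree.\<close>
  define g where "g e' = ennreal (Gamma ((real (card I) + (d1 + e')) / 2 + 1))" for e' :: real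
  have g: "g e' \<noteq> 0" "g e' \<noteq> \<infinity>" if "e' \<ge> 0" for e'
    using that d by (auto simp: g_def ennreal_eq_0_iff not_le intro!: Gamma_real_pos add_nonneg_pos)
  have radI: "(\<integral>\<^sup>+u. ennreal (h1 u * w u * exp (- sqnorm I u)) \<partial>?LI) = g e' * (\<integral>\<^sup>+u. ennreal (w u) \<partial>A)"
    if [measurable]: "w \<in> borel_measurable ?LI" and "\<And>u. w u \<ge> 0" "e' \<ge> 0" "\<And>r u. r > 0 \<Longrightarrow> w (\<lambda>i\<in>I. r * u i) = r powr e' * w u" for w e'
  proof -
    have "(\<integral>\<^sup>+u. ennreal (h1 u * w u * exp (- sqnorm I u)) \<partial>?LI) =
        g e' * (\<integral>\<^sup>+u. ennreal (h1 u * w u) * indicator {u. sqnorm I u \<le> 1} u \<partial>?LI)"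
      unfolding g_def by (rule gauss_radial[OF I]) (use that pos1 d hom1 in \<open>auto simp: powr_add\<close>)
    also have "(\<integral>\<^sup>+u. ennreal (h1 u * w u) * indicator {u. sqnorm I u \<le> 1} u \<partial>?LI) = (\<integral>\<^sup>+u. ennreal (w u) \<partial>A)"
      unfolding A_def by (subst nn_integral_density) (auto simp: ennreal_mult that pos1 mult_ac)
    finally show ?thesis .
  qed
  have radJ: "(\<integral>\<^sup>+u. ennreal (h2 u * w u * exp (- sqnorm J u)) \<partial>?LJ) = g e' * (\<integral>\<^sup>+u. ennreal (w u) \<partial>B)"
    if [measurable]: "w \<in> borel_measurable ?LJ" and "\<And>u. w u \<ge> 0" "e' \<ge> 0" "\<And>r u. r > 0 \<Longrightarrow> w (\<lambda>i\<in>J. r * u i) = r powr e' * w u" for w e'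
  proof -
    have gJ: "g e' = ennreal (Gamma ((real (card J) + (d2 + e')) / 2 + 1))"
      unfolding g_def using d(3) by (simp add: add.assoc[symmetric])
    have "(\<integral>\<^sup>+u. ennreal (h2 u * w u * exp (- sqnorm J u)) \<partial>?LJ) =
        g e' * (\<integral>\<^sup>+u. ennreal (h2 u * w u) * indicator {u. sqnorm J u \<le> 1} u \<partial>?LJ)"
      unfolding gJ by (rule gauss_radial[OF J]) (use that pos2 d hom2 in \<open>auto simp: powr_add\<close>)
    also have "(\<integral>\<^sup>+u. ennreal (h2 u * w u) * indicator {u. sqnorm J u \<le> 1} u \<partial>?LJ) = (\<integral>\<^sup>+u. ennreal (w u) \<partial>B)"
      unfolding B_def by (subst nn_integral_density) (auto simp: ennreal_mult that pos2 mult_ac)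
    finally show ?thesis .
  qed
  have finA: "finite_measure A"
  proof
    have "g 0 * (\<integral>\<^sup>+u. ennreal 1 \<partial>A) < \<infinity>" using fin1 radI[of "\<lambda>_. 1" 0] by simp
    then show "emeasure A (space A) \<noteq> \<infinity>" using g[of 0] by (auto simp: ennreal_mult_eq_top_iff)
  qed
  have finB: "finite_measure B"
  proof
    have "g 0 * (\<integral>\<^sup>+u. ennreal 1 \<partial>B) < \<infinity>" using fin2 radJ[of "\<lambda>_. 1" 0] by simp
    then show "emeasure B (space B) \<noteq> \<infinity>" using g[of 0] by (auto simp: ennreal_mult_eq_top_iff)
  qed
  interpret A: finite_measure A by (rule finA)
  interpret B: finite_measure B by (rule finB)
  have mA [measurable]: "D1 \<in> borel_measurable A" and mB [measurable]: "D2 \<in> borel_measurable B"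
    by (simp_all add: A_def B_def)
  have aeA: "AE u in A. (D1 u)\<^sup>2 \<in> {0..1}"
    unfolding A_def by (subst AE_density) (auto simp: indicator_def le1 abs_square_le_1)
  have aeB: "AE u in B. (D2 u)\<^sup>2 \<in> {0..1}"
    unfolding B_def by (subst AE_density) (auto simp: indicator_def le2 abs_square_le_1)
  have nnA: "(\<integral>\<^sup>+u. ennreal (f ((D1 u)\<^sup>2)) \<partial>A) = ennreal (\<integral>u. f ((D1 u)\<^sup>2) \<partial>A)"
    and nnB: "(\<integral>\<^sup>+u. ennreal (f ((D2 u)\<^sup>2)) \<partial>B) = ennreal (\<integral>u. f ((D2 u)\<^sup>2) \<partial>B)"
    if [measurable]: "f \<in> borel_measurable borel" and f: "\<And>y. 0 \<le> y \<Longrightarrow> 0 \<le> f y" "\<And>y. 0 \<le> y \<Longrightarrow> y \<le> 1 \<Longrightarrow> f y \<le> 1" for f :: "real \<Rightarrow> real"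
    by (intro nn_integral_eq_integral A.integrable_const_bound[of _ 1], use aeA f in auto)
       (intro nn_integral_eq_integral B.integrable_const_bound[of _ 1], use aeB f in auto)
  have mom: "z2 * (\<integral>u. ((D1 u)\<^sup>2) ^ m \<partial>A) = z1 * (\<integral>u. ((D2 u)\<^sup>2) ^ m \<partial>B)" for m
  proof -
    have r1: "(\<integral>\<^sup>+u. ennreal (h1 u * D1 u ^ (2 * m) * exp (- sqnorm I u)) \<partial>?LI) =
        g (real (e * (2 * m))) * (\<integral>\<^sup>+u. ennreal (D1 u ^ (2 * m)) \<partial>A)"
    proof (rule radI)
      show "D1 (\<lambda>i\<in>I. r * u i) ^ (2 * m) = r powr real (e * (2 * m)) * D1 u ^ (2 * m)" if "r > 0" for r u
        by (simp only: homD1[OF that] power_mult_distrib power_mult[symmetric] powr_realpow[OF that])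
    qed auto
    have r2: "(\<integral>\<^sup>+u. ennreal (h2 u * D2 u ^ (2 * m) * exp (- sqnorm J u)) \<partial>?LJ) =
        g (real (e * (2 * m))) * (\<integral>\<^sup>+u. ennreal (D2 u ^ (2 * m)) \<partial>B)"
    proof (rule radJ)
      show "D2 (\<lambda>i\<in>J. r * u i) ^ (2 * m) = r powr real (e * (2 * m)) * D2 u ^ (2 * m)" if "r > 0" for r u
        by (simp only: homD2[OF that] power_mult_distrib power_mult[symmetric] powr_realpow[OF that])
    qed auto
    have "ennreal z2 * (g (real (e * (2 * m))) * (\<integral>\<^sup>+u. ennreal (D1 u ^ (2 * m)) \<partial>A)) =
        ennreal z1 * (g (real (e * (2 * m))) * (\<integral>\<^sup>+u. ennreal (D2 u ^ (2 * m)) \<partial>B))"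
      using eq[of m] unfolding r1 r2 .
    then have "g (real (e * (2 * m))) * (ennreal z2 * (\<integral>\<^sup>+u. ennreal (D1 u ^ (2 * m)) \<partial>A)) =
        g (real (e * (2 * m))) * (ennreal z1 * (\<integral>\<^sup>+u. ennreal (D2 u ^ (2 * m)) \<partial>B))"
      by (simp only: mult.left_commute)
    then have "ennreal z2 * (\<integral>\<^sup>+u. ennreal (D1 u ^ (2 * m)) \<partial>A) = ennreal z1 * (\<integral>\<^sup>+u. ennreal (D2 u ^ (2 * m)) \<partial>B)"
      using g[of "real (e * (2 * m))"] by (subst (asm) ennreal_mult_cancel_left) auto
    then show ?thesis
      using nnA[of "\<lambda>y. y ^ m"] nnB[of "\<lambda>y. y ^ m"] z
      by (simp add: power_mult power_le_one ennreal_mult[symmetric] integral_nonneg_AE)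
  qed
  have cont: "continuous_on {0..1} (\<lambda>y::real. y powr \<mu>)"
    using \<mu> by (intro continuous_on_powr' continuous_intros) auto
  have fin: "z2 * (\<integral>u. (D1 u)\<^sup>2 powr \<mu> \<partial>A) = z1 * (\<integral>u. (D2 u)\<^sup>2 powr \<mu> \<partial>B)"
    by (rule hausdorff_moments[OF finA finB _ _ aeA aeB mom cont]) measurable
  have sq: "\<bar>y\<bar> powr (2 * \<mu>) = y\<^sup>2 powr \<mu>" for y :: real
    by (cases "y = 0") (simp_all add: powr_powr[symmetric])
  have p01: "y powr \<mu> \<le> 1" if "0 \<le> y" "y \<le> 1" for y
    using powr_mono2[of \<mu> y 1] that \<mu> by simp
  have rI: "(\<integral>\<^sup>+u. ennreal (h1 u * \<bar>D1 u\<bar> powr (2 * \<mu>) * exp (- sqnorm I u)) \<partial>?LI) =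
      g (real e * (2 * \<mu>)) * ennreal (\<integral>u. (D1 u)\<^sup>2 powr \<mu> \<partial>A)"
    by (subst radI[where e'="real e * (2 * \<mu>)"])
       (use \<mu> p01 in \<open>auto simp: homD1 abs_mult powr_mult powr_powr[symmetric] powr_realpow nnA[of "\<lambda>y. y powr \<mu>"] sq\<close>)
  have rJ: "(\<integral>\<^sup>+u. ennreal (h2 u * \<bar>D2 u\<bar> powr (2 * \<mu>) * exp (- sqnorm J u)) \<partial>?LJ) =
      g (real e * (2 * \<mu>)) * ennreal (\<integral>u. (D2 u)\<^sup>2 powr \<mu> \<partial>B)"
    by (subst radJ[where e'="real e * (2 * \<mu>)"])
       (use \<mu> p01 in \<open>auto simp: homD2 abs_mult powr_mult powr_powr[symmetric] powr_realpow nnB[of "\<lambda>y. y powr \<mu>"] sq\<close>)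
  show "ennreal z2 * (\<integral>\<^sup>+u. ennreal (h1 u * \<bar>D1 u\<bar> powr (2 * \<mu>) * exp (- sqnorm I u)) \<partial>?LI)
       = ennreal z1 * (\<integral>\<^sup>+u. ennreal (h2 u * \<bar>D2 u\<bar> powr (2 * \<mu>) * exp (- sqnorm J u)) \<partial>?LJ)"
  proof -
    have "ennreal z2 * ennreal (\<integral>u. (D1 u)\<^sup>2 powr \<mu> \<partial>A) = ennreal z1 * ennreal (\<integral>u. (D2 u)\<^sup>2 powr \<mu> \<partial>B)"
      using arg_cong[OF fin, of ennreal] z by (simp add: ennreal_mult)
    then show ?thesis
      unfolding rI rJ mult.left_commute[of "ennreal z1" "g (real e * (2 * \<mu>))"]
        mult.left_commute[of "ennreal z2" "g (real e * (2 * \<mu>))"] by (simp only:)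
  qed
qed

section \<open>Orthogonal polynomials and the one-point function\<close>

text \<open>The number by which the Dunkl operator of parameter \<open>\<mu>\<close> multiplies the power \<open>t^i\<close> when lowering its degree
by one. It takes the role that \<open>i\<close> has for the Hermite polynomials.\<close>

definition bracket :: "real \<Rightarrow> nat \<Rightarrow> real" where
  "bracket \<mu> i = real i + (if odd i then 2 * \<mu> else 0)"

text \<open>The monic generalized Hermite polynomials, given by their three-term recurrence; orthogonality is
derived in \<open>wgauss_integral_opoly_orth\<close>.\<close>

fun opoly :: "real \<Rightarrow> nat \<Rightarrow> real poly" where
  "opoly \<mu> 0 = 1"
| "opoly \<mu> (Suc 0) = [:0, 1:]"
| "opoly \<mu> (Suc (Suc j)) = [:0, 1:] * opoly \<mu> (Suc j) - Polynomial.smult (bracket \<mu> (Suc j) / 2) (opoly \<mu> j)"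

definition wgauss_integral :: "real \<Rightarrow> real poly \<Rightarrow> real" where
  "wgauss_integral \<mu> p = (\<integral>t. poly p t \<partial>wgauss \<mu>)"

context
  fixes \<mu> :: real
  assumes \<mu>: "\<mu> \<ge> 0"
begin

lemma wgauss_poly_integrable: "integrable (wgauss \<mu>) (poly p)"
  using wgauss_poly[OF \<mu>] by (auto simp: has_bochner_integral_iff)

lemma wgauss_integral_add: "wgauss_integral \<mu> (p + q) = wgauss_integral \<mu> p + wgauss_integral \<mu> q"
proof -
  have "poly (p + q) = (\<lambda>t. poly p t + poly q t)" by (simp add: fun_eq_iff)
  then show ?thesis
    unfolding wgauss_integral_def using Bochner_Integration.integral_add[OF wgauss_poly_integrable[of p] wgauss_poly_integrable[of q]] by simp
qed

lemma wgauss_integral_smult: "wgauss_integral \<mu> (Polynomial.smult c p) = c * wgauss_integral \<mu> p"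
proof -
  have "poly (Polynomial.smult c p) = (\<lambda>t. c * poly p t)" by (simp add: fun_eq_iff)
  then show ?thesis unfolding wgauss_integral_def by simp
qed

lemma wgauss_integral_diff: "wgauss_integral \<mu> (p - q) = wgauss_integral \<mu> p - wgauss_integral \<mu> q"
  using wgauss_integral_add[of p "Polynomial.smult (- 1) q"] wgauss_integral_smult[of "- 1" q] by simp

lemma wgauss_integral_0: "wgauss_integral \<mu> 0 = 0"
  using wgauss_integral_smult[of 0 0] by simp

lemma wgauss_integral_sum: "wgauss_integral \<mu> (\<Sum>i\<in>S. f i) = (\<Sum>i\<in>S. wgauss_integral \<mu> (f i))"
  by (induction S rule: infinite_finite_induct) (auto simp: wgauss_integral_0 wgauss_integral_add)

lemma wgauss_integral_monom: "wgauss_integral \<mu> (Polynomial.monom 1 m) = mom \<mu> m"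
proof -
  have "poly (Polynomial.monom 1 m) = (\<lambda>t::real. t ^ m)" by (simp add: fun_eq_iff poly_monom)
  then show ?thesis
    unfolding wgauss_integral_def using has_bochner_integral_integral_eq[OF wgauss_moment[OF \<mu>, of m]] by simp
qed

text \<open>The Rodrigues formula tested on powers: integrating against the \<open>j\<close>-th polynomial is \<open>2^(-j)\<close> times integrating the \<open>j\<close>-fold
Dunkl derivative. For \<open>m < j\<close> the product contains the factor \<open>bracket \<mu> 0 = 0\<close>, which is the orthogonality; the
truncated differences beyond it are then irrelevant.\<close>

lemma wgauss_integral_opoly_monom:
  "wgauss_integral \<mu> (opoly \<mu> j * Polynomial.monom 1 m) = (if even (m + j) then (1/2) ^ j * (\<Prod>i<j. bracket \<mu> (m - i)) * mom \<mu> (m - j) else 0)"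
proof (induction j arbitrary: m rule: induct_nat_012)
  case 0
  show ?case by (simp add: wgauss_integral_monom mom_odd)
next
  case 1
  have "[:0, 1:] * Polynomial.monom 1 m = Polynomial.monom (1::real) (Suc m)" by (simp add: monom_Suc)
  then have "wgauss_integral \<mu> (opoly \<mu> (Suc 0) * Polynomial.monom 1 m) = mom \<mu> (Suc m)" by (simp add: wgauss_integral_monom)
  moreover have "mom \<mu> (Suc m) = 1/2 * bracket \<mu> m * mom \<mu> (m - 1)" if "odd m"
    using that mom_even_rec[OF \<mu>, of "m - 1"] by (cases m) (auto simp: bracket_def algebra_simps)
  ultimately show ?case by (auto simp: mom_odd)
next
  case (ge2 j)
  have x: "[:0, 1:] * p * Polynomial.monom 1 m = p * Polynomial.monom (1::real) (Suc m)" for p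
    by (simp add: monom_Suc)
  have rec: "wgauss_integral \<mu> (opoly \<mu> (Suc (Suc j)) * Polynomial.monom 1 m) =
      wgauss_integral \<mu> (opoly \<mu> (Suc j) * Polynomial.monom 1 (Suc m)) - bracket \<mu> (Suc j) / 2 * wgauss_integral \<mu> (opoly \<mu> j * Polynomial.monom 1 m)"
    unfolding opoly.simps left_diff_distrib x by (simp add: wgauss_integral_diff wgauss_integral_smult)
  show ?case
  proof (cases "even (m + j)")
    case False
    then show ?thesis unfolding rec ge2.IH by simp
  next
    case True
    define Q where "Q = (\<Prod>i<j. bracket \<mu> (m - i))"
    \<comment> \<open>With the common factor \<open>Q\<close> split off, the claim is an identity between brackets.\<close>
    have s: "(\<Prod>i<Suc j. bracket \<mu> (Suc m - i)) = bracket \<mu> (Suc m) * Q"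
      unfolding prod.lessThan_Suc_shift by (simp add: Q_def)
    have l: "wgauss_integral \<mu> (opoly \<mu> (Suc (Suc j)) * Polynomial.monom 1 m) = (1/2) ^ Suc j * Q * mom \<mu> (m - j) * (bracket \<mu> (Suc m) - bracket \<mu> (Suc j))"
      unfolding rec ge2.IH using True s by (simp add: Q_def[symmetric] algebra_simps)
    have r: "(\<Prod>i<Suc (Suc j). bracket \<mu> (m - i)) = Q * bracket \<mu> (m - j) * bracket \<mu> (m - Suc j)"
      by (simp add: Q_def)
    have b: "bracket \<mu> (Suc m) - bracket \<mu> (Suc j) = real m - real j"
      using True by (auto simp: bracket_def)
    have "m < j \<or> m = j \<or> m \<ge> Suc (Suc j)" using True by presburger
    then consider "m < j" | "m = j" | "m \<ge> Suc (Suc j)" by blast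
    then show ?thesis
    proof cases
      case 1
      then have "Q = 0" unfolding Q_def by (intro prod_zero) (auto simp: bracket_def intro!: bexI[of _ m])
      then show ?thesis unfolding l r by simp
    next
      case 2
      then show ?thesis unfolding l r b by (simp add: bracket_def)
    next
      case 3
      then obtain k where k: "m = Suc (Suc j) + k" by (metis le_Suc_ex)
      then have ek: "even k" using True by auto
      have "mom \<mu> (m - j) = (real k + 1 + 2 * \<mu>) / 2 * mom \<mu> k"
        using mom_even_rec[OF \<mu> ek] by (simp add: k)
      moreover have "bracket \<mu> (m - j) = real k + 2" "bracket \<mu> (m - Suc j) = real k + 1 + 2 * \<mu>"
        "real m - real j = real k + 2" "m - Suc (Suc j) = k"
        using ek by (auto simp: k bracket_def)
      ultimately show ?thesis unfolding l r b using True by simp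
    qed
  qed
qed

text \<open>The squared norm of \<open>opoly \<mu> j\<close>.\<close>

definition opoly_norm :: "nat \<Rightarrow> real" where
  "opoly_norm j = (1/2) ^ j * (\<Prod>i<j. bracket \<mu> (j - i)) * mom \<mu> 0"

lemma opoly_norm_pos: "opoly_norm j > 0"
  unfolding opoly_norm_def using \<mu> mom_0_pos[OF \<mu>]
  by (intro mult_pos_pos prod_pos) (auto simp: bracket_def add_pos_nonneg)

lemma opoly_norm_Suc: "opoly_norm (Suc j) = bracket \<mu> (Suc j) / 2 * opoly_norm j"
  unfolding opoly_norm_def prod.lessThan_Suc_shift by simp

lemma degree_opoly: "degree (opoly \<mu> j) = j \<and> coeff (opoly \<mu> j) j = 1"
proof (induction j rule: induct_nat_012)
  case (ge2 j)
  then have d: "degree (opoly \<mu> j) = j" "degree (opoly \<mu> (Suc j)) = Suc j" "coeff (opoly \<mu> (Suc j)) (Suc j) = 1"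
    by auto
  have c: "coeff (opoly \<mu> (Suc (Suc j))) (Suc (Suc j)) = 1"
    using d by (simp add: coeff_eq_0)
  have "degree (opoly \<mu> (Suc (Suc j))) \<le> Suc (Suc j)"
    unfolding opoly.simps by (rule degree_diff_le) (use d in \<open>auto intro: order.trans[OF degree_mult_le] order.trans[OF degree_smult_le]\<close>)
  moreover have "Suc (Suc j) \<le> degree (opoly \<mu> (Suc (Suc j)))"
    by (rule le_degree) (simp only: c one_neq_zero not_False_eq_True)
  ultimately have "degree (opoly \<mu> (Suc (Suc j))) = Suc (Suc j)" by (rule antisym)
  then show ?case using c by (rule conjI)
qed auto

lemma wgauss_integral_opoly_lower:
  assumes "degree q < j"
  shows "wgauss_integral \<mu> (opoly \<mu> j * q) = 0"
proof -
  have "wgauss_integral \<mu> (opoly \<mu> j * Polynomial.monom 1 m) = 0" if "m < j" for m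
  proof -
    have "(\<Prod>i<j. bracket \<mu> (m - i)) = 0"
      using that by (intro prod_zero) (auto simp: bracket_def intro!: bexI[of _ m])
    then show ?thesis unfolding wgauss_integral_opoly_monom by simp
  qed
  moreover have "opoly \<mu> j * q = (\<Sum>i\<le>degree q. Polynomial.smult (coeff q i) (opoly \<mu> j * Polynomial.monom 1 i))"
  proof -
    have "q = (\<Sum>i\<le>degree q. Polynomial.smult (coeff q i) (Polynomial.monom 1 i))"
      by (simp add: smult_monom poly_as_sum_of_monoms)
    then have "opoly \<mu> j * q = opoly \<mu> j * (\<Sum>i\<le>degree q. Polynomial.smult (coeff q i) (Polynomial.monom 1 i))" by simp
    then show ?thesis by (simp add: sum_distrib_left)
  qed
  ultimately show ?thesis using assms by (simp add: wgauss_integral_sum wgauss_integral_smult)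
qed

lemma wgauss_integral_opoly_self: "wgauss_integral \<mu> (opoly \<mu> j * opoly \<mu> j) = opoly_norm j"
proof -
  have "wgauss_integral \<mu> (opoly \<mu> j * (opoly \<mu> j - Polynomial.monom 1 j)) = 0"
  proof (cases j)
    case 0 then show ?thesis by (simp add: wgauss_integral_0)
  next
    case (Suc i)
    have "degree (opoly \<mu> j - Polynomial.monom 1 j) < j"
    proof -
      have "degree (opoly \<mu> j - Polynomial.monom 1 j) \<le> i"
      proof (rule degree_le, intro allI impI)
        fix k assume "i < k"
        then show "coeff (opoly \<mu> j - Polynomial.monom 1 j) k = 0"
          using degree_opoly[of j] Suc by (cases "k = j") (auto simp: coeff_eq_0)
      qed
      then show ?thesis using Suc by simp
    qed
    then show ?thesis by (rule wgauss_integral_opoly_lower)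
  qed
  then have "wgauss_integral \<mu> (opoly \<mu> j * opoly \<mu> j) = wgauss_integral \<mu> (opoly \<mu> j * Polynomial.monom 1 j)"
    by (simp add: right_diff_distrib wgauss_integral_diff)
  then show ?thesis unfolding wgauss_integral_opoly_monom by (simp add: opoly_norm_def)
qed

lemma wgauss_integral_opoly_orth: "i \<noteq> j \<Longrightarrow> wgauss_integral \<mu> (opoly \<mu> i * opoly \<mu> j) = 0"
  using wgauss_integral_opoly_lower[of "opoly \<mu> j" i] wgauss_integral_opoly_lower[of "opoly \<mu> i" j] degree_opoly[of i] degree_opoly[of j]
  by (cases "i < j") (auto simp: mult.commute)

end

text \<open>Induction on \<open>n\<close>: as a function of the last node, the determinant is a polynomial of degree at most
\<open>n\<close> that vanishes at the other nodes, and its leading coefficient is the smaller determinant.\<close>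

lemma vandermonde_monic:
  fixes P :: "nat \<Rightarrow> real poly" and x :: "nat \<Rightarrow> real"
  assumes P: "\<And>k. degree (P k) = k \<and> coeff (P k) k = 1"
  shows "Determinant.det (Matrix.mat n n (\<lambda>(i, j). poly (P j) (x i))) = (\<Prod>(i, j)\<in>{(i, j). i < j \<and> j < n}. x j - x i)"
proof (induction n)
  case 0
  have "{(i, j). i < j \<and> j < (0::nat)} = {}" by auto
  then show ?case by (simp add: Determinant.det_def)
next
  case (Suc n)
  define M where "M y = Matrix.mat (Suc n) (Suc n) (\<lambda>(i, j). poly (P j) (y i))" for y :: "nat \<Rightarrow> real"
  have M: "M y \<in> carrier_mat (Suc n) (Suc n)" for y by (simp add: M_def)
  have S: "{(i, j). i < j \<and> j < Suc n} = {(i, j). i < j \<and> j < n} \<union> (\<lambda>i. (i, n)) ` {..<n}"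
    by (auto simp: less_Suc_eq)
  have R: "(\<Prod>(i, j)\<in>{(i, j). i < j \<and> j < Suc n}. x j - x i) =
      (\<Prod>(i, j)\<in>{(i, j). i < j \<and> j < n}. x j - x i) * (\<Prod>i<n. x n - x i)"
    unfolding S by (subst prod.union_disjoint) (auto simp: finite_pairs prod.reindex inj_on_def)
  have same: "Determinant.det (M y) = 0" if "i < n" "y i = y n" for y i
    by (rule det_identical_rows[OF M, of i n]) (use that in \<open>auto simp: M_def\<close>)
  show ?case
  proof (cases "inj_on x {..<n}")
    case False
    then obtain i j where ij: "i < j" "j < n" "x i = x j"
      unfolding inj_on_def by (metis lessThan_iff linorder_neqE_nat)
    have "Determinant.det (M x) = 0"
      by (rule det_identical_rows[OF M, of i j]) (use ij in \<open>auto simp: M_def\<close>)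
    moreover have "(\<Prod>(i, j)\<in>{(i, j). i < j \<and> j < Suc n}. x j - x i) = 0"
      by (intro prod_zero finite_pairs bexI[of _ "(i, j)"]) (use ij in auto)
    ultimately show ?thesis by (simp add: M_def)
  next
    case True
    define Q where "Q = (\<Sum>j<Suc n. Polynomial.smult (cofactor (M x) n j) (P j))"
    have cof: "cofactor (M (x(n := t))) n j = cofactor (M x) n j" if "j < Suc n" for t j
    proof -
      have "mat_delete (M (x(n := t))) n j = mat_delete (M x) n j"
        by (rule eq_matI) (auto simp: mat_delete_def M_def)
      then show ?thesis by (simp add: cofactor_def)
    qed
    have Mn: "M (x(n := t)) $$ (n, j) = poly (P j) t" if "j < Suc n" for t j
      using that by (simp add: M_def)
    have det: "Determinant.det (M (x(n := t))) = poly Q t" for t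
      unfolding laplace_expansion_row[OF M lessI] Q_def poly_sum
      by (intro sum.cong refl) (simp add: cof Mn)
    have "mat_delete (M x) n n = Matrix.mat n n (\<lambda>(i, j). poly (P j) (x i))"
      by (rule eq_matI) (auto simp: mat_delete_def M_def)
    then have c: "cofactor (M x) n n = (\<Prod>(i, j)\<in>{(i, j). i < j \<and> j < n}. x j - x i)" (is "_ = ?c")
      by (simp add: cofactor_def Suc.IH)
    define D where "D = (\<Prod>i<n. [:- x i, 1:])"
    have D: "degree D = n \<and> coeff D n = 1"
    proof -
      have "degree D = n" unfolding D_def by (subst degree_prod_eq_sum_degree) auto
      moreover have "lead_coeff D = 1" unfolding D_def by (simp add: lead_coeff_prod)
      ultimately show ?thesis by auto
    qed
    have "Q = Polynomial.smult ?c D"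
    proof (rule ccontr)
      define E where "E = Q - Polynomial.smult ?c D"
      assume "Q \<noteq> Polynomial.smult ?c D"
      then have E0: "E \<noteq> 0" by (simp add: E_def)
      have "coeff E k = 0" if "k \<ge> n" for k
      proof (cases "k = n")
        case True
        have "coeff Q n = (\<Sum>j<Suc n. cofactor (M x) n j * coeff (P j) n)" by (simp add: Q_def coeff_sum)
        also have "\<dots> = ?c" using P by (simp add: c coeff_eq_0)
        finally show ?thesis using True D by (simp add: E_def)
      next
        case False
        then show ?thesis using that P D by (simp add: E_def Q_def coeff_sum coeff_eq_0)
      qed
      then have "degree E < n \<or> E = 0"
        by (metis E0 leading_coeff_0_iff not_le)
      then have dE: "degree E < n" using E0 by simp
      have "poly E (x i) = 0" if "i < n" for i
      proof -
        have "poly Q (x i) = Determinant.det (M (x(n := x i)))" by (simp add: det)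
        also have "\<dots> = 0" by (rule same[OF that]) (use that in auto)
        finally show ?thesis using that by (auto simp: E_def D_def poly_prod intro!: prod_zero bexI[of _ i])
      qed
      then have "x ` {..<n} \<subseteq> {t. poly E t = 0}" by auto
      then have "card (x ` {..<n}) \<le> card {t. poly E t = 0}"
        by (rule card_mono[OF poly_roots_finite[OF E0]])
      also have "\<dots> \<le> degree E" by (rule card_poly_roots_bound[OF E0])
      finally show False using dE True by (simp add: card_image)
    qed
    then have "Determinant.det (M x) = ?c * (\<Prod>i<n. x n - x i)"
      using det[of "x n"] by (simp add: D_def poly_prod)
    then show ?thesis unfolding R by (simp add: M_def)
  qed
qed

definition vdm :: "nat \<Rightarrow> (nat \<Rightarrow> real) \<Rightarrow> real" where
  "vdm n x = (\<Prod>(i, j)\<in>{(i, j). i < j \<and> j < n}. x j - x i)"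

text \<open>Both Vandermonde factors are expanded as determinants in the orthogonal polynomials, giving a double sum over
permutations \<open>p\<close>, \<open>q\<close>. The function \<open>f\<close> sits at a single site \<open>i\<close>. Distinct permutations differ at two
sites at least, hence at one other than \<open>i\<close>, where orthogonality kills the term; only \<open>p = q\<close> survives.\<close>

lemma one_point_formula:
  assumes \<mu>: "\<mu> \<ge> 0"
  shows "has_bochner_integral (\<Pi>\<^sub>M i\<in>{..<n}. wgauss \<mu>) (\<lambda>x. (\<Sum>i<n. poly f (x i)) * (vdm n x)\<^sup>2)
     (fact n * (\<Prod>j<n. opoly_norm \<mu> j) * (\<Sum>j<n. wgauss_integral \<mu> (f * (opoly \<mu> j * opoly \<mu> j)) / opoly_norm \<mu> j))"
proof -
  interpret product_sigma_finite "\<lambda>_::nat. wgauss \<mu>"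
    unfolding product_sigma_finite_def
    by (auto intro: finite_measure.axioms(1) finite_measure_wgauss[OF \<mu>])
  let ?P = "opoly \<mu>"
  define S where "S = {p. p permutes {0..<n}}"
  have fS: "finite S" unfolding S_def by (rule finite_permutations) simp
  define sg where "sg p = (signof p :: real)" for p :: "nat \<Rightarrow> nat"
  have sg: "sg p * sg p = 1" for p by (simp add: sg_def sign_def)
  define G where "G p q i l = (if l = i then f else 1) * (?P (p l) * ?P (q l))" for p q :: "nat \<Rightarrow> nat" and i l :: nat
  have V: "vdm n x = (\<Sum>p\<in>S. sg p * (\<Prod>l<n. poly (?P (p l)) (x l)))" for x
  proof -
    have "vdm n x = Determinant.det (Matrix.mat n n (\<lambda>(i, j). poly (?P j) (x i)))"
      unfolding vdm_def by (rule vandermonde_monic[symmetric]) (rule degree_opoly[OF \<mu>])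
    also have "\<dots> = (\<Sum>p\<in>S. sg p * (\<Prod>l = 0..<n. Matrix.mat n n (\<lambda>(i, j). poly (?P j) (x i)) $$ (l, p l)))"
      unfolding S_def sg_def by (rule det_def') simp
    also have "\<dots> = (\<Sum>p\<in>S. sg p * (\<Prod>l<n. poly (?P (p l)) (x l)))"
    proof (intro sum.cong refl)
      fix p assume "p \<in> S"
      then have "p l < n" if "l < n" for l using that by (auto simp: S_def dest: permutes_in_image[of p "{0..<n}" l])
      then show "sg p * (\<Prod>l = 0..<n. Matrix.mat n n (\<lambda>(i, j). poly (?P j) (x i)) $$ (l, p l)) = sg p * (\<Prod>l<n. poly (?P (p l)) (x l))"
        by (simp add: lessThan_atLeast0)
    qed
    finally show ?thesis .
  qed
  have expand: "(\<Sum>i<n. poly f (x i)) * (vdm n x)\<^sup>2 =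
      (\<Sum>i<n. \<Sum>p\<in>S. \<Sum>q\<in>S. sg p * sg q * (\<Prod>l<n. poly (G p q i l) (x l)))" for x
  proof -
    have "poly f (x i) * ((\<Prod>l<n. poly (?P (p l)) (x l)) * (\<Prod>l<n. poly (?P (q l)) (x l))) = (\<Prod>l<n. poly (G p q i l) (x l))" if "i < n" for i p q
    proof -
      have "poly f (x i) = (\<Prod>l<n. poly (if l = i then f else 1) (x l))"
        using that by (subst prod.remove[of _ i]) (auto intro!: prod.neutral)
      then show ?thesis by (simp only: G_def poly_mult prod.distrib)
    qed
    then have e: "poly f (x i) * (sg p * (\<Prod>l<n. poly (?P (p l)) (x l)) * (sg q * (\<Prod>l<n. poly (?P (q l)) (x l)))) =
        sg p * sg q * (\<Prod>l<n. poly (G p q i l) (x l))" if "i < n" for i p q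
      using that by (simp add: mult_ac)
    have V2: "(vdm n x)\<^sup>2 = (\<Sum>p\<in>S. \<Sum>q\<in>S. sg p * (\<Prod>l<n. poly (?P (p l)) (x l)) * (sg q * (\<Prod>l<n. poly (?P (q l)) (x l))))"
      unfolding V power2_eq_square by (rule sum_product)
    have "(\<Sum>i<n. poly f (x i)) * (vdm n x)\<^sup>2 =
       (\<Sum>i<n. \<Sum>p\<in>S. \<Sum>q\<in>S. poly f (x i) * (sg p * (\<Prod>l<n. poly (?P (p l)) (x l)) * (sg q * (\<Prod>l<n. poly (?P (q l)) (x l)))))"
      unfolding V2 by (simp only: sum_distrib_right) (simp only: sum_distrib_left)
    also have "\<dots> = (\<Sum>i<n. \<Sum>p\<in>S. \<Sum>q\<in>S. sg p * sg q * (\<Prod>l<n. poly (G p q i l) (x l)))"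
      by (intro sum.cong refl e) auto
    finally show ?thesis .
  qed
  have hb: "has_bochner_integral (\<Pi>\<^sub>M i\<in>{..<n}. wgauss \<mu>) (\<lambda>x. \<Prod>l<n. poly (g l) (x l)) (\<Prod>l<n. wgauss_integral \<mu> (g l))" for g
    unfolding has_bochner_integral_iff wgauss_integral_def
    by (intro conjI product_integrable_prod product_integral_prod) (auto intro: wgauss_poly_integrable[OF \<mu>])
  define A where "A j = wgauss_integral \<mu> (f * (?P j * ?P j)) / opoly_norm \<mu> j" for j
  define H where "H = (\<Prod>j<n. opoly_norm \<mu> j)"
  have val: "(\<Prod>l<n. wgauss_integral \<mu> (G p q i l)) = (if p = q then A (p i) * H else 0)" if p: "p \<in> S" and q: "q \<in> S" and i: "i < n" for p q i
  proof (cases "p = q")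
    case True
    have pp: "p permutes {..<n}" using p by (simp add: S_def lessThan_atLeast0)
    have "H = (\<Prod>l<n. opoly_norm \<mu> (p l))"
      unfolding H_def by (rule prod.permute[OF pp, unfolded o_def])
    also have "\<dots> = opoly_norm \<mu> (p i) * (\<Prod>l\<in>{..<n}-{i}. opoly_norm \<mu> (p l))"
      using i by (intro prod.remove) auto
    finally have H: "H = opoly_norm \<mu> (p i) * (\<Prod>l\<in>{..<n}-{i}. opoly_norm \<mu> (p l))" .
    have "(\<Prod>l<n. wgauss_integral \<mu> (G p q i l)) = wgauss_integral \<mu> (G p q i i) * (\<Prod>l\<in>{..<n}-{i}. wgauss_integral \<mu> (G p q i l))"
      using i by (intro prod.remove) auto
    also have "(\<Prod>l\<in>{..<n}-{i}. wgauss_integral \<mu> (G p q i l)) = (\<Prod>l\<in>{..<n}-{i}. opoly_norm \<mu> (p l))"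
      by (intro prod.cong refl) (auto simp: G_def True wgauss_integral_opoly_self[OF \<mu>])
    finally show ?thesis
      using True opoly_norm_pos[OF \<mu>, of "p i"] by (simp add: H A_def G_def)
  next
    case False
    have pp: "p permutes {0..<n}" and qq: "q permutes {0..<n}" using p q by (auto simp: S_def)
    \<comment> \<open>If \<open>p\<close> and \<open>q\<close> agree off \<open>i\<close>, they also agree at \<open>i\<close>, being bijections.\<close>
    have "\<exists>l<n. l \<noteq> i \<and> p l \<noteq> q l"
    proof (rule ccontr)
      assume "\<not> ?thesis"
      then have eq: "p l = q l" if "l < n" "l \<noteq> i" for l using that by blast
      have "q i \<in> {0..<n}" using permutes_in_image[OF qq, of i] i by simp
      then obtain l where l: "l < n" "p l = q i"
        using permutes_image[OF pp] by (metis atLeastLessThan_iff imageE)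
      have "l = i"
      proof (rule ccontr)
        assume "l \<noteq> i"
        then have "q l = q i" using eq l by simp
        then show False using permutes_inj[OF qq] \<open>l \<noteq> i\<close> by (auto dest: injD)
      qed
      then have "p i = q i" using l by simp
      then have "p l = q l" for l
        using eq[of l] permutes_not_in[OF pp, of l] permutes_not_in[OF qq, of l] by (cases "l = i"; cases "l < n") auto
      then show False using False by auto
    qed
    then obtain l where "l < n" "l \<noteq> i" "p l \<noteq> q l" by blast
    then have "wgauss_integral \<mu> (G p q i l) = 0" by (simp add: G_def wgauss_integral_opoly_orth[OF \<mu>])
    then have "(\<Prod>l<n. wgauss_integral \<mu> (G p q i l)) = 0" using \<open>l < n\<close> by (intro prod_zero) auto
    then show ?thesis using False by simp
  qed
  have "has_bochner_integral (\<Pi>\<^sub>M i\<in>{..<n}. wgauss \<mu>) (\<lambda>x. (\<Sum>i<n. poly f (x i)) * (vdm n x)\<^sup>2)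
     (\<Sum>i<n. \<Sum>p\<in>S. \<Sum>q\<in>S. sg p * sg q * (\<Prod>l<n. wgauss_integral \<mu> (G p q i l)))"
    unfolding expand by (intro has_bochner_integral_sum has_bochner_integral_mult_right hb)
  also have "(\<Sum>i<n. \<Sum>p\<in>S. \<Sum>q\<in>S. sg p * sg q * (\<Prod>l<n. wgauss_integral \<mu> (G p q i l))) = (\<Sum>i<n. \<Sum>p\<in>S. A (p i) * H)"
  proof (intro sum.cong refl)
    fix i p assume i: "i \<in> {..<n}" and p: "p \<in> S"
    have "(\<Sum>q\<in>S. sg p * sg q * (\<Prod>l<n. wgauss_integral \<mu> (G p q i l))) = (\<Sum>q\<in>S. if p = q then sg p * sg q * (A (p i) * H) else 0)"
      using i p by (intro sum.cong refl) (simp add: val)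
    also have "\<dots> = A (p i) * H" using p fS by (simp add: sg)
    finally show "(\<Sum>q\<in>S. sg p * sg q * (\<Prod>l<n. wgauss_integral \<mu> (G p q i l))) = A (p i) * H" .
  qed
  also have "\<dots> = (\<Sum>p\<in>S. \<Sum>i<n. A (p i) * H)" by (rule sum.swap)
  also have "\<dots> = (\<Sum>p\<in>S. (\<Sum>j<n. A j) * H)"
  proof (intro sum.cong refl)
    fix p assume "p \<in> S"
    then have "p permutes {..<n}" by (simp add: S_def lessThan_atLeast0)
    from sum.permute[OF this, of A] show "(\<Sum>i<n. A (p i) * H) = (\<Sum>j<n. A j) * H"
      by (simp add: sum_distrib_right o_def)
  qed
  also have "\<dots> = fact n * H * (\<Sum>j<n. A j)"
    by (simp add: S_def card_permutations[of "{0..<n}" n])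
  finally show ?thesis by (simp add: A_def H_def)
qed

section \<open>The Jacobi matrix and its limit\<close>

definition jac_offdiag :: "real \<Rightarrow> nat \<Rightarrow> real" where
  "jac_offdiag \<mu> i = sqrt (bracket \<mu> i * bracket \<mu> (i - 1)) / 2"

text \<open>\<open>jac \<mu> k j i\<close> is the inner product of \<open>t^(2k) p\<^sub>j\<close> and \<open>p\<^sub>i\<close> for the orthonormal polynomials \<open>p\<^sub>i\<close>. Working with \<open>t^2\<close>
instead of \<open>t\<close> averages even and odd indices: the diagonal entry
\<open>([i] + [i + 1]) / 2 = i + 1/2 + \<mu>\<close> has no parity term. For \<open>i < 2\<close> the coefficient \<open>jac_offdiag \<mu> i\<close> is zero, so that the
truncated \<open>i - 2\<close> does not matter.\<close>

fun jac :: "real \<Rightarrow> nat \<Rightarrow> nat \<Rightarrow> nat \<Rightarrow> real" where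
  "jac \<mu> 0 j i = (if i = j then 1 else 0)"
| "jac \<mu> (Suc k) j i = jac_offdiag \<mu> (i + 2) * jac \<mu> k j (i + 2) + (real i + 1/2 + \<mu>) * jac \<mu> k j i
     + jac_offdiag \<mu> i * jac \<mu> k j (i - 2)"

lemma bracket_nonneg: "\<mu> \<ge> 0 \<Longrightarrow> bracket \<mu> i \<ge> 0"
  by (simp add: bracket_def)

lemma jac_offdiag_nonneg: "\<mu> \<ge> 0 \<Longrightarrow> jac_offdiag \<mu> i \<ge> 0"
  by (simp add: jac_offdiag_def bracket_nonneg)

lemma jac_offdiag_le:
  assumes "\<mu> \<ge> 0"
  shows "jac_offdiag \<mu> i \<le> real i + 2 * \<mu>"
proof -
  have "bracket \<mu> i \<le> real i + 2 * \<mu>" "bracket \<mu> (i - 1) \<le> real i + 2 * \<mu>" using assms by (auto simp: bracket_def)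
  then have "sqrt (bracket \<mu> i * bracket \<mu> (i - 1)) \<le> sqrt ((real i + 2 * \<mu>) * (real i + 2 * \<mu>))"
    using bracket_nonneg[OF assms] by (intro real_sqrt_le_mono mult_mono) (auto intro: order.trans)
  also have "\<dots> = real i + 2 * \<mu>" using assms by simp
  finally show ?thesis using assms unfolding jac_offdiag_def by (simp add: field_simps)
qed

text \<open>Polynomial growth in \<open>i\<close> and \<open>\<mu>\<close>, uniform in \<open>j\<close>; used as domination in the limit \<open>n \<rightarrow> \<infinity>\<close>.\<close>

lemma jac_bound:
  assumes \<mu>: "\<mu> \<ge> 0"
  shows "\<bar>jac \<mu> k j i\<bar> \<le> (5 * (real i + 2 * real k + 2 + 2 * \<mu>)) ^ k"
proof (induction k arbitrary: i)
  case 0 show ?case by simp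
next
  case (Suc k)
  define C where "C = 5 * (real i + 2 * real (Suc k) + 2 + 2 * \<mu>)"
  have C0: "C \<ge> 0" using \<mu> by (simp add: C_def)
  have b: "\<bar>jac \<mu> k j i'\<bar> \<le> C ^ k" if "i' \<le> i + 2" for i'
    by (rule order.trans[OF Suc.IH power_mono]) (use that \<mu> in \<open>auto simp: C_def\<close>)
  have G: "\<bar>jac_offdiag \<mu> (i + 2)\<bar> \<le> real i + 2 + 2 * \<mu>" "\<bar>jac_offdiag \<mu> i\<bar> \<le> real i + 2 + 2 * \<mu>"
    using jac_offdiag_le[OF \<mu>, of "i + 2"] jac_offdiag_le[OF \<mu>, of i] jac_offdiag_nonneg[OF \<mu>, of i] jac_offdiag_nonneg[OF \<mu>, of "i + 2"] by auto
  have "\<bar>jac \<mu> (Suc k) j i\<bar> \<le> \<bar>jac_offdiag \<mu> (i + 2) * jac \<mu> k j (i + 2)\<bar> + \<bar>(real i + 1/2 + \<mu>) * jac \<mu> k j i\<bar> + \<bar>jac_offdiag \<mu> i * jac \<mu> k j (i - 2)\<bar>"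
    unfolding jac.simps by linarith
  also have "\<dots> \<le> (real i + 2 + 2 * \<mu>) * C ^ k + (real i + 2 + 2 * \<mu>) * C ^ k + (real i + 2 + 2 * \<mu>) * C ^ k"
    unfolding abs_mult
    by (intro add_mono mult_mono b G) (use \<mu> C0 in auto)
  also have "\<dots> = (3 * (real i + 2 + 2 * \<mu>)) * C ^ k" by simp
  also have "\<dots> \<le> C * C ^ k"
    using \<mu> C0 by (intro mult_right_mono) (auto simp: C_def)
  finally show ?case by (simp add: C_def)
qed

lemma opoly_X2:
  "[:0, 1:] * ([:0, 1:] * opoly \<mu> i) = opoly \<mu> (i + 2) + Polynomial.smult (real i + 1/2 + \<mu>) (opoly \<mu> i)
     + Polynomial.smult (bracket \<mu> i * bracket \<mu> (i - 1) / 4) (opoly \<mu> (i - 2))"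
proof -
  have X: "[:0, 1:] * opoly \<mu> i = opoly \<mu> (Suc i) + Polynomial.smult (bracket \<mu> i / 2) (opoly \<mu> (i - 1))" for i
    by (cases i) (auto simp: bracket_def)
  have s: "bracket \<mu> (Suc i) / 2 + bracket \<mu> i / 2 = real i + 1/2 + \<mu>"
    by (auto simp: bracket_def field_simps)
  show ?thesis
  proof (cases i)
    case 0
    then show ?thesis by (simp add: bracket_def field_simps)
  next
    case (Suc j)
    have "[:0, 1:] * ([:0, 1:] * opoly \<mu> i) = [:0, 1:] * opoly \<mu> (Suc i) + Polynomial.smult (bracket \<mu> i / 2) ([:0, 1:] * opoly \<mu> (i - 1))"
      unfolding X[of i] by (simp only: distrib_left mult_smult_right)
    also have "\<dots> = opoly \<mu> (i + 2) + Polynomial.smult (bracket \<mu> (Suc i) / 2 + bracket \<mu> i / 2) (opoly \<mu> i)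
        + Polynomial.smult (bracket \<mu> i * bracket \<mu> (i - 1) / 4) (opoly \<mu> (i - 2))"
      unfolding X[of "Suc i"] X[of "i - 1"] using Suc
      by (simp add: smult_add_right smult_add_left del: opoly.simps)
    finally show ?thesis unfolding s .
  qed
qed

lemma wgauss_integral_jac:
  assumes \<mu>: "\<mu> \<ge> 0"
  shows "wgauss_integral \<mu> ([:0, 1:] ^ (2 * k) * (opoly \<mu> j * opoly \<mu> i)) = jac \<mu> k j i * sqrt (opoly_norm \<mu> i) * sqrt (opoly_norm \<mu> j)"
proof (induction k arbitrary: i)
  case 0
  show ?case
    using wgauss_integral_opoly_orth[OF \<mu>, of j i] wgauss_integral_opoly_self[OF \<mu>, of j] opoly_norm_pos[OF \<mu>, of j]
    by (cases "i = j") (auto simp: mult.commute)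
next
  case (Suc k)
  let ?X = "[:0, 1:] :: real poly"
  have h2: "sqrt (opoly_norm \<mu> (i + 2)) = jac_offdiag \<mu> (i + 2) * sqrt (opoly_norm \<mu> i)" for i
  proof -
    have "opoly_norm \<mu> (Suc (Suc i)) = bracket \<mu> (Suc (Suc i)) / 2 * (bracket \<mu> (Suc i) / 2 * opoly_norm \<mu> i)"
      by (simp only: opoly_norm_Suc[OF \<mu>])
    then have "opoly_norm \<mu> (i + 2) = (bracket \<mu> (i + 2) * bracket \<mu> (i + 2 - 1)) / 4 * opoly_norm \<mu> i"
      by simp
    then have "sqrt (opoly_norm \<mu> (i + 2)) = sqrt ((bracket \<mu> (i + 2) * bracket \<mu> (i + 2 - 1)) / 4 * opoly_norm \<mu> i)"
      by (simp only:)
    also have "\<dots> = sqrt (bracket \<mu> (i + 2) * bracket \<mu> (i + 2 - 1)) / sqrt 4 * sqrt (opoly_norm \<mu> i)"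
      unfolding real_sqrt_mult[of "bracket \<mu> (i + 2) * bracket \<mu> (i + 2 - 1) / 4"] real_sqrt_divide ..
    finally show ?thesis by (simp add: jac_offdiag_def)
  qed
  have g: "bracket \<mu> i * bracket \<mu> (i - 1) / 4 * sqrt (opoly_norm \<mu> (i - 2)) = jac_offdiag \<mu> i * sqrt (opoly_norm \<mu> i)"
  proof (cases "i < 2")
    case True
    then have "bracket \<mu> i * bracket \<mu> (i - 1) = 0" by (cases i) (auto simp: bracket_def less_Suc_eq)
    then show ?thesis by (auto simp: jac_offdiag_def)
  next
    case False
    then obtain l where l: "i = l + 2" by (metis add.commute le_Suc_ex not_less)
    have "jac_offdiag \<mu> i * jac_offdiag \<mu> i = bracket \<mu> i * bracket \<mu> (i - 1) / 4"
      using bracket_nonneg[OF \<mu>] by (simp add: jac_offdiag_def)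
    then show ?thesis using h2[of l] by (simp add: l mult.assoc[symmetric])
  qed
  have "?X ^ (2 * Suc k) * (opoly \<mu> j * opoly \<mu> i) = ?X ^ (2 * k) * (opoly \<mu> j * (?X * (?X * opoly \<mu> i)))"
  proof -
    have "?X ^ (2 * Suc k) = ?X * (?X * ?X ^ (2 * k))"
      unfolding mult_Suc_right power_add power2_eq_square by (simp only: mult.assoc)
    then show ?thesis by (simp only: mult_ac)
  qed
  also have "\<dots> = ?X ^ (2 * k) * (opoly \<mu> j * opoly \<mu> (i + 2))
      + Polynomial.smult (real i + 1/2 + \<mu>) (?X ^ (2 * k) * (opoly \<mu> j * opoly \<mu> i))
      + Polynomial.smult (bracket \<mu> i * bracket \<mu> (i - 1) / 4) (?X ^ (2 * k) * (opoly \<mu> j * opoly \<mu> (i - 2)))"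
    unfolding opoly_X2 by (simp only: distrib_left mult_smult_right)
  finally have "wgauss_integral \<mu> (?X ^ (2 * Suc k) * (opoly \<mu> j * opoly \<mu> i)) =
      jac \<mu> k j (i + 2) * sqrt (opoly_norm \<mu> (i + 2)) * sqrt (opoly_norm \<mu> j)
      + (real i + 1/2 + \<mu>) * (jac \<mu> k j i * sqrt (opoly_norm \<mu> i) * sqrt (opoly_norm \<mu> j))
      + bracket \<mu> i * bracket \<mu> (i - 1) / 4 * (jac \<mu> k j (i - 2) * sqrt (opoly_norm \<mu> (i - 2)) * sqrt (opoly_norm \<mu> j))"
    by (simp only: wgauss_integral_add[OF \<mu>] wgauss_integral_smult[OF \<mu>] Suc.IH)
  also have "bracket \<mu> i * bracket \<mu> (i - 1) / 4 * (jac \<mu> k j (i - 2) * sqrt (opoly_norm \<mu> (i - 2)) * sqrt (opoly_norm \<mu> j)) =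
      jac \<mu> k j (i - 2) * (bracket \<mu> i * bracket \<mu> (i - 1) / 4 * sqrt (opoly_norm \<mu> (i - 2))) * sqrt (opoly_norm \<mu> j)"
    by (simp only: mult_ac)
  finally show ?case unfolding g h2 by (simp add: algebra_simps)
qed

lemma wgauss_integral_jac_diag:
  assumes \<mu>: "\<mu> \<ge> 0"
  shows "wgauss_integral \<mu> ([:0, 1:] ^ (2 * k) * (opoly \<mu> j * opoly \<mu> j)) / opoly_norm \<mu> j = jac \<mu> k j j"
  unfolding wgauss_integral_jac[OF \<mu>] using opoly_norm_pos[OF \<mu>, of j] by (simp add: mult.assoc)

text \<open>The recursion of \<open>jac\<close> with the coefficients frozen at their limits along \<open>i / n \<rightarrow> s\<close>; \<open>r\<close> counts the distance from
the diagonal in steps of two, and it ranges over all integers because the boundary at \<open>i = 0\<close> has moved to infinity.\<close>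

fun lim_jac :: "real \<Rightarrow> real \<Rightarrow> nat \<Rightarrow> int \<Rightarrow> real" where
  "lim_jac c s 0 r = (if r = 0 then 1 else 0)"
| "lim_jac c s (Suc k) r = sqrt (s * (s + 2 * c)) / 2 * lim_jac c s k (r + 1) + (s + c) * lim_jac c s k r
     + sqrt (s * (s + 2 * c)) / 2 * lim_jac c s k (r - 1)"

lemma jac_tendsto:
  fixes \<mu> :: "nat \<Rightarrow> real" and j :: "nat \<Rightarrow> nat"
  assumes \<mu>: "(\<lambda>n. \<mu> n / real n) \<longlonglongrightarrow> c" and j: "(\<lambda>n. real (j n) / real n) \<longlonglongrightarrow> s" and s: "s > 0" and c: "c \<ge> 0"
  shows "(\<lambda>n. jac (\<mu> n) k (j n) (nat (int (j n) + 2 * r)) / real n ^ k) \<longlonglongrightarrow> lim_jac c s k r"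
proof -
  have inf: "filterlim (\<lambda>n. real (j n)) at_top sequentially"
  proof -
    have l: "filterlim (\<lambda>n. real (j n) / real n * real n) at_top sequentially"
      by (rule filterlim_tendsto_pos_mult_at_top[OF j s filterlim_real_sequentially])
    have e: "eventually (\<lambda>n. real (j n) / real n * real n = real (j n)) sequentially"
      using eventually_gt_at_top[of 0] by eventually_elim simp
    show ?thesis by (rule iffD1[OF filterlim_cong[OF refl refl e] l])
  qed
  show ?thesis
  proof (induction k arbitrary: r)
    case 0
    from inf have "eventually (\<lambda>n. real (j n) > \<bar>2 * real_of_int r\<bar>) sequentially"
      by (simp add: filterlim_at_top_dense)
    then have "eventually (\<lambda>n. jac (\<mu> n) 0 (j n) (nat (int (j n) + 2 * r)) / real n ^ 0 = lim_jac c s 0 r) sequentially"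
    proof eventually_elim
      case (elim n)
      then have "int (j n) > \<bar>2 * r\<bar>" by linarith
      then have "(nat (int (j n) + 2 * r) = j n) = (r = 0)" by auto
      then show ?case by simp
    qed
    then show ?case by (rule tendsto_eventually)
  next
    case (Suc k)
    have inv: "(\<lambda>n. 1 / real n) \<longlonglongrightarrow> 0" by (rule lim_1_over_n)
    define i where "i r n = nat (int (j n) + 2 * r)" for r :: int and n
    have big: "eventually (\<lambda>n. int (j n) > \<bar>2 * r\<bar> + 2 \<and> n > 0) sequentially" for r :: int
    proof -
      have "eventually (\<lambda>n. real (j n) > \<bar>2 * real_of_int r\<bar> + 2) sequentially"
        using inf by (simp add: filterlim_at_top_dense)
      then show ?thesis using eventually_gt_at_top[of 0] by eventually_elim linarith
    qed
    have iL: "(\<lambda>n. real (i r n) / real n) \<longlonglongrightarrow> s" for r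
    proof -
      have "(\<lambda>n. real (j n) / real n + 2 * real_of_int r * (1 / real n)) \<longlonglongrightarrow> s + 2 * real_of_int r * 0"
        by (intro tendsto_intros j inv)
      moreover have "eventually (\<lambda>n. real (j n) / real n + 2 * real_of_int r * (1 / real n) = real (i r n) / real n) sequentially"
        using big[of r] by eventually_elim (auto simp: i_def field_simps)
      ultimately show ?thesis by (auto intro: Lim_transform_eventually)
    qed
    \<comment> \<open>The bracket is \<open>i\<close> or \<open>i + 2\<mu>\<close> by parity, and of two consecutive ones exactly one carries the \<open>2\<mu>\<close>: the product is \<open>i (i - 1) + 2 \<mu> (i - o')\<close> with \<open>o' \<in> {0, 1}\<close>.\<close>
    have GL: "(\<lambda>n. jac_offdiag (\<mu> n) (i r n) / real n) \<longlonglongrightarrow> sqrt (s * (s + 2 * c)) / 2" for r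
    proof -
      \<comment> \<open>The parity correction is bounded, hence negligible after division by \<open>n\<close>.\<close>
      define o' where "o' n = (if odd (i r n) then 1 else 0 :: real)" for n
      have o': "(\<lambda>n. o' n * (1 / real n)) \<longlonglongrightarrow> 0"
        by (rule lim_null_mult_left_bounded[of _ 1]) (auto simp: o'_def inv)
      let ?x = "\<lambda>n. real (i r n) / real n"
      have "(\<lambda>n. sqrt (?x n * (?x n - 1 / real n) + 2 * (\<mu> n / real n) * (?x n - o' n * (1 / real n))) / 2)
         \<longlonglongrightarrow> sqrt (s * (s - 0) + 2 * c * (s - 0)) / 2"
        by (intro tendsto_intros iL inv \<mu> o') simp
      moreover have "eventually (\<lambda>n. sqrt (?x n * (?x n - 1 / real n) + 2 * (\<mu> n / real n) * (?x n - o' n * (1 / real n))) / 2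
          = jac_offdiag (\<mu> n) (i r n) / real n) sequentially"
        using big[of r]
      proof eventually_elim
        case (elim n)
        then have n: "real n > 0" and i: "i r n \<ge> 1" by (auto simp: i_def)
        have "bracket (\<mu> n) (i r n) * bracket (\<mu> n) (i r n - 1) = real (i r n) * (real (i r n) - 1) + 2 * \<mu> n * (real (i r n) - o' n)"
          using i by (auto simp: bracket_def o'_def algebra_simps)
        moreover have "\<dots> = (real n)\<^sup>2 * (?x n * (?x n - 1 / real n) + 2 * (\<mu> n / real n) * (?x n - o' n * (1 / real n)))"
          using n by (simp add: power2_eq_square field_simps)
        ultimately show ?case using n by (simp add: jac_offdiag_def real_sqrt_mult)
      qed
      ultimately show ?thesis by (auto intro: Lim_transform_eventually simp: algebra_simps)
    qed
    have dL: "(\<lambda>n. (real (i r n) + 1/2 + \<mu> n) / real n) \<longlonglongrightarrow> s + c" for r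
    proof -
      have "(\<lambda>n. real (i r n) / real n + 1/2 * (1 / real n) + \<mu> n / real n) \<longlonglongrightarrow> s + 1/2 * 0 + c"
        by (intro tendsto_intros iL inv \<mu>)
      then show ?thesis by (simp add: add_divide_distrib)
    qed
    have "(\<lambda>n. jac_offdiag (\<mu> n) (i (r + 1) n) / real n * (jac (\<mu> n) k (j n) (i (r + 1) n) / real n ^ k)
        + (real (i r n) + 1/2 + \<mu> n) / real n * (jac (\<mu> n) k (j n) (i r n) / real n ^ k)
        + jac_offdiag (\<mu> n) (i r n) / real n * (jac (\<mu> n) k (j n) (i (r - 1) n) / real n ^ k)) \<longlonglongrightarrow> lim_jac c s (Suc k) r"
      unfolding lim_jac.simps by (intro tendsto_intros GL dL Suc.IH[folded i_def])
    moreover have "eventually (\<lambda>n. jac_offdiag (\<mu> n) (i (r + 1) n) / real n * (jac (\<mu> n) k (j n) (i (r + 1) n) / real n ^ k)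
        + (real (i r n) + 1/2 + \<mu> n) / real n * (jac (\<mu> n) k (j n) (i r n) / real n ^ k)
        + jac_offdiag (\<mu> n) (i r n) / real n * (jac (\<mu> n) k (j n) (i (r - 1) n) / real n ^ k)
        = jac (\<mu> n) (Suc k) (j n) (i r n) / real n ^ Suc k) sequentially"
      using big[of r]
    proof eventually_elim
      case (elim n)
      then have "i (r + 1) n = i r n + 2" "i (r - 1) n = i r n - 2" by (auto simp: i_def)
      then have e: "jac (\<mu> n) (Suc k) (j n) (i r n) = jac_offdiag (\<mu> n) (i (r + 1) n) * jac (\<mu> n) k (j n) (i (r + 1) n)
         + (real (i r n) + 1/2 + \<mu> n) * jac (\<mu> n) k (j n) (i r n) + jac_offdiag (\<mu> n) (i r n) * jac (\<mu> n) k (j n) (i (r - 1) n)"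
        by simp
      have gen: "a / x * (b / y) + c / x * (d / y) + e / x * (f / y) = (a * b + c * d + e * f) / (x * y)"
        for a b c d e f x y :: real
        by (simp add: add_divide_distrib)
      show ?case unfolding e gen power_Suc ..
    qed
    ultimately show ?case unfolding i_def by (rule Lim_transform_eventually)
  qed
qed

text \<open>The symbol of the Toeplitz operator with the coefficients of \<open>lim_jac\<close>.\<close>

definition tau :: "real \<Rightarrow> real \<Rightarrow> real \<Rightarrow> real" where
  "tau c s \<theta> = s + c + sqrt (s * (s + 2 * c)) * cos \<theta>"

text \<open>The Fourier coefficients of the powers of the symbol obey the recursion of \<open>lim_jac\<close>, by
\<open>2 cos \<theta> cos (r \<theta>) = cos ((r + 1) \<theta>) + cos ((r - 1) \<theta>)\<close>.\<close>

lemma lim_jac_integral: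
  "((\<lambda>\<theta>. tau c s \<theta> ^ k * cos (of_int r * \<theta>)) has_integral pi * lim_jac c s k r) {0..pi}"
proof (induction k arbitrary: r)
  case 0
  show ?case
  proof (cases "r = 0")
    case True
    then show ?thesis using has_integral_const_real[of "1::real" 0 pi] by simp
  next
    case False
    have "((\<lambda>\<theta>. cos (of_int r * \<theta>)) has_integral (sin (of_int r * pi) / of_int r - sin (of_int r * 0) / of_int r)) {0..pi}"
      using False
      by (intro fundamental_theorem_of_calculus)
         (auto intro!: derivative_eq_intros simp: has_real_derivative_iff_has_vector_derivative[symmetric])
    moreover have "sin (of_int r * pi) = 0" by (metis sin_npi_int mult.commute)
    ultimately show ?thesis using False by simp
  qed
next
  case (Suc k)
  let ?\<rho> = "sqrt (s * (s + 2 * c))"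
  have "((\<lambda>\<theta>. ?\<rho> / 2 * (tau c s \<theta> ^ k * cos (of_int (r + 1) * \<theta>)) + (s + c) * (tau c s \<theta> ^ k * cos (of_int r * \<theta>))
      + ?\<rho> / 2 * (tau c s \<theta> ^ k * cos (of_int (r - 1) * \<theta>))) has_integral
      ?\<rho> / 2 * (pi * lim_jac c s k (r + 1)) + (s + c) * (pi * lim_jac c s k r) + ?\<rho> / 2 * (pi * lim_jac c s k (r - 1))) {0..pi}"
    by (intro has_integral_add has_integral_mult_right Suc.IH)
  moreover have "?\<rho> / 2 * (tau c s \<theta> ^ k * cos (of_int (r + 1) * \<theta>)) + (s + c) * (tau c s \<theta> ^ k * cos (of_int r * \<theta>))
      + ?\<rho> / 2 * (tau c s \<theta> ^ k * cos (of_int (r - 1) * \<theta>)) = tau c s \<theta> ^ Suc k * cos (of_int r * \<theta>)" for \<theta>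
  proof -
    have "cos (of_int (r + 1) * \<theta>) + cos (of_int (r - 1) * \<theta>) = 2 * cos \<theta> * cos (of_int r * \<theta>)"
      by (simp add: distrib_right left_diff_distrib cos_add cos_diff)
    then have e: "?\<rho> / 2 * (cos (of_int (r + 1) * \<theta>) + cos (of_int (r - 1) * \<theta>)) + (s + c) * cos (of_int r * \<theta>)
       = ?\<rho> / 2 * (2 * cos \<theta> * cos (of_int r * \<theta>)) + (s + c) * cos (of_int r * \<theta>)" by (simp only:)
    have gen: "p / 2 * (T * A) + q * (T * B) + p / 2 * (T * C) = T * (p / 2 * (A + C) + q * B)" for p q T A B C :: real
      by (simp add: algebra_simps)
    show ?thesis unfolding gen e by (simp add: tau_def algebra_simps)
  qed
  ultimately show ?case by (simp add: algebra_simps del: of_int_add of_int_diff)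
qed

lemma step_function_integral:
  fixes g :: "nat \<Rightarrow> real"
  assumes n: "n > 0"
  shows "has_bochner_integral lborel (\<lambda>s. indicator {0..<1} s * g (nat \<lfloor>real n * s\<rfloor>)) (1 / real n * (\<Sum>j<n. g j))"
proof -
  have "has_bochner_integral lborel (\<lambda>s. \<Sum>j<n. indicator {real j / real n..<(real j + 1) / real n} s *\<^sub>R g j)
     (\<Sum>j<n. measure lborel {real j / real n..<(real j + 1) / real n} *\<^sub>R g j)"
    by (intro has_bochner_integral_sum has_bochner_integral_indicator) (auto simp: divide_right_mono)
  moreover have "(\<Sum>j<n. measure lborel {real j / real n..<(real j + 1) / real n} *\<^sub>R g j) = 1 / real n * (\<Sum>j<n. g j)"
    using n by (simp add: sum_distrib_left field_simps)
  moreover have "(\<Sum>j<n. indicator {real j / real n..<(real j + 1) / real n} s *\<^sub>R g j) = indicator {0..<1} s * g (nat \<lfloor>real n * s\<rfloor>)" for s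
  proof (cases "s \<in> {0..<1}")
    case True
    define l where "l = nat \<lfloor>real n * s\<rfloor>"
    have l: "real l \<le> real n * s" "real n * s < real l + 1" using True n by (auto simp: l_def)
    have "real n * s < real n * 1" using True n by (intro mult_strict_left_mono) auto
    then have ln: "l < n" using l by linarith
    have "indicator {real j / real n..<(real j + 1) / real n} s *\<^sub>R g j = (if j = l then g j else 0)" for j
    proof -
      have "s \<in> {real j / real n..<(real j + 1) / real n} \<longleftrightarrow> real j \<le> real n * s \<and> real n * s < real j + 1"
        using n by (simp add: field_simps)
      also have "\<dots> \<longleftrightarrow> j = l" using l by linarith
      finally show ?thesis by (simp add: indicator_def)
    qed
    then show ?thesis using True ln by (simp add: l_def)
  next
    case False
    have "s \<notin> {real j / real n..<(real j + 1) / real n}" if "j < n" for j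
    proof
      assume a: "s \<in> {real j / real n..<(real j + 1) / real n}"
      have "0 \<le> real j / real n" by simp
      moreover have "(real j + 1) / real n \<le> 1" using that n by (simp add: field_simps)
      ultimately have "0 \<le> s" "s < 1" using a by (meson atLeastLessThan_iff order.trans less_le_trans)+
      then show False using False by simp
    qed
    then show ?thesis using False by simp
  qed
  ultimately show ?thesis by simp
qed

text \<open>The average is the integral over \<open>s\<close> of a step function with \<open>j = \<lfloor>n s\<rfloor>\<close>; dominated
convergence with \<open>jac_tendsto\<close> for fixed \<open>s > 0\<close> and the bound \<open>jac_bound\<close>.\<close>

lemma jac_average_tendsto:
  fixes \<mu> :: "nat \<Rightarrow> real"
  assumes \<mu>: "(\<lambda>n. \<mu> n / real n) \<longlonglongrightarrow> c" and c: "c \<ge> 0" and pos: "\<And>n. n \<ge> 1 \<Longrightarrow> \<mu> n > 0"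
  shows "(\<lambda>n. 1 / real n * (\<Sum>j<n. jac (\<mu> n) k j j / real n ^ k)) \<longlonglongrightarrow>
      (\<integral>s. indicator {0..<1} s * lim_jac c s k 0 \<partial>lborel)"
proof -
  define f where "f n s = indicator {0..<1} s * (jac (\<mu> n) k (nat \<lfloor>real n * s\<rfloor>) (nat \<lfloor>real n * s\<rfloor>) / real n ^ k)" for n and s :: real
  obtain K where K: "\<And>n. \<bar>\<mu> n / real n\<bar> \<le> K"
    using convergent_imp_Bseq[OF convergentI[OF \<mu>]] by (auto simp: Bseq_def)
  have K0: "K \<ge> 0" using K[of 0] by simp
  define M where "M = (5 * (1 + 2 * real k + 2 + 2 * K)) ^ k"
  have f_bound: "norm (f n s) \<le> indicator {0..<1} s * M" if n: "n \<ge> 1" for n s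
  proof (cases "s \<in> {0..<1}")
    case True
    define l where "l = nat \<lfloor>real n * s\<rfloor>"
    have "real l \<le> real n * s" using True by (simp add: l_def)
    also have "\<dots> \<le> real n * 1" using True n by (intro mult_left_mono) auto
    finally have l: "real l \<le> real n" by simp
    have \<mu>0: "\<mu> n \<ge> 0" using pos[OF n] by simp
    have "\<mu> n \<le> K * real n" using K[of n] n \<mu>0 by (simp add: field_simps)
    moreover have "2 * real k \<le> 2 * real k * real n" "2 \<le> 2 * real n"
      using n by (auto simp: mult_le_cancel_left1)
    ultimately have "5 * (real l + 2 * real k + 2 + 2 * \<mu> n) \<le> 5 * (1 + 2 * real k + 2 + 2 * K) * real n"
      using l by (simp add: algebra_simps)
    then have "(5 * (real l + 2 * real k + 2 + 2 * \<mu> n)) ^ k \<le> (5 * (1 + 2 * real k + 2 + 2 * K) * real n) ^ k"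
      using \<mu>0 by (intro power_mono) auto
    then have "\<bar>jac (\<mu> n) k l l\<bar> \<le> M * real n ^ k"
      using jac_bound[OF \<mu>0, of k l l] unfolding M_def power_mult_distrib by linarith
    moreover have "f n s = jac (\<mu> n) k l l / real n ^ k" using True by (simp add: f_def l_def)
    ultimately show ?thesis using True n by (simp add: abs_divide pos_divide_le_eq)
  qed (simp add: f_def)
  have f_meas [measurable]: "f n \<in> borel_measurable lborel" if "n \<ge> 1" for n
    using step_function_integral[of n "\<lambda>l. jac (\<mu> n) k l l / real n ^ k"] that
    unfolding f_def[abs_def] by (auto simp: has_bochner_integral_iff)
  \<comment> \<open>The null set \<open>s = 0\<close> is excluded because there the row index need not tend to infinity.\<close>
  have ptw: "(\<lambda>n. f (Suc n) s) \<longlonglongrightarrow> indicator {0..<1} s * lim_jac c s k 0" if s0: "s \<noteq> 0" for s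
  proof (cases "s \<in> {0..<1}")
    case True
    then have s: "s > 0" using s0 by auto
    have j: "(\<lambda>n. real (nat \<lfloor>real n * s\<rfloor>) / real n) \<longlonglongrightarrow> s"
    proof (rule tendsto_sandwich)
      show "eventually (\<lambda>n. s - 1 / real n \<le> real (nat \<lfloor>real n * s\<rfloor>) / real n) sequentially"
        using eventually_gt_at_top[of 0]
      proof eventually_elim
        case (elim n)
        have "real n * s < real_of_int \<lfloor>real n * s\<rfloor> + 1" by linarith
        moreover have "real (nat \<lfloor>real n * s\<rfloor>) = real_of_int \<lfloor>real n * s\<rfloor>" using s by simp
        ultimately have "(real n * s - 1) / real n \<le> real (nat \<lfloor>real n * s\<rfloor>) / real n"
          by (intro divide_right_mono) auto
        then show ?case using elim by (simp add: diff_divide_distrib)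
      qed
      show "eventually (\<lambda>n. real (nat \<lfloor>real n * s\<rfloor>) / real n \<le> s) sequentially"
        using eventually_gt_at_top[of 0]
      proof eventually_elim
        case (elim n)
        have "real (nat \<lfloor>real n * s\<rfloor>) \<le> real n * s" using s by simp
        then show ?case using elim by (simp add: pos_divide_le_eq mult.commute)
      qed
      have "(\<lambda>n. s - 1 / real n) \<longlonglongrightarrow> s - 0" by (intro tendsto_intros lim_1_over_n)
      then show "(\<lambda>n. s - 1 / real n) \<longlonglongrightarrow> s" by simp
    qed auto
    have "(\<lambda>n. jac (\<mu> n) k (nat \<lfloor>real n * s\<rfloor>) (nat (int (nat \<lfloor>real n * s\<rfloor>) + 2 * 0)) / real n ^ k) \<longlonglongrightarrow> lim_jac c s k 0"
      by (rule jac_tendsto[OF \<mu> j s c])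
    then have "(\<lambda>n. f n s) \<longlonglongrightarrow> lim_jac c s k 0" using True by (simp add: f_def)
    from LIMSEQ_Suc[OF this] show ?thesis using True by simp
  qed (simp add: f_def)
  have "(\<lambda>n. \<integral>s. f (Suc n) s \<partial>lborel) \<longlonglongrightarrow> (\<integral>s. indicator {0..<1} s * lim_jac c s k 0 \<partial>lborel)"
  proof (rule integral_dominated_convergence[where w="\<lambda>s. indicator {0..<1} s * M"])
    show "AE s in lborel. (\<lambda>n. f (Suc n) s) \<longlonglongrightarrow> indicator {0..<1} s * lim_jac c s k 0"
      using AE_lborel_singleton[of 0] by eventually_elim (rule ptw)
    show "(\<lambda>s. indicator {0..<1} s * lim_jac c s k 0) \<in> borel_measurable lborel"
    proof -
      have [measurable]: "(\<lambda>s. lim_jac c s k r) \<in> borel_measurable borel" for r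
        by (induction k arbitrary: r) auto
      show ?thesis by measurable
    qed
    show "integrable lborel (\<lambda>s. indicator {0..<1::real} s * M)"
      by (intro integrable_mult_left integrable_real_indicator) (auto simp: ennreal_less_top)
    show "AE s in lborel. norm (f (Suc n) s) \<le> indicator {0..<1} s * M" for n
      by (intro AE_I2 f_bound) simp
  qed (rule f_meas, simp)
  moreover have "(\<integral>s. f (Suc n) s \<partial>lborel) = 1 / real (Suc n) * (\<Sum>j<Suc n. jac (\<mu> (Suc n)) k j j / real (Suc n) ^ k)" for n
    unfolding f_def by (rule has_bochner_integral_integral_eq[OF step_function_integral]) simp
  ultimately have "(\<lambda>n. 1 / real (Suc n) * (\<Sum>j<Suc n. jac (\<mu> (Suc n)) k j j / real (Suc n) ^ k)) \<longlonglongrightarrow>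
      (\<integral>s. indicator {0..<1} s * lim_jac c s k 0 \<partial>lborel)" by (simp only:)
  then show ?thesis by (rule LIMSEQ_imp_Suc)
qed

section \<open>The limiting moments\<close>

lemma tau_pos:
  assumes "c > 0" "s \<ge> 0"
  shows "tau c s \<theta> > 0"
proof -
  have "sqrt (s * (s + 2 * c)) < sqrt ((s + c)\<^sup>2)"
    using assms by (intro real_sqrt_less_mono) (simp add: power2_eq_square algebra_simps)
  then have r: "sqrt (s * (s + 2 * c)) < s + c" using assms by simp
  have "- sqrt (s * (s + 2 * c)) \<le> sqrt (s * (s + 2 * c)) * cos \<theta>"
    using mult_left_mono[of "-1" "cos \<theta>" "sqrt (s * (s + 2 * c))"] assms by simp
  then show ?thesis using r by (simp add: tau_def)
qed

text \<open>The value at \<open>s = 1\<close> of \<open>\<rho>\<^sub>s^2 sin^2 \<theta> \<tau>\<^sub>s^(k-1)\<close>, where \<open>\<rho>\<^sub>s^2 = s (s + 2c)\<close>. The quotient form includes \<open>k = 0\<close>.\<close>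

definition limit_integrand :: "real \<Rightarrow> nat \<Rightarrow> real \<Rightarrow> real" where
  "limit_integrand c k \<theta> = (1 + 2 * c) * (sin \<theta>)\<^sup>2 * tau c 1 \<theta> ^ k / tau c 1 \<theta>"

text \<open>The algebra behind the next lemma, with \<open>a = k - 1\<close>, \<open>C = cos \<theta>\<close>, \<open>S = sin \<theta>\<close>: the first summand is
\<open>\<partial>\<^sub>s (\<rho>\<^sub>s^2 S^2 \<tau>^a)\<close>, the second is \<open>\<partial>\<^sub>\<theta> (\<tau>^a S (\<rho>\<^sub>s + (s + c) C))\<close>.\<close>

lemma tau_flow_identity:
  fixes x a C S s c \<rho> :: real
  assumes x: "x > 0" "x = s + c + \<rho> * C" and CS: "S\<^sup>2 + C\<^sup>2 = 1"
  shows "S\<^sup>2 * (2 * (s + c) * x powr a + a * x powr (a - 1) * (\<rho> * (\<rho> + (s + c) * C)))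
     + (a * x powr (a - 1) * (- \<rho> * S) * (S * (\<rho> + (s + c) * C)) + x powr a * (C * (\<rho> + (s + c) * C) - (s + c) * S\<^sup>2))
     = x powr (a + 1)"
proof -
  have "S\<^sup>2 * (2 * (s + c) * x powr a + a * x powr (a - 1) * (\<rho> * (\<rho> + (s + c) * C)))
     + (a * x powr (a - 1) * (- \<rho> * S) * (S * (\<rho> + (s + c) * C)) + x powr a * (C * (\<rho> + (s + c) * C) - (s + c) * S\<^sup>2))
     = x powr a * ((s + c) * (S\<^sup>2 + C\<^sup>2) + \<rho> * C)"
    by (simp add: power2_eq_square algebra_simps)
  also have "\<dots> = x powr a * x" unfolding CS using x by simp
  also have "\<dots> = x powr (a + 1)" using x by (simp add: powr_add)
  finally show ?thesis .
qed

text \<open>Integrating the identity over \<open>\<theta>\<close>, the \<open>\<theta>\<close>-derivative drops out since \<open>sin\<close> vanishes at both ends.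
So \<open>\<pi> lim_jac c s k 0\<close>, the integral of \<open>\<tau>\<^sub>s^k\<close>, is the \<open>s\<close>-derivative of the integral of
\<open>\<rho>\<^sub>s^2 sin^2 \<theta> \<tau>\<^sub>s^(k-1)\<close>, which vanishes at \<open>s = 0\<close>. Positivity of \<open>c\<close> keeps \<open>\<tau>\<close> away from zero.\<close>

lemma lim_jac_flow:
  assumes c: "c > 0"
  shows "((\<lambda>s. pi * lim_jac c s k 0) has_integral integral {0..pi} (limit_integrand c k)) {0..1}"
proof -
  define a where "a = real k - 1"
  define K where "K s \<theta> = s * (s + 2 * c) * (sin \<theta>)\<^sup>2 * tau c s \<theta> powr a" for s \<theta> :: real
  define K' where "K' s \<theta> = (sin \<theta>)\<^sup>2 * (2 * (s + c) * tau c s \<theta> powr a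
     + a * tau c s \<theta> powr (a - 1) * (sqrt (s * (s + 2 * c)) * (sqrt (s * (s + 2 * c)) + (s + c) * cos \<theta>)))" for s \<theta> :: real
  define F where "F s = integral {0..pi} (K s)" for s
  have tpos: "tau c s \<theta> > 0" "tau c s \<theta> \<noteq> 0" if "s \<ge> 0" for s \<theta> using tau_pos[OF c that, of \<theta>] by auto
  have pk: "tau c s \<theta> powr (a + 1) = tau c s \<theta> ^ k" if "s \<ge> 0" for s \<theta>
    using tpos[OF that] by (simp add: a_def powr_realpow)
  have contF: "continuous_on {0..1} F"
  proof -
    have "continuous_on ({0..1} \<times> cbox 0 pi) (\<lambda>(s, \<theta>). K s \<theta>)"
      unfolding K_def tau_def split_def
      by (intro continuous_intros) (use tpos in \<open>auto simp: tau_def\<close>)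
    from integral_continuous_on_param[OF this] show ?thesis by (simp add: F_def[abs_def])
  qed
  have deriv: "(F has_real_derivative pi * lim_jac c s k 0) (at s)" if s: "s \<in> {0<..<1}" for s
  proof -
    let ?U = "{0<..<1::real}"
    have "((\<lambda>x. integral (cbox 0 pi) (K x)) has_field_derivative integral (cbox 0 pi) (K' s)) (at s within ?U)"
    proof (rule leibniz_rule_field_derivative)
      fix x \<theta> :: real assume x: "x \<in> ?U"
      let ?r = "sqrt (x * (x + 2 * c))"
      have r: "x * (x + 2 * c) > 0" "?r > 0" "?r * ?r = x * (x + 2 * c)" using x c by auto
      have gen: "y * (1 + z / R * C) = R * (R + z * C)" if "y = R * R" "R > 0" for y z R C :: real
        using that by (simp add: field_simps)
      have dt: "((\<lambda>x. tau c x \<theta>) has_real_derivative (1 + (x + c) / ?r * cos \<theta>)) (at x)"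
        unfolding tau_def using r by (auto intro!: derivative_eq_intros simp: field_simps)
      have tp: "tau c x \<theta> > 0" using tpos x by simp
      have dp: "((\<lambda>x. tau c x \<theta> powr a) has_real_derivative a * tau c x \<theta> powr (a - 1) * (1 + (x + c) / ?r * cos \<theta>)) (at x within ?U)"
        using has_field_derivative_at_within[OF DERIV_fun_powr[OF dt tp, of a]] by (simp only: of_nat_1)
      have dq: "((\<lambda>x. x * (x + 2 * c) * (sin \<theta>)\<^sup>2) has_real_derivative 2 * (x + c) * (sin \<theta>)\<^sup>2) (at x within ?U)"
        by (auto intro!: derivative_eq_intros simp: algebra_simps)
      \<comment> \<open>The derivative of \<open>\<rho>\<^sub>s\<close> is singular at \<open>s = 0\<close>, but the prefactor \<open>\<rho>\<^sub>s^2\<close> compensates for it.\<close>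
      define q where "q = 1 + (x + c) / ?r * cos \<theta>"
      have "x * (x + 2 * c) * q = ?r * (?r + (x + c) * cos \<theta>)"
        unfolding q_def by (rule gen[OF r(3)[symmetric] r(2)])
      then have "(sin \<theta>)\<^sup>2 * (a * tau c x \<theta> powr (a - 1) * (x * (x + 2 * c) * q)) =
          (sin \<theta>)\<^sup>2 * (a * tau c x \<theta> powr (a - 1) * (?r * (?r + (x + c) * cos \<theta>)))"
        by (simp only:)
      then have "2 * (x + c) * (sin \<theta>)\<^sup>2 * tau c x \<theta> powr a + a * tau c x \<theta> powr (a - 1) * q * (x * (x + 2 * c) * (sin \<theta>)\<^sup>2)
         = K' x \<theta>"
        unfolding K'_def by (simp only: distrib_left mult_ac)
      with DERIV_mult[OF dq dp[folded q_def]] show "((\<lambda>x. K x \<theta>) has_field_derivative K' x \<theta>) (at x within ?U)"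
        unfolding K_def by (simp only:)
    next
      fix x :: real assume x: "x \<in> ?U"
      show "K x integrable_on cbox 0 pi"
        unfolding K_def tau_def
        by (intro integrable_continuous continuous_intros) (use tpos[of x] x in \<open>auto simp: tau_def\<close>)
    next
      show "continuous_on (?U \<times> cbox 0 pi) (\<lambda>(x, t). K' x t)"
        unfolding K'_def tau_def split_def
        by (intro continuous_intros) (use tpos in \<open>auto simp: tau_def\<close>)
    qed (use s in auto)
    then have D: "(F has_real_derivative integral {0..pi} (K' s)) (at s)"
      using s by (simp add: F_def[abs_def] at_within_open[of s ?U])
    let ?r = "sqrt (s * (s + 2 * c))"
    \<comment> \<open>The term whose \<open>\<theta>\<close>-derivative integrates to zero.\<close>
    define G where "G \<theta> = tau c s \<theta> powr a * (sin \<theta> * (?r + (s + c) * cos \<theta>))" for \<theta>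
    define G' where "G' \<theta> = a * tau c s \<theta> powr (a - 1) * (- ?r * sin \<theta>) * (sin \<theta> * (?r + (s + c) * cos \<theta>))
       + tau c s \<theta> powr a * (cos \<theta> * (?r + (s + c) * cos \<theta>) - (s + c) * (sin \<theta>)\<^sup>2)" for \<theta>
    have dG: "(G has_real_derivative G' \<theta>) (at \<theta> within {0..pi})" for \<theta>
    proof -
      have dt: "((\<lambda>\<theta>. tau c s \<theta>) has_real_derivative (- ?r * sin \<theta>)) (at \<theta>)"
        unfolding tau_def by (auto intro!: derivative_eq_intros)
      have tp: "tau c s \<theta> > 0" using tpos s by simp
      have dp: "((\<lambda>\<theta>. tau c s \<theta> powr a) has_real_derivative a * tau c s \<theta> powr (a - 1) * (- ?r * sin \<theta>)) (at \<theta> within {0..pi})"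
        using has_field_derivative_at_within[OF DERIV_fun_powr[OF dt tp, of a]] by (simp only: of_nat_1)
      have dq: "((\<lambda>\<theta>. sin \<theta> * (?r + (s + c) * cos \<theta>)) has_real_derivative (cos \<theta> * (?r + (s + c) * cos \<theta>) - (s + c) * (sin \<theta>)\<^sup>2)) (at \<theta> within {0..pi})"
        by (auto intro!: derivative_eq_intros simp: power2_eq_square algebra_simps)
      show ?thesis unfolding G_def G'_def using DERIV_mult'[OF dp dq] by (simp add: algebra_simps)
    qed
    have "(G' has_integral (G pi - G 0)) {0..pi}"
      by (rule fundamental_theorem_of_calculus)
         (auto simp: has_real_derivative_iff_has_vector_derivative[symmetric] dG)
    then have iG: "(G' has_integral 0) {0..pi}" by (simp add: G_def)
    have "((\<lambda>\<theta>. tau c s \<theta> ^ k * cos (of_int 0 * \<theta>) - G' \<theta>) has_integral pi * lim_jac c s k 0 - 0) {0..pi}"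
      by (rule has_integral_diff[OF lim_jac_integral iG])
    moreover have "tau c s \<theta> ^ k * cos (of_int 0 * \<theta>) - G' \<theta> = K' s \<theta>" for \<theta>
      using tau_flow_identity[of "tau c s \<theta>" s c ?r "cos \<theta>" "sin \<theta>" a] tpos(1)[of s \<theta>] pk[of s \<theta>] s
      by (simp add: K'_def G'_def tau_def)
    ultimately have "(K' s has_integral pi * lim_jac c s k 0) {0..pi}" by simp
    then show ?thesis using D by (simp add: integral_unique)
  qed
  have "((\<lambda>s. pi * lim_jac c s k 0) has_integral (F 1 - F 0)) {0..1}"
    by (rule fundamental_theorem_of_calculus_interior)
       (use contF deriv in \<open>auto simp: has_real_derivative_iff_has_vector_derivative[symmetric]\<close>)
  moreover have "F 0 = 0"
  proof -
    have "K 0 = (\<lambda>\<theta>. 0)" by (simp add: K_def fun_eq_iff)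
    then show ?thesis by (simp add: F_def)
  qed
  moreover have "K 1 = limit_integrand c k"
  proof
    fix \<theta>
    have "tau c 1 \<theta> powr (a + 1) = tau c 1 \<theta> powr a * tau c 1 \<theta>"
      using tpos[of 1 \<theta>] by (simp add: powr_add)
    then have "tau c 1 \<theta> powr a = tau c 1 \<theta> ^ k / tau c 1 \<theta>"
      using tpos[of 1 \<theta>] pk[of 1 \<theta>] by (simp add: field_simps)
    then show "K 1 \<theta> = limit_integrand c k \<theta>" by (simp add: K_def limit_integrand_def)
  qed
  ultimately show ?thesis by (simp add: F_def)
qed

lemma limit_integrand_0: "\<theta> \<in> {0<..<pi} \<Longrightarrow> limit_integrand 0 k \<theta> = (1 - cos \<theta>) * (1 + cos \<theta>) ^ k"
proof -
  assume "\<theta> \<in> {0<..<pi}"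
  then have "cos \<theta> > cos pi" by (intro cos_monotone_0_pi) auto
  then have "1 + cos \<theta> \<noteq> 0" by simp
  moreover have "(sin \<theta>)\<^sup>2 = (1 - cos \<theta>) * (1 + cos \<theta>)"
    by (simp add: sin_squared_eq power2_eq_square algebra_simps)
  ultimately show ?thesis by (simp add: limit_integrand_def tau_def)
qed

lemma limit_integrand_continuous:
  assumes "c \<ge> 0"
  obtains w where "continuous_on {0..pi} w" "\<And>\<theta>. \<theta> \<in> {0<..<pi} \<Longrightarrow> limit_integrand c k \<theta> = w \<theta>"
    "\<And>\<theta>. \<theta> \<in> {0..pi} \<Longrightarrow> w \<theta> \<ge> 0"
proof (cases "c = 0")
  case True
  show ?thesis
  proof (rule that[of "\<lambda>\<theta>. (1 - cos \<theta>) * (1 + cos \<theta>) ^ k"])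
    show "0 \<le> (1 - cos \<theta>) * (1 + cos \<theta>) ^ k" for \<theta> :: real
      using cos_le_one[of \<theta>] cos_ge_minus_one[of \<theta>] by (intro mult_nonneg_nonneg zero_le_power) linarith+
    show "limit_integrand c k \<theta> = (1 - cos \<theta>) * (1 + cos \<theta>) ^ k" if "\<theta> \<in> {0<..<pi}" for \<theta>
      unfolding True by (rule limit_integrand_0[OF that])
  qed (intro continuous_intros)
next
  case False
  then have c: "c > 0" using assms by simp
  have t: "tau c 1 \<theta> > 0" "tau c 1 \<theta> \<noteq> 0" for \<theta> using tau_pos[OF c, of 1 \<theta>] by auto
  show ?thesis
  proof (rule that[of "limit_integrand c k"])
    show "continuous_on {0..pi} (limit_integrand c k)"
      unfolding limit_integrand_def[abs_def] tau_def
      by (intro continuous_intros) (use t in \<open>auto simp: tau_def\<close>)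
  qed (use t c in \<open>auto simp: limit_integrand_def less_imp_le\<close>)
qed

text \<open>For \<open>c = 0\<close> the symbol \<open>s (1 + cos \<theta>)\<close> has a zero at \<open>\<pi>\<close>, but it is homogeneous in \<open>s\<close>, so the integral over \<open>s\<close>
is elementary, and one integration by parts in \<open>\<theta>\<close> gives the same form.\<close>

lemma lim_jac_flow_0:
  "((\<lambda>s. pi * lim_jac 0 s k 0) has_integral integral {0..pi} (limit_integrand 0 k)) {0..1}"
proof -
  define L where "L = pi * lim_jac 0 1 k 0"
  have i1: "((\<lambda>\<theta>. (1 + cos \<theta>) ^ k) has_integral L) {0..pi}"
    using lim_jac_integral[of 0 1 k 0] by (simp add: tau_def L_def)
  have hs: "pi * lim_jac 0 s k 0 = s ^ k * L" if "s \<ge> 0" for s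
  proof -
    have "((\<lambda>\<theta>. tau 0 s \<theta> ^ k * cos (of_int 0 * \<theta>)) has_integral s ^ k * L) {0..pi}"
      using has_integral_mult_right[OF i1, of "s ^ k"] that
      by (simp add: tau_def power_mult_distrib[symmetric] algebra_simps)
    then show ?thesis using lim_jac_integral[of 0 s k 0] by (rule has_integral_unique[symmetric])
  qed
  define H where "H \<theta> = (1 + cos \<theta>) ^ k * sin \<theta>" for \<theta> :: real
  have "((\<lambda>\<theta>. (1 + cos \<theta>) ^ k - (real k + 1) * ((1 - cos \<theta>) * (1 + cos \<theta>) ^ k)) has_integral (H pi - H 0)) {0..pi}"
  proof (rule fundamental_theorem_of_calculus)
    fix \<theta> :: real
    have dH: "(H has_real_derivative (real k * (1 + cos \<theta>) ^ (k - 1) * (- sin \<theta>) * sin \<theta> + (1 + cos \<theta>) ^ k * cos \<theta>)) (at \<theta> within {0..pi})"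
      unfolding H_def by (auto intro!: derivative_eq_intros simp: algebra_simps)
    have T: "real k * (1 + cos \<theta>) ^ (k - 1) * (- sin \<theta>) * sin \<theta> = - real k * ((1 - cos \<theta>) * (1 + cos \<theta>) ^ k)"
    proof (cases k)
      case (Suc l)
      have ss: "sin \<theta> * sin \<theta> = (1 - cos \<theta>) * (1 + cos \<theta>)"
        using sin_squared_eq[of \<theta>] by (simp add: power2_eq_square algebra_simps)
      have "real k * (1 + cos \<theta>) ^ (k - 1) * (- sin \<theta>) * sin \<theta> = - (real k * (1 + cos \<theta>) ^ l * (sin \<theta> * sin \<theta>))"
        using Suc by simp
      also have "\<dots> = - (real k * (1 + cos \<theta>) ^ l * ((1 - cos \<theta>) * (1 + cos \<theta>)))"
        by (simp only: ss)
      also have "\<dots> = - real k * ((1 - cos \<theta>) * (1 + cos \<theta>) ^ k)"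
        unfolding Suc power_Suc by (simp only: mult_minus_left mult_minus_right mult_ac)
      finally show ?thesis .
    qed simp
    have "real k * (1 + cos \<theta>) ^ (k - 1) * (- sin \<theta>) * sin \<theta> + (1 + cos \<theta>) ^ k * cos \<theta>
        = (1 + cos \<theta>) ^ k - (real k + 1) * ((1 - cos \<theta>) * (1 + cos \<theta>) ^ k)"
      unfolding T by (simp add: algebra_simps)
    with dH show "(H has_vector_derivative (1 + cos \<theta>) ^ k - (real k + 1) * ((1 - cos \<theta>) * (1 + cos \<theta>) ^ k)) (at \<theta> within {0..pi})"
      unfolding has_real_derivative_iff_has_vector_derivative[symmetric] by (simp only:)
  qed simp
  then have "((\<lambda>\<theta>. (1 + cos \<theta>) ^ k - (real k + 1) * ((1 - cos \<theta>) * (1 + cos \<theta>) ^ k)) has_integral 0) {0..pi}"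
    by (simp add: H_def)
  from has_integral_mult_right[OF has_integral_diff[OF i1 this], of "1 / (real k + 1)"]
  have "((\<lambda>\<theta>. (1 - cos \<theta>) * (1 + cos \<theta>) ^ k) has_integral L / (real k + 1)) {0..pi}"
    by simp
  then have "(limit_integrand 0 k has_integral L / (real k + 1)) {0..pi}"
    by (rule has_integral_spike_finite[of "{0, pi}", rotated -1]) (auto simp: limit_integrand_0)
  then have R: "integral {0..pi} (limit_integrand 0 k) = L / (real k + 1)" by (rule integral_unique)
  have "((\<lambda>s. s ^ k * L) has_integral (1 ^ Suc k / (real k + 1) * L - 0 ^ Suc k / (real k + 1) * L)) {0..1}"
  proof (rule fundamental_theorem_of_calculus)
    fix s :: real
    have "((\<lambda>s. s ^ Suc k / (real k + 1) * L) has_real_derivative real (Suc k) * s ^ (Suc k - Suc 0) / (real k + 1) * L) (at s within {0..1})"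
      by (intro DERIV_cmult_right DERIV_cdivide DERIV_pow)
    moreover have "real (Suc k) * s ^ (Suc k - Suc 0) / (real k + 1) * L = s ^ k * L"
      by (simp add: field_simps)
    ultimately show "((\<lambda>s. s ^ Suc k / (real k + 1) * L) has_vector_derivative s ^ k * L) (at s within {0..1})"
      by (simp only: has_real_derivative_iff_has_vector_derivative)
  qed simp
  then have "((\<lambda>s. s ^ k * L) has_integral L / (real k + 1)) {0..1}" by simp
  then show ?thesis unfolding R
    by (rule has_integral_eq[rotated]) (simp add: hs)
qed

lemma lim_jac_average:
  assumes c: "c \<ge> 0"
  shows "(\<integral>s. indicator {0..<1} s * lim_jac c s k 0 \<partial>lborel) = 1 / pi * integral {0..pi} (limit_integrand c k)"
proof -
  have h: "((\<lambda>s. pi * lim_jac c s k 0) has_integral integral {0..pi} (limit_integrand c k)) {0..1}"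
    using lim_jac_flow[of c k] lim_jac_flow_0[of k] c by (cases "c = 0") auto
  have h': "((\<lambda>s. lim_jac c s k 0) has_integral 1 / pi * integral {0..pi} (limit_integrand c k)) {0..1}"
    using has_integral_mult_right[OF h, of "1 / pi"] by simp
  have cont: "continuous_on {0..1} (\<lambda>s. lim_jac c s k r)" for r
    by (induction k arbitrary: r) (auto intro!: continuous_intros)
  have si: "set_integrable lborel {0..1} (\<lambda>s. lim_jac c s k 0)"
    by (rule borel_integrable_atLeastAtMost') (rule cont)
  have "(\<integral>s. indicator {0..<1} s * lim_jac c s k 0 \<partial>lborel) = (LINT s:{0..1}|lborel. lim_jac c s k 0)"
    unfolding set_lebesgue_integral_def
  proof (rule integral_cong_AE)
    have [measurable]: "(\<lambda>s. lim_jac c s k r) \<in> borel_measurable borel" for r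
      by (induction k arbitrary: r) auto
    show "(\<lambda>s. indicator {0..<1} s * lim_jac c s k 0) \<in> borel_measurable lborel" by measurable
    show "(\<lambda>s. indicator {0..1} s *\<^sub>R lim_jac c s k 0) \<in> borel_measurable lborel" by measurable
    show "AE s in lborel. indicator {0..<1} s * lim_jac c s k 0 = indicator {0..1} s *\<^sub>R lim_jac c s k 0"
      using AE_lborel_singleton[of 1] by eventually_elim (auto simp: indicator_def)
  qed
  also have "\<dots> = integral {0..1} (\<lambda>s. lim_jac c s k 0)" by (rule set_borel_integral_eq_integral(2)[OF si])
  also have "\<dots> = 1 / pi * integral {0..pi} (limit_integrand c k)" using h' by (rule integral_unique)
  finally show ?thesis .
qed

lemma edges:
  assumes "c \<ge> 0"
  shows "(edge_a c)\<^sup>2 = 1 + c - sqrt (1 + 2 * c)" "(edge_b c)\<^sup>2 = 1 + c + sqrt (1 + 2 * c)"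
    "0 \<le> edge_a c" "edge_a c < edge_b c"
proof -
  have "sqrt (1 + 2 * c) \<le> sqrt ((1 + c)\<^sup>2)"
    by (intro real_sqrt_le_mono) (simp add: power2_eq_square algebra_simps)
  then have "sqrt (1 + 2 * c) \<le> 1 + c" using assms by simp
  then show "(edge_a c)\<^sup>2 = 1 + c - sqrt (1 + 2 * c)" "(edge_b c)\<^sup>2 = 1 + c + sqrt (1 + 2 * c)" "0 \<le> edge_a c"
    using assms by (simp_all add: edge_a_def edge_b_def)
  have "sqrt (1 + 2 * c) > 0" using assms by simp
  then show "edge_a c < edge_b c" unfolding edge_a_def edge_b_def by (intro real_sqrt_less_mono) simp
qed

text \<open>The substitution \<open>t = sqrt (\<tau>\<^sub>1(\<theta>))\<close> maps \<open>(0, \<pi>)\<close> onto \<open>(a, b)\<close>, reversing the order. With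
\<open>(t^2 - a^2) (b^2 - t^2) = \<rho>^2 sin^2 \<theta>\<close> and \<open>|dt/d\<theta>| = \<rho> sin \<theta> / (2 t)\<close>, the density becomes
\<open>\<rho>^2 sin^2 \<theta> / (2 \<pi> \<tau>\<^sub>1(\<theta>))\<close>.\<close>

lemma limit_moment_half:
  assumes c: "c \<ge> 0"
  shows "has_bochner_integral lborel (\<lambda>t. indicator {edge_a c<..<edge_b c} t * (limit_density c t * t ^ (2 * k)))
     (1 / (2 * pi) * integral {0..pi} (limit_integrand c k))"
proof -
  let ?a = "edge_a c" and ?b = "edge_b c" and ?\<rho> = "sqrt (1 + 2 * c)"
  have \<rho>: "?\<rho> > 0" "?\<rho> * ?\<rho> = 1 + 2 * c" using c by auto
  define f where "f t = limit_density c t * t ^ (2 * k)" for t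
  define g where "g \<theta> = sqrt (tau c 1 \<theta>)" for \<theta>
  define g' where "g' \<theta> = - ?\<rho> * sin \<theta> / (2 * sqrt (tau c 1 \<theta>))" for \<theta>
  have tau1: "tau c 1 \<theta> = 1 + c + ?\<rho> * cos \<theta>" for \<theta> by (simp add: tau_def)
  have lo: "tau c 1 \<theta> - ?a\<^sup>2 = ?\<rho> * (1 + cos \<theta>)" and hi: "?b\<^sup>2 - tau c 1 \<theta> = ?\<rho> * (1 - cos \<theta>)" for \<theta>
    using edges[OF c] by (simp_all add: tau1 algebra_simps)
  have cosb: "- 1 < cos \<theta>" "cos \<theta> < 1" if "\<theta> \<in> {0<..<pi}" for \<theta>
    using that cos_monotone_0_pi[of \<theta> pi] cos_monotone_0_pi[of 0 \<theta>] by auto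
  have rng: "?a\<^sup>2 < tau c 1 \<theta>" "tau c 1 \<theta> < ?b\<^sup>2" if "\<theta> \<in> {0<..<pi}" for \<theta>
  proof -
    have "tau c 1 \<theta> - ?a\<^sup>2 > 0" "?b\<^sup>2 - tau c 1 \<theta> > 0"
      unfolding lo hi using cosb[OF that] \<rho>(1) by (auto intro!: mult_pos_pos)
    then show "?a\<^sup>2 < tau c 1 \<theta>" "tau c 1 \<theta> < ?b\<^sup>2" by auto
  qed
  have tp: "tau c 1 \<theta> > 0" if "\<theta> \<in> {0<..<pi}" for \<theta>
    using rng(1)[OF that] zero_le_power2[of ?a] by linarith
  have gd: "(g has_real_derivative g' \<theta>) (at \<theta> within {0<..<pi})" if "\<theta> \<in> {0<..<pi}" for \<theta>
    unfolding g_def g'_def using tp[OF that] unfolding tau1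
    by (auto intro!: derivative_eq_intros simp: field_simps)
  have inj: "inj_on g {0<..<pi}"
  proof (rule inj_onI)
    fix x y assume xy: "x \<in> {0<..<pi}" "y \<in> {0<..<pi}" "g x = g y"
    then have "tau c 1 x = tau c 1 y" by (simp add: g_def)
    then have "cos x = cos y" using \<rho>(1) by (simp add: tau1)
    then show "x = y" using xy cos_inj_pi[of x y] by auto
  qed
  have img: "g ` {0<..<pi} = {?a<..<?b}"
  proof (intro equalityI subsetI)
    fix t assume "t \<in> g ` {0<..<pi}"
    then obtain \<theta> where \<theta>: "\<theta> \<in> {0<..<pi}" "t = g \<theta>" by blast
    have "?a < g \<theta>" "g \<theta> < ?b"
      unfolding g_def using rng[OF \<theta>(1)] edges(3,4)[OF c]
      by (auto intro: real_less_rsqrt real_less_lsqrt simp del: real_sqrt_less_iff)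
    then show "t \<in> {?a<..<?b}" using \<theta> by simp
  next
    fix t assume t: "t \<in> {?a<..<?b}"
    then have t0: "t > 0" using edges(3)[OF c] by auto
    have t2: "?a\<^sup>2 < t\<^sup>2" "t\<^sup>2 < ?b\<^sup>2"
      using t t0 edges(3)[OF c] by (auto intro!: power_strict_mono)
    define y where "y = (t\<^sup>2 - 1 - c) / ?\<rho>"
    have y: "- 1 < y" "y < 1" using t2 \<rho>(1) edges[OF c] by (auto simp: y_def field_simps)
    have "arccos y \<in> {0<..<pi}" using arccos_lt_bounded[OF y] by auto
    moreover have "g (arccos y) = t"
      using y t0 \<rho>(1) by (simp add: g_def tau1 cos_arccos) (simp add: y_def)
    ultimately show "t \<in> g ` {0<..<pi}" by (metis imageI)
  qed
  have fg: "\<bar>g' \<theta>\<bar> * f (g \<theta>) = 1 / (2 * pi) * limit_integrand c k \<theta>" if \<theta>: "\<theta> \<in> {0<..<pi}" for \<theta>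
  proof -
    have sp: "sin \<theta> > 0" using \<theta> by (auto intro: sin_gt_zero)
    let ?t = "tau c 1 \<theta>"
    have tq: "?t > 0" by (rule tp[OF \<theta>])
    have "(?t - ?a\<^sup>2) * (?b\<^sup>2 - ?t) = (?\<rho> * sin \<theta>)\<^sup>2"
      unfolding lo hi by (simp add: power_mult_distrib sin_squared_eq) (simp add: power2_eq_square algebra_simps)
    then have sq: "sqrt ((?t - ?a\<^sup>2) * (?b\<^sup>2 - ?t)) = ?\<rho> * sin \<theta>"
      using sp \<rho>(1) by simp
    have f: "f (g \<theta>) = 1 / (pi * sqrt ?t) * (?\<rho> * sin \<theta>) * ?t ^ k"
      using tq by (simp add: f_def g_def limit_density_def sq power_mult)
    have gen: "\<rho> * S / (2 * q) * (1 / (pi * q) * (\<rho> * S) * T) = (\<rho> * \<rho>) * S\<^sup>2 * T / (2 * pi * (q * q))" for \<rho> S q T :: real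
      by (simp add: power2_eq_square mult_ac)
    have ga: "\<bar>g' \<theta>\<bar> = ?\<rho> * sin \<theta> / (2 * sqrt ?t)"
      using sp \<rho>(1) tq by (simp add: g'_def abs_mult)
    have "\<bar>g' \<theta>\<bar> * f (g \<theta>) = (?\<rho> * ?\<rho>) * (sin \<theta>)\<^sup>2 * ?t ^ k / (2 * pi * (sqrt ?t * sqrt ?t))"
      unfolding f ga by (rule gen)
    also have "sqrt ?t * sqrt ?t = ?t" using tq by simp
    finally show ?thesis using \<rho>(2) by (simp add: limit_integrand_def)
  qed
  obtain w where w: "continuous_on {0..pi} w" "\<And>\<theta>. \<theta> \<in> {0<..<pi} \<Longrightarrow> limit_integrand c k \<theta> = w \<theta>"
    "\<And>\<theta>. \<theta> \<in> {0..pi} \<Longrightarrow> w \<theta> \<ge> 0"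
    using limit_integrand_continuous[OF c] by metis
  have wi: "w integrable_on {0..pi}" by (rule integrable_continuous_real[OF w(1)])
  have iw: "integral {0..pi} (limit_integrand c k) = integral {0..pi} w"
    by (rule integral_spike[of "{0, pi}"]) (auto simp: w(2))
  have wa: "(\<lambda>\<theta>. 1 / (2 * pi) * w \<theta>) absolutely_integrable_on {0<..<pi}"
    by (rule nonnegative_absolutely_integrable_1)
       (use wi w(3) in \<open>auto simp: integrable_on_open_interval_real intro!: integrable_on_cmult_left\<close>)
  have wv: "integral {0<..<pi} (\<lambda>\<theta>. 1 / (2 * pi) * w \<theta>) = 1 / (2 * pi) * integral {0..pi} w"
    by (simp add: integral_open_interval_real)
  have e: "\<bar>g' \<theta>\<bar> * f (g \<theta>) = 1 / (2 * pi) * w \<theta>" if "\<theta> \<in> {0<..<pi}" for \<theta>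
    by (simp only: fg[OF that] w(2)[OF that])
  have "(\<lambda>\<theta>. \<bar>g' \<theta>\<bar> * f (g \<theta>)) absolutely_integrable_on {0<..<pi} \<and>
      integral {0<..<pi} (\<lambda>\<theta>. \<bar>g' \<theta>\<bar> * f (g \<theta>)) = 1 / (2 * pi) * integral {0..pi} (limit_integrand c k)"
  proof
    show "(\<lambda>\<theta>. \<bar>g' \<theta>\<bar> * f (g \<theta>)) absolutely_integrable_on {0<..<pi}"
      by (rule iffD2[OF set_integrable_cong[OF refl refl e] wa])
    show "integral {0<..<pi} (\<lambda>\<theta>. \<bar>g' \<theta>\<bar> * f (g \<theta>)) = 1 / (2 * pi) * integral {0..pi} (limit_integrand c k)"
      unfolding iw wv[symmetric] by (rule Henstock_Kurzweil_Integration.integral_cong[OF e])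
  qed
  then have ab: "f absolutely_integrable_on {?a<..<?b}" and ib: "integral {?a<..<?b} f = 1 / (2 * pi) * integral {0..pi} (limit_integrand c k)"
    using has_absolute_integral_change_of_variables_1'[OF _ gd inj, of f "1 / (2 * pi) * integral {0..pi} (limit_integrand c k)"]
    unfolding img by simp_all
  have "has_bochner_integral lebesgue (\<lambda>t. indicator {?a<..<?b} t *\<^sub>R f t) (1 / (2 * pi) * integral {0..pi} (limit_integrand c k))"
    using ab set_lebesgue_integral_eq_integral(2)[OF ab] ib
    by (simp add: has_bochner_integral_iff set_integrable_def set_lebesgue_integral_def)
  moreover have "(\<lambda>t. indicator {?a<..<?b} t *\<^sub>R f t) \<in> borel_measurable lborel"
    unfolding f_def limit_density_def by measurable
  ultimately show ?thesis
    by (auto simp: has_bochner_integral_iff integrable_completion integral_completion f_def)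
qed

lemma limit_measure_moment:
  assumes c: "c \<ge> 0"
  shows "has_bochner_integral (limit_measure c) (\<lambda>t. t ^ (2 * k)) (1 / pi * integral {0..pi} (limit_integrand c k))"
proof -
  let ?a = "edge_a c" and ?b = "edge_b c"
  define f where "f t = indicator (limit_support c) t * limit_density c t * t ^ (2 * k)" for t
  have m [measurable]: "f \<in> borel_measurable borel"
    unfolding f_def limit_support_def limit_density_def by measurable
  have "has_bochner_integral lborel (\<lambda>t. indicator {0..} t *\<^sub>R f t) (1 / (2 * pi) * integral {0..pi} (limit_integrand c k))"
  proof (subst has_bochner_integral_cong_AE)
    show "AE t in lborel. indicator {0..} t *\<^sub>R f t = indicator {?a<..<?b} t * (limit_density c t * t ^ (2 * k))"
      using AE_lborel_singleton[of ?a] AE_lborel_singleton[of ?b] AE_lborel_singleton[of 0]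
    proof eventually_elim
      case (elim t)
      then show ?case using edges(3,4)[OF c] by (auto simp: f_def limit_support_def indicator_def)
    qed
    show "has_bochner_integral lborel (\<lambda>t. indicator {?a<..<?b} t * (limit_density c t * t ^ (2 * k))) (1 / (2 * pi) * integral {0..pi} (limit_integrand c k))"
      by (rule limit_moment_half[OF c])
    show "(\<lambda>t. indicator {?a<..<?b} t * (limit_density c t * t ^ (2 * k))) \<in> borel_measurable lborel"
      unfolding limit_density_def by measurable
  qed measurable
  then have "has_bochner_integral lborel f (2 *\<^sub>R (1 / (2 * pi) * integral {0..pi} (limit_integrand c k)))"
    by (rule has_bochner_integral_even_function)
       (auto simp: f_def limit_support_def limit_density_def indicator_def)
  then have h: "has_bochner_integral lborel f (1 / pi * integral {0..pi} (limit_integrand c k))" by simp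
  show ?thesis
    unfolding limit_measure_def
  proof (rule has_bochner_integral_density)
    show "has_bochner_integral lborel (\<lambda>t. (indicator (limit_support c) t * limit_density c t) *\<^sub>R t ^ (2 * k)) (1 / pi * integral {0..pi} (limit_integrand c k))"
      using h by (simp add: f_def[abs_def])
    show "AE t in lborel. 0 \<le> indicator (limit_support c) t * limit_density c t"
    proof (rule AE_I2)
      fix t :: real
      show "0 \<le> indicator (limit_support c) t * limit_density c t"
      proof (cases "t \<in> limit_support c")
        case True
        then have "?a \<le> \<bar>t\<bar>" "\<bar>t\<bar> \<le> ?b" using edges[OF c] by (auto simp: limit_support_def)
        then have "?a\<^sup>2 \<le> t\<^sup>2" "t\<^sup>2 \<le> ?b\<^sup>2"
          using power_mono[of ?a "\<bar>t\<bar>" 2] power_mono[of "\<bar>t\<bar>" ?b 2] edges(3)[OF c] by simp_all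
        then show ?thesis by (simp add: limit_density_def)
      qed simp
    qed
  qed (unfold limit_support_def limit_density_def, measurable)
qed

section \<open>Weak convergence from even moments\<close>

text \<open>By symmetry the test function may be replaced by its even part, a continuous function of \<open>t^2\<close>,
approximated by a polynomial in \<open>t^2\<close> on \<open>|t| \<le> K\<close> with \<open>K > b\<close>. Outside, the error is dominated by \<open>C (t / K)^(2m)\<close>; its integral is
controlled by the moment of order \<open>2m\<close>, which is small in the limit since \<open>(b / K)^(2m)\<close> tends to \<open>0\<close>.\<close>

lemma even_moments_weak_convergence:
  fixes M :: "nat \<Rightarrow> real measure" and \<sigma> :: "real measure" and \<phi> :: "real \<Rightarrow> real"
  assumes M: "\<And>n. prob_space (M n)" "\<And>n. sets (M n) = sets borel" and S: "prob_space \<sigma>" "sets \<sigma> = sets borel"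
    and symM: "\<And>n (\<phi> :: real \<Rightarrow> real). \<phi> \<in> borel_measurable borel \<Longrightarrow> bounded (range \<phi>) \<Longrightarrow> (\<integral>t. \<phi> (- t) \<partial>M n) = (\<integral>t. \<phi> t \<partial>M n)"
    and symS: "\<And>\<phi> :: real \<Rightarrow> real. \<phi> \<in> borel_measurable borel \<Longrightarrow> bounded (range \<phi>) \<Longrightarrow> (\<integral>t. \<phi> (- t) \<partial>\<sigma>) = (\<integral>t. \<phi> t \<partial>\<sigma>)"
    and iM: "\<And>n k. integrable (M n) (\<lambda>t. t ^ (2 * k))" and iS: "\<And>k. integrable \<sigma> (\<lambda>t. t ^ (2 * k))"
    and supp: "AE t in \<sigma>. \<bar>t\<bar> \<le> b" and b: "b \<ge> 0"
    and mom: "\<And>k. (\<lambda>n. \<integral>t. t ^ (2 * k) \<partial>M n) \<longlonglongrightarrow> (\<integral>t. t ^ (2 * k) \<partial>\<sigma>)"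
    and \<phi>: "continuous_on UNIV \<phi>" and \<phi>b: "bounded (range \<phi>)"
  shows "(\<lambda>n. \<integral>t. \<phi> t \<partial>M n) \<longlonglongrightarrow> (\<integral>t. \<phi> t \<partial>\<sigma>)"
proof -
  interpret M: prob_space "M n" for n by (rule M)
  interpret S: prob_space \<sigma> by (rule S)
  note [measurable_cong] = M(2) S(2)
  have \<phi>m [measurable]: "\<phi> \<in> borel_measurable borel" by (rule borel_measurable_continuous_onI[OF \<phi>])
  obtain B where B: "\<And>t. \<bar>\<phi> t\<bar> \<le> B" using \<phi>b by (auto simp: bounded_iff)
  have B0: "B \<ge> 0" using B[of 0] by simp
  \<comment> \<open>The even part of the test function.\<close>
  define \<psi> where "\<psi> t = (\<phi> t + \<phi> (- t)) / 2" for t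
  have \<psi>m [measurable]: "\<psi> \<in> borel_measurable borel" unfolding \<psi>_def by measurable
  have \<psi>B: "\<bar>\<psi> t\<bar> \<le> B" for t using B[of t] B[of "- t"] by (simp add: \<psi>_def)
  have \<psi>sq: "\<psi> t = \<psi> (sqrt (t\<^sup>2))" for t by (cases "t \<ge> 0") (simp_all add: \<psi>_def)
  have i\<phi>: "integrable (M n) \<phi>" "integrable (M n) (\<lambda>t. \<phi> (- t))" "integrable \<sigma> \<phi>" "integrable \<sigma> (\<lambda>t. \<phi> (- t))" for n
    using B by (auto intro!: M.integrable_const_bound[of _ B] S.integrable_const_bound[of _ B])
  have e1: "(\<integral>t. \<phi> t \<partial>M n) = (\<integral>t. \<psi> t \<partial>M n)" for n
    using symM[OF \<phi>m \<phi>b, of n] i\<phi>(1,2)[of n] by (simp add: \<psi>_def)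
  have e2: "(\<integral>t. \<phi> t \<partial>\<sigma>) = (\<integral>t. \<psi> t \<partial>\<sigma>)"
    using symS[OF \<phi>m \<phi>b] i\<phi>(3,4) by (simp add: \<psi>_def)
  have i\<psi>: "integrable (M n) \<psi>" "integrable \<sigma> \<psi>" for n
    using \<psi>B by (auto intro!: M.integrable_const_bound[of _ B] S.integrable_const_bound[of _ B])
  define K where "K = b + 1"
  have K: "K > 0" "b < K" using b by (auto simp: K_def)
  show ?thesis
    unfolding e1 e2
  proof (rule LIMSEQ_I)
    fix \<epsilon>0 :: real assume \<epsilon>0: "\<epsilon>0 > 0"
    define \<epsilon> where "\<epsilon> = \<epsilon>0 / 6"
    have \<epsilon>: "\<epsilon> > 0" using \<epsilon>0 by (simp add: \<epsilon>_def)
    have "continuous_on {0..K\<^sup>2} (\<lambda>y. \<psi> (sqrt y))"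
      unfolding \<psi>_def by (intro continuous_intros continuous_on_compose2[OF \<phi>]) auto
    then obtain g where g: "real_polynomial_function g" and gf: "\<And>y. y \<in> {0..K\<^sup>2} \<Longrightarrow> \<bar>\<psi> (sqrt y) - g y\<bar> < \<epsilon>"
      using Stone_Weierstrass_real_polynomial_function[OF compact_Icc _ \<epsilon>] by metis
    obtain c d where gs: "g = (\<lambda>y. \<Sum>i\<le>d. c i * y ^ i)"
      using real_polynomial_function_imp_sum[OF g] by metis
    \<comment> \<open>For \<open>|t| \<ge> K\<close> and \<open>m \<ge> d\<close>, both \<open>\<psi>\<close> and the polynomial are at most a multiple of \<open>(t / K)^(2m)\<close>.\<close>
    define C where "C = B + (\<Sum>i\<le>d. \<bar>c i\<bar> * (K\<^sup>2) ^ i)"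
    have C0: "C \<ge> 0" unfolding C_def using B0 by (intro add_nonneg_nonneg sum_nonneg) auto
    have q: "(b\<^sup>2 / K\<^sup>2) < 1" "b\<^sup>2 / K\<^sup>2 \<ge> 0" using b K by (auto intro!: power_strict_mono)
    have "(\<lambda>m. C * (b\<^sup>2 / K\<^sup>2) ^ m) \<longlonglongrightarrow> C * 0"
      by (intro tendsto_intros LIMSEQ_power_zero) (use q in auto)
    then have "eventually (\<lambda>m. C * (b\<^sup>2 / K\<^sup>2) ^ m < \<epsilon>) sequentially"
      using \<epsilon> by (intro order_tendstoD) auto
    then obtain m where m: "m \<ge> d" "C * (b\<^sup>2 / K\<^sup>2) ^ m < \<epsilon>"
      by (metis (mono_tags, lifting) eventually_sequentially nle_le)
    define G where "G t = g (t\<^sup>2)" for t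
    have Gs: "G t = (\<Sum>i\<le>d. c i * t ^ (2 * i))" for t by (simp add: G_def gs power_mult)
    have iG: "integrable (M n) G" "integrable \<sigma> G" for n
      unfolding Gs by (intro Bochner_Integration.integrable_sum integrable_mult_right iM iS)+
    have GL: "(\<lambda>n. \<integral>t. G t \<partial>M n) \<longlonglongrightarrow> (\<integral>t. G t \<partial>\<sigma>)"
    proof -
      have "(\<integral>t. G t \<partial>M n) = (\<Sum>i\<le>d. c i * (\<integral>t. t ^ (2 * i) \<partial>M n))" for n
        unfolding Gs using iM by (subst Bochner_Integration.integral_sum) auto
      moreover have "(\<integral>t. G t \<partial>\<sigma>) = (\<Sum>i\<le>d. c i * (\<integral>t. t ^ (2 * i) \<partial>\<sigma>))"
        unfolding Gs using iS by (subst Bochner_Integration.integral_sum) auto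
      moreover have "(\<lambda>n. \<Sum>i\<le>d. c i * (\<integral>t. t ^ (2 * i) \<partial>M n)) \<longlonglongrightarrow> (\<Sum>i\<le>d. c i * (\<integral>t. t ^ (2 * i) \<partial>\<sigma>))"
        by (intro tendsto_intros mom)
      ultimately show ?thesis by (simp only:)
    qed
    define E where "E t = \<epsilon> + C / (K\<^sup>2) ^ m * t ^ (2 * m)" for t
    have dom: "\<bar>\<psi> t - G t\<bar> \<le> E t" for t
    proof (cases "t\<^sup>2 \<le> K\<^sup>2")
      case True
      then have "\<bar>\<psi> (sqrt (t\<^sup>2)) - g (t\<^sup>2)\<bar> < \<epsilon>" by (intro gf) auto
      then have "\<bar>\<psi> t - G t\<bar> < \<epsilon>" by (simp only: \<psi>sq[symmetric] G_def)
      moreover have "C / (K\<^sup>2) ^ m * t ^ (2 * m) \<ge> 0" using C0 by (simp add: power_mult)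
      ultimately show ?thesis by (simp add: E_def)
    next
      case False
      define x where "x = t\<^sup>2 / K\<^sup>2"
      have x: "x \<ge> 1" using False K by (simp add: x_def)
      have t2: "t\<^sup>2 = K\<^sup>2 * x" using K by (simp add: x_def)
      have "\<bar>\<psi> t - G t\<bar> \<le> B + \<bar>G t\<bar>" using \<psi>B[of t] by linarith
      also have "\<bar>G t\<bar> \<le> (\<Sum>i\<le>d. \<bar>c i * (t\<^sup>2) ^ i\<bar>)" unfolding Gs power_mult by (rule sum_abs)
      also have "\<dots> \<le> (\<Sum>i\<le>d. \<bar>c i\<bar> * (K\<^sup>2) ^ i * x ^ m)"
      proof (rule sum_mono)
        fix i assume "i \<in> {..d}"
        then have "x ^ i \<le> x ^ m" using x m by (intro power_increasing) auto
        then have "\<bar>c i\<bar> * (K\<^sup>2) ^ i * x ^ i \<le> \<bar>c i\<bar> * (K\<^sup>2) ^ i * x ^ m" by (intro mult_left_mono) auto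
        then show "\<bar>c i * (t\<^sup>2) ^ i\<bar> \<le> \<bar>c i\<bar> * (K\<^sup>2) ^ i * x ^ m"
          unfolding t2 using x by (simp add: abs_mult power_mult_distrib)
      qed
      also have "B + (\<Sum>i\<le>d. \<bar>c i\<bar> * (K\<^sup>2) ^ i * x ^ m) \<le> C * x ^ m"
        using B0 x by (simp add: C_def distrib_right sum_distrib_right mult_le_cancel_left1)
      also have "C * x ^ m = C / (K\<^sup>2) ^ m * t ^ (2 * m)"
        by (simp add: x_def power_divide power_mult)
      finally show ?thesis using \<epsilon> by (simp add: E_def)
    qed
    have iE: "integrable (M n) E" "integrable \<sigma> E" for n
      unfolding E_def by (intro Bochner_Integration.integrable_add integrable_mult_right iM iS; simp)+
    have EM: "(\<integral>t. E t \<partial>M n) = \<epsilon> + C / (K\<^sup>2) ^ m * (\<integral>t. t ^ (2 * m) \<partial>M n)" for n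
      unfolding E_def using iM[of n m] by (simp add: M.prob_space)
    have ES: "(\<integral>t. E t \<partial>\<sigma>) = \<epsilon> + C / (K\<^sup>2) ^ m * (\<integral>t. t ^ (2 * m) \<partial>\<sigma>)"
      unfolding E_def using iS[of m] by (simp add: S.prob_space)
    have "(\<integral>t. t ^ (2 * m) \<partial>\<sigma>) \<le> (\<integral>t. (b\<^sup>2) ^ m \<partial>\<sigma>)"
    proof (rule integral_mono_AE)
      show "AE t in \<sigma>. t ^ (2 * m) \<le> (b\<^sup>2) ^ m"
        using supp
      proof eventually_elim
        case (elim t)
        then have "t\<^sup>2 \<le> b\<^sup>2" by (simp add: abs_le_square_iff[symmetric] b)
        then show ?case using power_mono[of "t\<^sup>2" "b\<^sup>2" m] by (simp add: power_mult)
      qed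
    qed (use iS in auto)
    then have "C / (K\<^sup>2) ^ m * (\<integral>t. t ^ (2 * m) \<partial>\<sigma>) \<le> C / (K\<^sup>2) ^ m * (b\<^sup>2) ^ m"
      using C0 by (intro mult_left_mono) (auto simp: S.prob_space)
    also have "\<dots> = C * (b\<^sup>2 / K\<^sup>2) ^ m" by (simp add: power_divide)
    finally have ES2: "(\<integral>t. E t \<partial>\<sigma>) < 2 * \<epsilon>" unfolding ES using m by simp
    have "(\<lambda>n. \<integral>t. E t \<partial>M n) \<longlonglongrightarrow> (\<integral>t. E t \<partial>\<sigma>)"
      unfolding EM ES by (intro tendsto_intros mom)
    then have ev1: "eventually (\<lambda>n. (\<integral>t. E t \<partial>M n) < 2 * \<epsilon>) sequentially"
      using ES2 by (rule order_tendstoD)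
    have ev2: "eventually (\<lambda>n. dist (\<integral>t. G t \<partial>M n) (\<integral>t. G t \<partial>\<sigma>) < \<epsilon>) sequentially"
      using GL \<epsilon> by (rule tendstoD)
    have close: "\<bar>(\<integral>t. \<psi> t \<partial>P) - (\<integral>t. G t \<partial>P)\<bar> \<le> (\<integral>t. E t \<partial>P)"
      if "integrable P \<psi>" "integrable P G" "integrable P E" for P :: "real measure"
    proof -
      have "\<bar>(\<integral>t. \<psi> t \<partial>P) - (\<integral>t. G t \<partial>P)\<bar> = \<bar>\<integral>t. \<psi> t - G t \<partial>P\<bar>" using that by simp
      also have "\<dots> \<le> (\<integral>t. \<bar>\<psi> t - G t\<bar> \<partial>P)" by (rule integral_abs_bound)
      also have "\<dots> \<le> (\<integral>t. E t \<partial>P)" using that dom by (intro integral_mono) auto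
      finally show ?thesis .
    qed
    have "eventually (\<lambda>n. norm ((\<integral>t. \<psi> t \<partial>M n) - (\<integral>t. \<psi> t \<partial>\<sigma>)) < \<epsilon>0) sequentially"
      using ev1 ev2
    proof eventually_elim
      case (elim n)
      have "\<bar>(\<integral>t. \<psi> t \<partial>M n) - (\<integral>t. \<psi> t \<partial>\<sigma>)\<bar> < 2 * \<epsilon> + \<epsilon> + 2 * \<epsilon>"
        using close[OF i\<psi>(1) iG(1) iE(1), of n] close[OF i\<psi>(2) iG(2) iE(2)] elim ES2
        unfolding dist_real_def by linarith
      then show ?case using \<epsilon>0 by (simp add: \<epsilon>_def)
    qed
    then show "\<exists>N. \<forall>n\<ge>N. norm ((\<integral>t. \<psi> t \<partial>M n) - (\<integral>t. \<psi> t \<partial>\<sigma>)) < \<epsilon>0"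
      by (simp add: eventually_sequentially)
  qed
qed

section \<open>Unitary diagonalization of Hermitian matrices\<close>

lemma adjoint_dims [simp]: "dim_row (mat_adjoint A) = dim_col A" "dim_col (mat_adjoint A) = dim_row A"
  by (simp_all add: mat_adjoint_def)

lemma adjoint_carrier: "A \<in> carrier_mat n m \<Longrightarrow> mat_adjoint A \<in> carrier_mat m n"
  by (rule carrier_matI) auto

lemma adjoint_index:
  fixes A :: "complex mat"
  assumes "i < dim_col A" "j < dim_row A"
  shows "mat_adjoint A $$ (i, j) = cnj (A $$ (j, i))"
  using assms by (simp add: mat_adjoint_def mat_of_rows_def)

lemma adjoint_mult:
  fixes A B :: "complex mat"
  assumes A: "A \<in> carrier_mat n m" and B: "B \<in> carrier_mat m k"
  shows "mat_adjoint (A * B) = mat_adjoint B * mat_adjoint A"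
proof (rule eq_matI)
  fix i j assume "i < dim_row (mat_adjoint B * mat_adjoint A)" "j < dim_col (mat_adjoint B * mat_adjoint A)"
  then have i: "i < k" and j: "j < n" using A B by auto
  have "mat_adjoint (A * B) $$ (i, j) = cnj ((A * B) $$ (j, i))"
    using A B i j by (intro adjoint_index) auto
  also have "\<dots> = (\<Sum>l = 0..<m. cnj (A $$ (j, l)) * cnj (B $$ (l, i)))"
    using A B i j by (simp add: scalar_prod_def)
  also have "\<dots> = (mat_adjoint B * mat_adjoint A) $$ (i, j)"
    using A B i j by (simp add: scalar_prod_def adjoint_index mult.commute)
  finally show "mat_adjoint (A * B) $$ (i, j) = (mat_adjoint B * mat_adjoint A) $$ (i, j)" .
qed (use A B in auto)

lemma adjoint_adjoint: "mat_adjoint (mat_adjoint A) = (A :: complex mat)"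
  by (rule eq_matI) (auto simp: adjoint_index)

lemma unitary_mult:
  assumes U: "unitary n U" and V: "unitary n V"
  shows "unitary n (U * V)"
proof -
  have c: "U \<in> carrier_mat n n" "V \<in> carrier_mat n n" "mat_adjoint U \<in> carrier_mat n n" "mat_adjoint V \<in> carrier_mat n n"
    and e: "mat_adjoint U * U = 1\<^sub>m n" "U * mat_adjoint U = 1\<^sub>m n" "mat_adjoint V * V = 1\<^sub>m n" "V * mat_adjoint V = 1\<^sub>m n"
    using U V by (auto simp: unitary_def)
  note m = mult_carrier_mat[of _ n n _ n]
  note assoc = assoc_mult_mat[where ?n\<^sub>1.0=n and ?n\<^sub>2.0=n and ?n\<^sub>3.0=n and ?n\<^sub>4.0=n]
  have a: "mat_adjoint (U * V) = mat_adjoint V * mat_adjoint U" by (rule adjoint_mult[OF c(1,2)])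
  have "mat_adjoint V * mat_adjoint U * (U * V) = mat_adjoint V * ((mat_adjoint U * U) * V)"
    using c by (simp only: assoc m)
  also have "\<dots> = 1\<^sub>m n" using c e by simp
  finally have 1: "mat_adjoint V * mat_adjoint U * (U * V) = 1\<^sub>m n" .
  have "U * V * (mat_adjoint V * mat_adjoint U) = U * ((V * mat_adjoint V) * mat_adjoint U)"
    using c by (simp only: assoc m)
  also have "\<dots> = 1\<^sub>m n" using c e by simp
  finally have 2: "U * V * (mat_adjoint V * mat_adjoint U) = 1\<^sub>m n" .
  show ?thesis unfolding unitary_def a using 1 2 m[OF c(1,2)] by simp
qed

lemma diag_conj_compose:
  assumes U: "unitary n U" and x: "x \<in> carrier_mat n n"
    and T: "is_diagonalization n (mat_adjoint U * x * U) T d"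
  shows "is_diagonalization n x (U * T) d"
proof -
  define D where "D = mat_diag n (\<lambda>i. complex_of_real (d i))"
  have Tu: "unitary n T" and eq: "mat_adjoint U * x * U = T * D * mat_adjoint T"
    using T by (auto simp: is_diagonalization_def D_def)
  have c: "U \<in> carrier_mat n n" "mat_adjoint U \<in> carrier_mat n n" "T \<in> carrier_mat n n" "mat_adjoint T \<in> carrier_mat n n" "D \<in> carrier_mat n n"
    and e: "U * mat_adjoint U = 1\<^sub>m n"
    using U Tu by (auto simp: unitary_def D_def)
  note m = mult_carrier_mat[of _ n n _ n]
  note assoc = assoc_mult_mat[where ?n\<^sub>1.0=n and ?n\<^sub>2.0=n and ?n\<^sub>3.0=n and ?n\<^sub>4.0=n]
  have "x = (U * mat_adjoint U) * x * (U * mat_adjoint U)" using x by (simp add: e)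
  also have "\<dots> = U * (mat_adjoint U * x * U) * mat_adjoint U"
    using c x by (simp only: assoc m)
  also have "\<dots> = U * T * D * (mat_adjoint T * mat_adjoint U)"
    unfolding eq using c by (simp only: assoc m)
  also have "mat_adjoint T * mat_adjoint U = mat_adjoint (U * T)"
    by (rule adjoint_mult[OF c(1,3), symmetric])
  finally show ?thesis
    using unitary_mult[OF U Tu] by (simp add: is_diagonalization_def D_def)
qed

lemma eigenvalue_exists:
  fixes A :: "complex mat"
  assumes A: "A \<in> carrier_mat (Suc m) (Suc m)"
  shows "\<exists>e v. eigenvector A v e"
proof -
  have "degree (char_poly A) = Suc m" using degree_monic_char_poly[OF A] by simp
  then obtain e where "poly (char_poly A) e = 0"
    using fundamental_theorem_of_algebra[of "char_poly A"] by (auto simp: constant_degree)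
  then have "eigenvalue A e" by (simp add: eigenvalue_root_char_poly[OF A])
  then show ?thesis unfolding eigenvalue_def by blast
qed

definition cnorm :: "complex vec \<Rightarrow> complex" where
  "cnorm v = complex_of_real (sqrt (Re (v \<bullet>c v)))"

lemma cnorm_sq:
  assumes "v \<in> carrier_vec n" "v \<noteq> 0\<^sub>v n"
  shows "v \<bullet>c v = cnorm v * cnorm v" "cnorm v \<noteq> 0" "cnj (cnorm v) = cnorm v"
proof -
  have s: "v \<bullet>c v = complex_of_real (\<Sum>i = 0..<n. (cmod (v $ i))\<^sup>2)"
    using assms(1) by (simp add: scalar_prod_def complex_norm_square del: of_real_power)
  moreover have "v \<bullet>c v \<noteq> 0" using conjugate_square_eq_0_vec[OF assms(1)] assms(2) by simp
  ultimately have "(\<Sum>i = 0..<n. (cmod (v $ i))\<^sup>2) \<noteq> 0" by (simp only: of_real_eq_0_iff not_False_eq_True)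
  moreover have "(\<Sum>i = 0..<n. (cmod (v $ i))\<^sup>2) \<ge> 0" by (intro sum_nonneg) auto
  ultimately have r: "Re (v \<bullet>c v) > 0" "Im (v \<bullet>c v) = 0" unfolding s by auto
  then show "v \<bullet>c v = cnorm v * cnorm v" "cnorm v \<noteq> 0"
    by (auto simp: cnorm_def complex_eq_iff)
  show "cnj (cnorm v) = cnorm v" by (simp add: cnorm_def)
qed

text \<open>Gram-Schmidt applied to a basis starting with \<open>v\<close>, followed by normalization.\<close>

lemma unitary_with_first_column:
  fixes v :: "complex vec"
  assumes v: "v \<in> carrier_vec (Suc m)" and v0: "v \<noteq> 0\<^sub>v (Suc m)"
  obtains U a where "unitary (Suc m) U" "col U 0 = a \<cdot>\<^sub>v v"
proof -
  let ?n = "Suc m"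
  interpret cof_vec_space ?n "TYPE(complex)" .
  define b where "b = basis_completion v"
  define ws where "ws = gram_schmidt ?n b"
  from basis_completion[OF v v0, folded b_def]
  have dist_b: "distinct b" and indep: "\<not> lin_dep (set b)" and b: "set b \<subseteq> carrier_vec ?n"
    and hdb: "hd b = v" and len_b: "length b = ?n" by auto
  from hdb len_b obtain vs where bv: "b = v # vs" by (cases b, auto)
  from gram_schmidt_result[OF b dist_b indep refl, folded ws_def]
  have ws: "set ws \<subseteq> carrier_vec ?n" "corthogonal ws" "length ws = ?n" by (auto simp: len_b)
  from gram_schmidt_hd[OF v, of vs, folded bv] have hdws: "hd ws = v" unfolding ws_def .
  then have ws0: "ws ! 0 = v" using ws(3) by (metis hd_conv_nth length_0_conv nat.distinct(1))
  have wc: "ws ! i \<in> carrier_vec ?n" if "i < ?n" for i using ws that by auto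
  have orth: "(ws ! i \<bullet>c ws ! j = 0) = (i \<noteq> j)" if "i < ?n" "j < ?n" for i j
    using ws(2,3) that unfolding corthogonal_def by simp
  have w0: "ws ! i \<noteq> 0\<^sub>v ?n" if "i < ?n" for i
    using orth[OF that that] wc[OF that] by auto
  have N: "ws ! i \<bullet>c ws ! i = cnorm (ws ! i) * cnorm (ws ! i)" "cnorm (ws ! i) \<noteq> 0" "cnj (cnorm (ws ! i)) = cnorm (ws ! i)"
    if "i < ?n" for i
    using cnorm_sq[OF wc[OF that] w0[OF that]] by blast+
  define U where "U = Matrix.mat ?n ?n (\<lambda>(i, j). (ws ! j) $ i / cnorm (ws ! j))"
  have U: "U \<in> carrier_mat ?n ?n" by (simp add: U_def)
  have UU: "mat_adjoint U * U = 1\<^sub>m ?n"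
  proof (rule eq_matI)
    fix i j assume "i < dim_row (1\<^sub>m ?n)" "j < dim_col (1\<^sub>m ?n)"
    then have i: "i < ?n" and j: "j < ?n" by auto
    have "(mat_adjoint U * U) $$ (i, j) = (\<Sum>l = 0..<?n. cnj (U $$ (l, i)) * U $$ (l, j))"
      using U i j by (simp add: scalar_prod_def adjoint_index)
    also have "\<dots> = (\<Sum>l = 0..<?n. (ws ! j) $ l * cnj ((ws ! i) $ l) / (cnorm (ws ! i) * cnorm (ws ! j)))"
      using i j N(3) by (intro sum.cong refl) (simp add: U_def mult.commute)
    also have "\<dots> = (ws ! j \<bullet>c ws ! i) / (cnorm (ws ! i) * cnorm (ws ! j))"
      using wc[OF i] wc[OF j] by (simp add: scalar_prod_def sum_divide_distrib add_divide_distrib)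
    also have "\<dots> = (1\<^sub>m ?n) $$ (i, j)"
      using i j orth[OF j i] N(1,2)[OF i] by (cases "i = j") auto
    finally show "(mat_adjoint U * U) $$ (i, j) = (1\<^sub>m ?n) $$ (i, j)" .
  qed (use U in auto)
  have "unitary ?n U"
    unfolding unitary_def using U UU mat_mult_left_right_inverse[OF adjoint_carrier[OF U] U UU] by simp
  moreover have "col U 0 = (1 / cnorm v) \<cdot>\<^sub>v v"
    using v by (intro eq_vecI) (auto simp: U_def ws0)
  ultimately show ?thesis by (rule that)
qed

text \<open>A diagonalization of the lower right block extends by the unit vector in the first coordinate.\<close>

lemma diag_block_extend:
  assumes P: "is_diagonalization m B P d" and x: "x \<in> carrier_mat (Suc m) (Suc m)"
    and x00: "x $$ (0, 0) = complex_of_real r"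
    and x0: "\<And>i. i < m \<Longrightarrow> x $$ (Suc i, 0) = 0" "\<And>i. i < m \<Longrightarrow> x $$ (0, Suc i) = 0"
    and xB: "\<And>i j. i < m \<Longrightarrow> j < m \<Longrightarrow> x $$ (Suc i, Suc j) = B $$ (i, j)"
  shows "\<exists>T. is_diagonalization (Suc m) x T (case_nat r d)"
proof -
  have Pc: "P \<in> carrier_mat m m" and PP: "mat_adjoint P * P = 1\<^sub>m m" and B: "B = P * mat_diag m (\<lambda>i. complex_of_real (d i)) * mat_adjoint P"
    using P by (auto simp: is_diagonalization_def unitary_def)
  define T where "T = Matrix.mat (Suc m) (Suc m) (\<lambda>(i, j). case i of 0 \<Rightarrow> (case j of 0 \<Rightarrow> 1 | Suc j' \<Rightarrow> 0)
      | Suc i' \<Rightarrow> (case j of 0 \<Rightarrow> 0 | Suc j' \<Rightarrow> P $$ (i', j')))"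
  have T: "T \<in> carrier_mat (Suc m) (Suc m)" by (simp add: T_def)
  have Ti: "T $$ (0, 0) = 1" "\<And>j. j < m \<Longrightarrow> T $$ (0, Suc j) = 0" "\<And>i. i < m \<Longrightarrow> T $$ (Suc i, 0) = 0"
    "\<And>i j. i < m \<Longrightarrow> j < m \<Longrightarrow> T $$ (Suc i, Suc j) = P $$ (i, j)" by (auto simp: T_def)
  have TT: "mat_adjoint T * T = 1\<^sub>m (Suc m)"
  proof (rule eq_matI)
    fix i j assume "i < dim_row (1\<^sub>m (Suc m))" "j < dim_col (1\<^sub>m (Suc m))"
    then have i: "i < Suc m" and j: "j < Suc m" by auto
    have "(mat_adjoint T * T) $$ (i, j) = (\<Sum>l<Suc m. cnj (T $$ (l, i)) * T $$ (l, j))"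
      using T i j by (simp add: scalar_prod_def adjoint_index lessThan_atLeast0 del: sum.lessThan_Suc sum.op_ivl_Suc)
    also have "\<dots> = cnj (T $$ (0, i)) * T $$ (0, j) + (\<Sum>l<m. cnj (T $$ (Suc l, i)) * T $$ (Suc l, j))"
      by (rule sum.lessThan_Suc_shift)
    also have "\<dots> = (1\<^sub>m (Suc m)) $$ (i, j)"
    proof (cases i)
      case 0 then show ?thesis using j by (cases j) (auto simp: Ti)
    next
      case (Suc i')
      show ?thesis
      proof (cases j)
        case 0 then show ?thesis using Suc i by (auto simp: Ti)
      next
        case (Suc j')
        have "(\<Sum>l<m. cnj (P $$ (l, i')) * P $$ (l, j')) = (mat_adjoint P * P) $$ (i', j')"
          using \<open>i = Suc i'\<close> Suc i j Pc by (simp add: scalar_prod_def adjoint_index lessThan_atLeast0)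
        then show ?thesis using \<open>i = Suc i'\<close> Suc i j PP by (auto simp: Ti)
      qed
    qed
    finally show "(mat_adjoint T * T) $$ (i, j) = (1\<^sub>m (Suc m)) $$ (i, j)" .
  qed (use T in auto)
  have Tu: "unitary (Suc m) T"
    unfolding unitary_def using T TT mat_mult_left_right_inverse[OF adjoint_carrier[OF T] T TT] by simp
  have "x = T * mat_diag (Suc m) (\<lambda>i. complex_of_real (case_nat r d i)) * mat_adjoint T"
  proof (rule eq_matI)
    fix i j assume "i < dim_row (T * mat_diag (Suc m) (\<lambda>i. complex_of_real (case_nat r d i)) * mat_adjoint T)"
      "j < dim_col (T * mat_diag (Suc m) (\<lambda>i. complex_of_real (case_nat r d i)) * mat_adjoint T)"
    then have i: "i < Suc m" and j: "j < Suc m" using T by auto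
    have "(T * mat_diag (Suc m) (\<lambda>i. complex_of_real (case_nat r d i)) * mat_adjoint T) $$ (i, j)
       = (\<Sum>l<Suc m. T $$ (i, l) * complex_of_real (case_nat r d l) * cnj (T $$ (j, l)))"
      unfolding mat_diag_mult_right[OF T]
      using T i j by (simp add: scalar_prod_def adjoint_index lessThan_atLeast0 del: sum.lessThan_Suc sum.op_ivl_Suc)
    also have "\<dots> = T $$ (i, 0) * r * cnj (T $$ (j, 0)) + (\<Sum>l<m. T $$ (i, Suc l) * complex_of_real (d l) * cnj (T $$ (j, Suc l)))"
      by (subst sum.lessThan_Suc_shift) simp
    also have "\<dots> = x $$ (i, j)"
    proof (cases i)
      case 0 then show ?thesis using j by (cases j) (auto simp: Ti x00 x0)
    next
      case (Suc i')
      show ?thesis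
      proof (cases j)
        case 0 then show ?thesis using Suc i by (auto simp: Ti x0)
      next
        case (Suc j')
        have "(\<Sum>l<m. P $$ (i', l) * complex_of_real (d l) * cnj (P $$ (j', l))) = B $$ (i', j')"
          unfolding B mat_diag_mult_right[OF Pc] using \<open>i = Suc i'\<close> Suc i j Pc
          by (simp add: scalar_prod_def adjoint_index lessThan_atLeast0)
        then show ?thesis using \<open>i = Suc i'\<close> Suc i j by (auto simp: Ti xB)
      qed
    qed
    finally show "x $$ (i, j) = (T * mat_diag (Suc m) (\<lambda>i. complex_of_real (case_nat r d i)) * mat_adjoint T) $$ (i, j)" ..
  qed (use T x in auto)
  then show ?thesis using Tu unfolding is_diagonalization_def by blast
qed

text \<open>Induction on the size: conjugating by a unitary whose first column is an eigenvector splits off a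
\<open>1 \<times> 1\<close> block, because a Hermitian matrix whose first column vanishes below the diagonal also has such a first row.\<close>

theorem hermitian_diagonalizable:
  assumes "x \<in> herm n"
  shows "\<exists>U d. is_diagonalization n x U d"
  using assms
proof (induction n arbitrary: x)
  case 0
  then have "x \<in> carrier_mat 0 0" by (simp add: herm_def)
  then have "is_diagonalization 0 x (1\<^sub>m 0) (\<lambda>_. 0)"
    unfolding is_diagonalization_def unitary_def by (auto intro!: eq_matI)
  then show ?case by blast
next
  case (Suc m)
  let ?n = "Suc m"
  have x: "x \<in> carrier_mat ?n ?n" and xh: "mat_adjoint x = x" using Suc.prems by (auto simp: herm_def)
  obtain e v where ev: "eigenvector x v e" using eigenvalue_exists[OF x] by blast
  then have v: "v \<in> carrier_vec ?n" "v \<noteq> 0\<^sub>v ?n" "x *\<^sub>v v = e \<cdot>\<^sub>v v" using x by (auto simp: eigenvector_def)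
  obtain U a where U: "unitary ?n U" and c0: "col U 0 = a \<cdot>\<^sub>v v" using unitary_with_first_column[OF v(1,2)] by metis
  have Uc: "U \<in> carrier_mat ?n ?n" and UU: "mat_adjoint U * U = 1\<^sub>m ?n" using U by (auto simp: unitary_def)
  have Ua: "mat_adjoint U \<in> carrier_mat ?n ?n" by (rule adjoint_carrier[OF Uc])
  define y where "y = mat_adjoint U * x * U"
  have y: "y \<in> carrier_mat ?n ?n" unfolding y_def by (intro mult_carrier_mat[of _ ?n ?n _ ?n] Ua x Uc)
  have yh: "mat_adjoint y = y"
  proof -
    have "mat_adjoint y = mat_adjoint U * mat_adjoint (mat_adjoint U * x)"
      unfolding y_def by (rule adjoint_mult[of _ ?n ?n _ ?n]) (use Ua x Uc in auto)
    also have "mat_adjoint (mat_adjoint U * x) = x * U"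
      using adjoint_mult[OF Ua x] by (simp add: xh adjoint_adjoint)
    also have "mat_adjoint U * (x * U) = y"
      unfolding y_def by (rule assoc_mult_mat[symmetric, OF Ua x Uc])
    finally show ?thesis .
  qed
  have yadj: "y $$ (i, j) = cnj (y $$ (j, i))" if "i < ?n" "j < ?n" for i j
    using adjoint_index[of i y j] that y yh by simp
  have col: "y $$ (i, 0) = e * (1\<^sub>m ?n) $$ (i, 0)" if i: "i < ?n" for i
  proof -
    have "x *\<^sub>v col U 0 = a \<cdot>\<^sub>v (e \<cdot>\<^sub>v v)" unfolding c0 using mult_mat_vec[OF x v(1)] v(3) by simp
    also have "\<dots> = e \<cdot>\<^sub>v col U 0" unfolding c0 by (simp add: smult_smult_assoc mult.commute)
    finally have xc: "x *\<^sub>v col U 0 = e \<cdot>\<^sub>v col U 0" .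
    have "y = mat_adjoint U * (x * U)" unfolding y_def by (rule assoc_mult_mat[OF Ua x Uc])
    then have "y $$ (i, 0) = row (mat_adjoint U) i \<bullet> col (x * U) 0" using i Uc Ua x by simp
    also have "col (x * U) 0 = x *\<^sub>v col U 0" using x Uc by (intro eq_vecI) auto
    also have "row (mat_adjoint U) i \<bullet> (x *\<^sub>v col U 0) = e * (row (mat_adjoint U) i \<bullet> col U 0)"
      unfolding xc using Uc Ua i by (intro scalar_prod_smult_right) auto
    also have "row (mat_adjoint U) i \<bullet> col U 0 = (mat_adjoint U * U) $$ (i, 0)" using i Uc Ua by simp
    finally show ?thesis unfolding UU .
  qed
  define B where "B = Matrix.mat m m (\<lambda>(i, j). y $$ (Suc i, Suc j))"
  have "B \<in> herm m"
  proof -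
    have "mat_adjoint B = B"
    proof (rule eq_matI)
      fix i j assume "i < dim_row B" "j < dim_col B"
      then have ij: "i < m" "j < m" by (auto simp: B_def)
      have "mat_adjoint B $$ (i, j) = cnj (y $$ (Suc j, Suc i))" using ij by (simp add: adjoint_index B_def)
      also have "\<dots> = y $$ (Suc i, Suc j)" using ij by (intro yadj[symmetric]) auto
      finally show "mat_adjoint B $$ (i, j) = B $$ (i, j)" using ij by (simp add: B_def)
    qed (auto simp: B_def)
    then show ?thesis by (simp add: herm_def B_def)
  qed
  then obtain P d where P: "is_diagonalization m B P d" using Suc.IH by blast
  have y00: "y $$ (0, 0) = complex_of_real (Re (y $$ (0, 0)))"
    using yadj[of 0 0] by (simp add: complex_eq_iff)
  have y0: "y $$ (Suc i, 0) = 0" "y $$ (0, Suc i) = 0" if "i < m" for i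
    using col[of "Suc i"] yadj[of 0 "Suc i"] that by auto
  obtain T where "is_diagonalization ?n y T (case_nat (Re (y $$ (0, 0))) d)"
    using diag_block_extend[OF P y y00 y0] by (auto simp: B_def)
  then have "is_diagonalization ?n x (U * T) (case_nat (Re (y $$ (0, 0))) d)"
    unfolding y_def by (rule diag_conj_compose[OF U x])
  then show ?case by blast
qed

lemma trace_cyclic:
  assumes A: "A \<in> carrier_mat n m" and B: "B \<in> carrier_mat m n"
  shows "tr (A * B) = tr (B * A)"
proof -
  have "tr (A * B) = (\<Sum>i<n. \<Sum>j<m. A $$ (i, j) * B $$ (j, i))"
    using A B by (simp add: tr_def diag_mat_def scalar_prod_def sum_list_distinct_conv_sum_set lessThan_atLeast0)
  also have "\<dots> = (\<Sum>j<m. \<Sum>i<n. B $$ (j, i) * A $$ (i, j))"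
    by (subst sum.swap) (simp add: mult.commute)
  also have "\<dots> = tr (B * A)"
    using A B by (simp add: tr_def diag_mat_def scalar_prod_def sum_list_distinct_conv_sum_set lessThan_atLeast0)
  finally show ?thesis .
qed

lemma tr_unitary_conj:
  assumes U: "unitary n U"
  shows "tr (U * mat_diag n f * mat_adjoint U) = (\<Sum>i<n. f i)"
proof -
  have c: "U \<in> carrier_mat n n" "mat_adjoint U \<in> carrier_mat n n" "mat_diag n f \<in> carrier_mat n n"
    and e: "mat_adjoint U * U = 1\<^sub>m n" using U by (auto simp: unitary_def)
  have "tr (U * mat_diag n f * mat_adjoint U) = tr (mat_adjoint U * (U * mat_diag n f))"
    by (rule trace_cyclic[of _ n n]) (use c in auto)
  also have "mat_adjoint U * (U * mat_diag n f) = mat_diag n f"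
    using assoc_mult_mat[OF c(2,1,3)] e c by simp
  also have "tr (mat_diag n f) = (\<Sum>i<n. f i)"
    by (simp add: tr_def diag_mat_def sum_list_distinct_conv_sum_set lessThan_atLeast0 mat_diag_def)
  finally show ?thesis .
qed

lemma tr_fun_calc:
  assumes "is_diagonalization n x U d"
  shows "tr (fun_calc f x) = of_real (\<Sum>i<n. f (d i))"
  using assms tr_unitary_conj[of n U "\<lambda>i. complex_of_real (f (d i))"]
  unfolding fun_calc_eq[OF assms] by (simp add: is_diagonalization_def)

lemma det_diagonalization:
  assumes D: "is_diagonalization n x U d"
  shows "Determinant.det x = of_real (\<Prod>i<n. d i)"
proof -
  let ?D = "mat_diag n (\<lambda>i. complex_of_real (d i))"
  have c: "U \<in> carrier_mat n n" "mat_adjoint U \<in> carrier_mat n n" "?D \<in> carrier_mat n n"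
    and e: "U * mat_adjoint U = 1\<^sub>m n" and x: "x = U * ?D * mat_adjoint U"
    using D by (auto simp: unitary_def is_diagonalization_def)
  have "Determinant.det x = Determinant.det U * Determinant.det ?D * Determinant.det (mat_adjoint U)"
    unfolding x using c by (simp add: det_mult[of _ n])
  also have "\<dots> = Determinant.det ?D * Determinant.det (U * mat_adjoint U)"
    using c by (simp add: det_mult[of _ n])
  also have "\<dots> = Determinant.det ?D" by (simp add: e)
  also have "\<dots> = prod_list (diag_mat ?D)"
    by (rule det_upper_triangular[of _ n]) (auto simp: upper_triangular_def mat_diag_def)
  also have "\<dots> = (\<Prod>i<n. complex_of_real (d i))"
    by (simp add: diag_mat_def prod.list_conv_set_nth mat_diag_def lessThan_atLeast0)
  finally show ?thesis by simp
qed

section \<open>Moments of the matrix ensemble\<close>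

lemma pfun_measurable_lborel:
  assumes "pfun I F F'"
  shows "F \<in> borel_measurable (\<Pi>\<^sub>M i\<in>I. lborel)"
proof -
  have "sets (\<Pi>\<^sub>M i\<in>I. wgauss 0) = sets (\<Pi>\<^sub>M i\<in>I. lborel)" by (rule sets_PiM_cong) auto
  then show ?thesis using pfun_measurable[OF assms, of 0] by (simp cong: measurable_cong_sets)
qed

lemma pfun_tmon:
  assumes "\<And>k. \<exists>t'. pfun I (t k) t'"
  shows "\<exists>m'. pfun I (\<lambda>u. tmon (\<lambda>k. t k u) L) m'"
proof (induction L)
  case Nil show ?case using pfun_const[of I 1] by (intro exI) simp
next
  case (Cons a L)
  obtain t' where "pfun I (t a) t'" using assms by blast
  moreover obtain m' where "pfun I (\<lambda>u. tmon (\<lambda>k. t k u) L) m'" using Cons by blast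
  ultimately show ?case using pfun_mult by (intro exI) simp
qed

lemma trace_poly_measurable:
  assumes "trace_poly f" "\<And>k. t k \<in> borel_measurable M"
  shows "(\<lambda>u. f (\<lambda>k. t k u)) \<in> borel_measurable M"
  using assms(1)
proof induction
  case (tp_var k) show ?case by (rule assms(2))
next
  case (tp_add f g) then show ?case by (intro borel_measurable_add)
next
  case (tp_mult f g) then show ?case by (intro borel_measurable_times)
qed simp

text \<open>The index set of the coordinates of Hermitian matrices.\<close>

definition hidx :: "nat \<Rightarrow> (nat \<times> nat) set" where
  "hidx n = {..<n} \<times> {..<n}"

lemma finite_hidx [simp]: "finite (hidx n)" and card_hidx: "card (hidx n) = n * n"
  by (simp_all add: hidx_def)

lemma herm_of_coords_carrier [simp]: "herm_of_coords n u \<in> carrier_mat n n"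
  "dim_row (herm_of_coords n u) = n" "dim_col (herm_of_coords n u) = n"
  by (simp_all add: herm_of_coords_def)

lemma herm_of_coords_index:
  "i < n \<Longrightarrow> j < n \<Longrightarrow> herm_of_coords n u $$ (i, j) = hent i j u"
  by (simp add: herm_of_coords_def hent_def)

lemma cnj_hent: "cnj (hent j i u) = hent i j u"
  by (auto simp: hent_def complex_eq_iff)

lemma herm_of_coords_herm: "herm_of_coords n u \<in> herm n"
  unfolding herm_def
  by (auto intro!: eq_matI simp: adjoint_index herm_of_coords_index cnj_hent)

lemma herm_of_coords_scale:
  "herm_of_coords n (\<lambda>p\<in>hidx n. r * u p) = of_real r \<cdot>\<^sub>m herm_of_coords n u"
  by (rule eq_matI) (auto simp: herm_of_coords_index hent_def hidx_def complex_eq_iff)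

lemma hpow_diagonalization:
  assumes D: "is_diagonalization n (herm_of_coords n u) U d" and ij: "i < n" "j < n"
  shows "hpow n k i j u = (U * mat_diag n (\<lambda>i. complex_of_real (d i) ^ k) * mat_adjoint U) $$ (i, j)"
  using ij
proof (induction k arbitrary: i)
  have Uc: "U \<in> carrier_mat n n" "mat_adjoint U \<in> carrier_mat n n"
    and UU: "mat_adjoint U * U = 1\<^sub>m n" "U * mat_adjoint U = 1\<^sub>m n"
    and x: "herm_of_coords n u = U * mat_diag n (\<lambda>i. complex_of_real (d i)) * mat_adjoint U"
    using D by (auto simp: is_diagonalization_def unitary_def)
  {
    case 0
    have "mat_diag n (\<lambda>i. complex_of_real (d i) ^ 0) = 1\<^sub>m n" by (rule eq_matI) (auto simp: mat_diag_def)
    then show ?case using 0 Uc UU by simp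
  next
    case (Suc k)
    let ?D = "\<lambda>k. mat_diag n (\<lambda>i. complex_of_real (d i) ^ k)"
    have Dc: "?D k \<in> carrier_mat n n" for k by simp
    note m = mult_carrier_mat[of _ n n _ n]
    note assoc = assoc_mult_mat[where ?n\<^sub>1.0=n and ?n\<^sub>2.0=n and ?n\<^sub>3.0=n and ?n\<^sub>4.0=n]
    have DD: "?D 1 * ?D k = ?D (Suc k)"
      unfolding mat_diag_diag by simp
    have "herm_of_coords n u * (U * ?D k * mat_adjoint U) = U * ?D 1 * mat_adjoint U * (U * ?D k * mat_adjoint U)"
      unfolding x by simp
    also have "\<dots> = U * (?D 1 * ((mat_adjoint U * U) * (?D k * mat_adjoint U)))"
      using Uc Dc by (simp only: assoc m)
    also have "\<dots> = U * (?D 1 * (?D k * mat_adjoint U))"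
      unfolding UU using left_mult_one_mat[OF m[OF Dc[of k] Uc(2)]] by simp
    also have "\<dots> = U * (?D 1 * ?D k) * mat_adjoint U"
      using Uc Dc by (simp only: assoc m)
    finally have E: "herm_of_coords n u * (U * ?D k * mat_adjoint U) = U * ?D (Suc k) * mat_adjoint U" unfolding DD .
    have c: "U * ?D k * mat_adjoint U \<in> carrier_mat n n" using Uc Dc by (intro m)
    have "hpow n (Suc k) i j u = (\<Sum>l<n. herm_of_coords n u $$ (i, l) * (U * ?D k * mat_adjoint U) $$ (l, j))"
      using Suc by (simp add: herm_of_coords_index)
    also have "\<dots> = (herm_of_coords n u * (U * ?D k * mat_adjoint U)) $$ (i, j)"
      using c Suc.prems by (simp add: scalar_prod_def lessThan_atLeast0 del: index_mult_mat(2,3))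
    finally show ?case unfolding E .
  }
qed

lemma htr_eigenvalues:
  assumes D: "is_diagonalization n (herm_of_coords n u) U d"
  shows "htr n k u = of_real (\<Sum>i<n. d i ^ k)"
proof -
  have U: "unitary n U" using D by (simp add: is_diagonalization_def)
  then have c: "dim_row U = n" by (auto simp: unitary_def)
  have "htr n k u = (\<Sum>i<n. (U * mat_diag n (\<lambda>i. complex_of_real (d i) ^ k) * mat_adjoint U) $$ (i, i))"
    unfolding htr_def using hpow_diagonalization[OF D] by (intro sum.cong refl) auto
  also have "\<dots> = tr (U * mat_diag n (\<lambda>i. complex_of_real (d i) ^ k) * mat_adjoint U)"
    using c by (simp add: tr_def diag_mat_def sum_list_distinct_conv_sum_set lessThan_atLeast0)
  also have "\<dots> = (\<Sum>i<n. complex_of_real (d i) ^ k)" by (rule tr_unitary_conj[OF U])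
  finally show ?thesis by simp
qed

lemma tr_square_coords: "tr (herm_of_coords n u * herm_of_coords n u) = complex_of_real (sqnorm (hidx n) u)"
  unfolding tr_herm_of_coords by (simp add: sqnorm_def hidx_def power2_eq_square)

lemma sqnorm_eigenvalues:
  assumes D: "is_diagonalization n (herm_of_coords n u) U d"
  shows "sqnorm (hidx n) u = (\<Sum>i<n. (d i)\<^sup>2)"
proof -
  have "tr (herm_of_coords n u * herm_of_coords n u) = (\<Sum>i<n. \<Sum>l<n. hent i l u * hent l i u)"
    by (simp add: tr_def diag_mat_def scalar_prod_def herm_of_coords_index sum_list_distinct_conv_sum_set lessThan_atLeast0)
  also have "\<dots> = htr n 2 u"
    unfolding htr_def numeral_2_eq_2 hpow.simps
    by (intro sum.cong refl) (simp add: if_distrib cong: if_cong)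
  also have "\<dots> = complex_of_real (\<Sum>i<n. (d i)\<^sup>2)" by (rule htr_eigenvalues[OF D])
  finally have "complex_of_real (sqnorm (hidx n) u) = complex_of_real (\<Sum>i<n. (d i)\<^sup>2)" unfolding tr_square_coords .
  then show ?thesis by (simp only: of_real_eq_iff)
qed

text \<open>The determinant of a Hermitian matrix is real, so that its real part loses nothing.\<close>

definition hdet :: "nat \<Rightarrow> (nat \<times> nat \<Rightarrow> real) \<Rightarrow> real" where
  "hdet n u = Re (Determinant.det (herm_of_coords n u))"

lemma hdet_eigenvalues:
  assumes D: "is_diagonalization n (herm_of_coords n u) U d"
  shows "Determinant.det (herm_of_coords n u) = of_real (hdet n u)" "hdet n u = (\<Prod>i<n. d i)"
  unfolding hdet_def det_diagonalization[OF D] by (simp_all only: Re_complex_of_real)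

lemma obtain_eigenvalues:
  obtains U d where "is_diagonalization n (herm_of_coords n u) U d"
  using hermitian_diagonalizable[OF herm_of_coords_herm] by blast

lemma pfun_htr: "\<exists>t'. pfun (hidx n) (htr n k) t'"
proof -
  have "pfun (hidx n) (htr n k) (\<lambda>p u. \<Sum>i<n. if p \<in> {..<n}\<times>{..<n} then hpow_deriv n k i i p u else 0)"
    unfolding hidx_def htr_def[abs_def] by (intro pfun_sum pfun_hpow) auto
  then show ?thesis by blast
qed

lemma htr_measurable [measurable]: "htr n k \<in> borel_measurable (\<Pi>\<^sub>M p\<in>hidx n. lborel)"
  using pfun_htr pfun_measurable_lborel by blast

text \<open>One polynomial represents the determinant in terms of the traces and the product of the coordinates in terms of
the power sums.\<close>

lemma hdet_trace_poly:
  "\<exists>f. trace_poly f \<and> (\<forall>u. complex_of_real (hdet n u) = f (\<lambda>k. htr n k u)) \<and>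
     (\<forall>x. (\<Prod>i<n. complex_of_real (x i)) = f (\<lambda>k. power_sum n k x))"
proof -
  obtain f where f: "trace_poly f" "\<And>x. (\<Prod>i<n. x i) = f (\<lambda>j. \<Sum>i<n. x i ^ j)"
    using product_trace_poly[of n] by blast
  have "complex_of_real (hdet n u) = f (\<lambda>k. htr n k u)" for u
  proof -
    obtain U d where D: "is_diagonalization n (herm_of_coords n u) U d" by (rule obtain_eigenvalues)
    show ?thesis using f(2)[of "\<lambda>i. complex_of_real (d i)"]
      by (simp add: hdet_eigenvalues(2)[OF D] htr_eigenvalues[OF D])
  qed
  moreover have "(\<Prod>i<n. complex_of_real (x i)) = f (\<lambda>k. power_sum n k x)" for x
    unfolding power_sum_def by (rule f(2))
  ultimately show ?thesis using f(1) by blast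
qed

lemma hdet_measurable [measurable]: "hdet n \<in> borel_measurable (\<Pi>\<^sub>M p\<in>hidx n. lborel)"
proof -
  obtain f where f: "trace_poly f" "\<And>u. complex_of_real (hdet n u) = f (\<lambda>k. htr n k u)"
    using hdet_trace_poly by blast
  have "(\<lambda>u. f (\<lambda>k. htr n k u)) \<in> borel_measurable (\<Pi>\<^sub>M p\<in>hidx n. lborel)"
    by (rule trace_poly_measurable[OF f(1) htr_measurable])
  then have "(\<lambda>u. Re (complex_of_real (hdet n u))) \<in> borel_measurable (\<Pi>\<^sub>M p\<in>hidx n. lborel)"
    unfolding f(2) by measurable
  then show ?thesis by simp
qed

lemma abs_prod_le_1:
  fixes x :: "nat \<Rightarrow> real"
  assumes "(\<Sum>i<n. (x i)\<^sup>2) \<le> 1"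
  shows "\<bar>\<Prod>i<n. x i\<bar> \<le> 1"
proof -
  have "\<bar>x i\<bar> \<le> 1" if "i < n" for i
  proof -
    have "(x i)\<^sup>2 \<le> (\<Sum>i<n. (x i)\<^sup>2)" using that by (intro member_le_sum) auto
    then have "(x i)\<^sup>2 \<le> 1" using assms by simp
    then show ?thesis by (simp add: abs_square_le_1)
  qed
  then show ?thesis by (auto simp: abs_prod intro!: prod_le_1)
qed

lemma hpow_scale:
  assumes "i < n" "j < n"
  shows "hpow n k i j (\<lambda>p\<in>hidx n. r * u p) = of_real (r ^ k) * hpow n k i j u"
  using assms
proof (induction k arbitrary: i)
  case (Suc k)
  have "hent i l (\<lambda>p\<in>hidx n. r * u p) = of_real r * hent i l u" if "l < n" for l
    using Suc.prems that by (auto simp: hent_def hidx_def complex_eq_iff)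
  then have "hpow n (Suc k) i j (\<lambda>p\<in>hidx n. r * u p) = (\<Sum>l<n. of_real r * hent i l u * (of_real (r ^ k) * hpow n k l j u))"
    unfolding hpow.simps by (intro sum.cong refl) (simp only: lessThan_iff Suc.IH[OF _ Suc.prems(2)])
  also have "\<dots> = of_real (r ^ Suc k) * hpow n (Suc k) i j u"
    by (simp add: sum_distrib_left mult_ac)
  finally show ?case .
qed auto

lemma two_card_pairs: "n + 2 * card {(i, j). i < j \<and> j < (n::nat)} = n * n"
proof -
  have "complex_of_nat (n * n) = of_nat (n + 2 * card {(i, j). i < j \<and> j < n})"
    using sum_offdiag[where g="\<lambda>_ _. 1" and n=n] by (simp add: case_prod_unfold)
  then show ?thesis by (simp only: of_nat_eq_iff)
qed

lemma PiM_wgauss_density: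
  assumes I: "finite I" and \<mu>: "\<mu> \<ge> 0"
  shows "(\<Pi>\<^sub>M i\<in>I. wgauss \<mu>) = density (\<Pi>\<^sub>M i\<in>I. lborel) (\<lambda>u. ennreal (\<bar>\<Prod>i\<in>I. u i\<bar> powr (2 * \<mu>) * exp (- sqnorm I u)))"
proof -
  have "(\<Pi>\<^sub>M i\<in>I. wgauss \<mu>) = density (\<Pi>\<^sub>M i\<in>I. lborel) (\<lambda>u. ennreal (\<Prod>i\<in>I. \<bar>u i\<bar> powr (2 * \<mu>) * exp (- (u i)\<^sup>2)))"
    unfolding wgauss_def
    by (rule PiM_density_lborel[OF I])
       (use finite_measure.axioms(1)[OF finite_measure_wgauss[OF \<mu>]] in \<open>auto simp: wgauss_def\<close>)
  moreover have "(\<Prod>i\<in>I. \<bar>u i\<bar> powr (2 * \<mu>) * exp (- (u i)\<^sup>2)) = \<bar>\<Prod>i\<in>I. u i\<bar> powr (2 * \<mu>) * exp (- sqnorm I u)" for u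
    by (simp add: prod.distrib abs_prod prod_powr_distrib exp_sum[OF I, symmetric] sqnorm_def sum_negf)
  ultimately show ?thesis by simp
qed

lemma PiM_wgauss_0_density:
  assumes I: "finite I"
  shows "(\<Pi>\<^sub>M i\<in>I. wgauss 0) = density (\<Pi>\<^sub>M i\<in>I. lborel) (\<lambda>u. ennreal (exp (- sqnorm I u)))"
proof -
  have "(\<Pi>\<^sub>M i\<in>I. wgauss 0) = density (\<Pi>\<^sub>M i\<in>I. lborel) (\<lambda>u. ennreal (\<Prod>i\<in>I. exp (- (u i)\<^sup>2)))"
    unfolding wgauss_0
    by (rule PiM_density_lborel[OF I])
       (use finite_measure.axioms(1)[OF finite_measure_wgauss[of 0]] in \<open>auto simp: wgauss_0\<close>)
  moreover have "(\<Prod>i\<in>I. exp (- (u i)\<^sup>2)) = exp (- sqnorm I u)" for u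
    by (simp add: exp_sum[OF I, symmetric] sqnorm_def sum_negf)
  ultimately show ?thesis by simp
qed

lemma vdm2_real: "vdm2 n x = complex_of_real ((vdm n x)\<^sup>2)"
  by (simp add: vdm2_def vdm_def case_prod_unfold prod_power_distrib)

lemma power_sum_real: "power_sum n k x = complex_of_real (\<Sum>i<n. x i ^ k)"
  by (simp add: power_sum_def)

lemma vdm_measurable [measurable]: "vdm n \<in> borel_measurable (\<Pi>\<^sub>M i\<in>{..<n}. lborel)"
proof -
  have [measurable]: "(\<lambda>x. x i) \<in> borel_measurable (\<Pi>\<^sub>M i\<in>{..<n}. (lborel :: real measure))" if "i < n" for i
    using that measurable_component_singleton[of i "{..<n}" "\<lambda>_. lborel :: real measure"] by simp
  show ?thesis unfolding vdm_def[abs_def] case_prod_unfold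
    by (intro borel_measurable_prod borel_measurable_diff) auto
qed

lemma nn_integral_PiM_wgauss_0:
  assumes I: "finite I" and f [measurable]: "f \<in> borel_measurable (\<Pi>\<^sub>M i\<in>I. lborel)" and pos: "\<And>u. f u \<ge> 0"
    and int: "integrable (\<Pi>\<^sub>M i\<in>I. wgauss 0) f"
  shows "(\<integral>\<^sup>+u. ennreal (f u * exp (- sqnorm I u)) \<partial>(\<Pi>\<^sub>M i\<in>I. lborel)) = ennreal (\<integral>u. f u \<partial>(\<Pi>\<^sub>M i\<in>I. wgauss 0))"
proof -
  have "ennreal (\<integral>u. f u \<partial>(\<Pi>\<^sub>M i\<in>I. wgauss 0)) = (\<integral>\<^sup>+u. ennreal (f u) \<partial>(\<Pi>\<^sub>M i\<in>I. wgauss 0))"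
    by (rule nn_integral_eq_integral[symmetric, OF int]) (use pos in auto)
  also have "\<dots> = (\<integral>\<^sup>+u. ennreal (exp (- sqnorm I u)) * ennreal (f u) \<partial>(\<Pi>\<^sub>M i\<in>I. lborel))"
    unfolding PiM_wgauss_0_density[OF I] by (rule nn_integral_density) measurable
  finally show ?thesis using pos by (simp add: ennreal_mult mult.commute)
qed

lemma nn_integral_PiM_wgauss:
  assumes I: "finite I" and \<mu>: "\<mu> \<ge> 0" and f [measurable]: "f \<in> borel_measurable (\<Pi>\<^sub>M i\<in>I. lborel)" and pos: "\<And>u. f u \<ge> 0"
    and int: "has_bochner_integral (\<Pi>\<^sub>M i\<in>I. wgauss \<mu>) f v"
  shows "(\<integral>\<^sup>+u. ennreal (f u * \<bar>\<Prod>i\<in>I. u i\<bar> powr (2 * \<mu>) * exp (- sqnorm I u)) \<partial>(\<Pi>\<^sub>M i\<in>I. lborel)) = ennreal v"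
proof -
  have [measurable]: "(\<lambda>u. \<Prod>i\<in>I. u i) \<in> borel_measurable (\<Pi>\<^sub>M i\<in>I. (lborel :: real measure))" by measurable
  have "ennreal v = (\<integral>\<^sup>+u. ennreal (f u) \<partial>(\<Pi>\<^sub>M i\<in>I. wgauss \<mu>))"
    using int pos by (subst nn_integral_eq_integral) (auto simp: has_bochner_integral_iff)
  also have "\<dots> = (\<integral>\<^sup>+u. ennreal (\<bar>\<Prod>i\<in>I. u i\<bar> powr (2 * \<mu>) * exp (- sqnorm I u)) * ennreal (f u) \<partial>(\<Pi>\<^sub>M i\<in>I. lborel))"
    unfolding PiM_wgauss_density[OF I \<mu>] by (rule nn_integral_density) measurable
  finally show ?thesis using pos by (simp add: ennreal_mult[symmetric] mult_ac)
qed

text \<open>Weyl's integration formula for polynomial class functions of a Gaussian Hermitian matrix.\<close>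

lemma gauss_polynomial_transfer:
  assumes f: "trace_poly f" and F: "\<And>u. f (\<lambda>k. htr n k u) = complex_of_real (F u)" and G: "\<And>x. f (\<lambda>k. power_sum n k x) = complex_of_real (G x)"
  shows "integrable (\<Pi>\<^sub>M p\<in>hidx n. wgauss 0) F" "integrable (\<Pi>\<^sub>M i\<in>{..<n}. wgauss 0) (\<lambda>x. G x * (vdm n x)\<^sup>2)"
    "(\<integral>x. (vdm n x)\<^sup>2 \<partial>(\<Pi>\<^sub>M i\<in>{..<n}. wgauss 0)) * (\<integral>u. F u \<partial>(\<Pi>\<^sub>M p\<in>hidx n. wgauss 0)) =
     measure (\<Pi>\<^sub>M p\<in>hidx n. wgauss 0) (space (\<Pi>\<^sub>M p\<in>hidx n. wgauss 0)) * (\<integral>x. G x * (vdm n x)\<^sup>2 \<partial>(\<Pi>\<^sub>M i\<in>{..<n}. wgauss 0))"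
proof -
  let ?A = "\<Pi>\<^sub>M p\<in>hidx n. wgauss 0" and ?B = "\<Pi>\<^sub>M i\<in>{..<n}. wgauss 0"
  have iA: "integrable ?A (\<lambda>u. 1 * tmon (\<lambda>k. htr n k u) L)" for L
  proof -
    obtain m' where "pfun (hidx n) (\<lambda>u. tmon (\<lambda>k. htr n k u) L) m'" using pfun_tmon[of "hidx n" "htr n", OF pfun_htr] by blast
    then show ?thesis by (simp add: pfun_integrable[OF finite_hidx order.refl])
  qed
  have iB: "integrable ?B (\<lambda>x. vdm2 n x * tmon (\<lambda>k. power_sum n k x) L)" for L
  proof -
    have "pfun {..<n} (power_sum n k) (\<lambda>p u. \<Sum>i<n. if p = i then of_nat k * of_real (u i) ^ (k - 1) else 0)" for k
      unfolding power_sum_def[abs_def] by (intro pfun_sum pfun_power_coord) auto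
    then have "\<exists>t'. pfun {..<n} (power_sum n k) t'" for k by blast
    then obtain m' where m: "pfun {..<n} (\<lambda>u. tmon (\<lambda>k. power_sum n k u) L) m'" using pfun_tmon[of "{..<n}" "power_sum n"] by blast
    obtain W' where W: "pfun {..<n} (vdm2 n) W'" using power_vector_field_vdm2[of n] by blast
    show ?thesis by (rule pfun_integrable[OF finite_lessThan order.refl pfun_mult[OF W m]])
  qed
  note T = loop_solution_trace_poly[OF loop_solution_matrices[folded hidx_def] loop_solution_eigenvalues iA iB f]
  have i1: "integrable ?A (\<lambda>u. complex_of_real (F u))" using T(1) by (simp add: F)
  then show "integrable ?A F" using integrable_Re by fastforce
  have i2: "integrable ?B (\<lambda>x. complex_of_real (G x * (vdm n x)\<^sup>2))" using T(2) by (simp add: G vdm2_real mult.commute)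
  then show "integrable ?B (\<lambda>x. G x * (vdm n x)\<^sup>2)" using integrable_Re[OF i2] by simp
  have "(\<integral>u. complex_of_real (F u) \<partial>?A) * (\<integral>x. complex_of_real ((vdm n x)\<^sup>2) \<partial>?B) =
     (\<integral>x. complex_of_real (G x * (vdm n x)\<^sup>2) \<partial>?B) * of_real (measure ?A (space ?A))"
    using T(3) by (simp add: F G vdm2_real mult.commute scaleR_conv_of_real)
  then have "complex_of_real ((\<integral>u. F u \<partial>?A) * (\<integral>x. (vdm n x)\<^sup>2 \<partial>?B)) = complex_of_real ((\<integral>x. G x * (vdm n x)\<^sup>2 \<partial>?B) * measure ?A (space ?A))"
    unfolding integral_complex_of_real by (simp only: of_real_mult[symmetric])
  then show "(\<integral>x. (vdm n x)\<^sup>2 \<partial>?B) * (\<integral>u. F u \<partial>?A) = measure ?A (space ?A) * (\<integral>x. G x * (vdm n x)\<^sup>2 \<partial>?B)"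
    by (simp only: of_real_eq_iff mult.commute)
qed

text \<open>The unnormalized moment of order \<open>2k\<close>, as a nonnegative integral so that finiteness need not be known
in advance.\<close>

definition matrix_moment :: "nat \<Rightarrow> real \<Rightarrow> nat \<Rightarrow> ennreal" where
  "matrix_moment n \<mu> k = (\<integral>\<^sup>+u. ennreal (Re (htr n (2 * k) u) * \<bar>hdet n u\<bar> powr (2 * \<mu>) * exp (- sqnorm (hidx n) u)) \<partial>(\<Pi>\<^sub>M p\<in>hidx n. lborel))"

lemma one_point_moment:
  assumes "\<nu> \<ge> 0"
  shows "has_bochner_integral (\<Pi>\<^sub>M i\<in>{..<n}. wgauss \<nu>) (\<lambda>x. (\<Sum>i<n. x i ^ (2 * k)) * (vdm n x)\<^sup>2)
     (fact n * (\<Prod>j<n. opoly_norm \<nu> j) * (\<Sum>j<n. jac \<nu> k j j))"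
  using one_point_formula[OF assms, of n "[:0, 1:] ^ (2 * k)"] unfolding wgauss_integral_jac_diag[OF assms]
  by (simp add: poly_power)

lemma sum_jac_diag_nonneg:
  assumes "\<nu> \<ge> 0"
  shows "(\<Sum>j<n. jac \<nu> k j j) \<ge> 0"
proof -
  have "0 \<le> fact n * (\<Prod>j<n. opoly_norm \<nu> j) * (\<Sum>j<n. jac \<nu> k j j)"
    unfolding has_bochner_integral_integral_eq[OF one_point_moment[OF assms], symmetric]
    by (intro integral_nonneg_AE AE_I2 mult_nonneg_nonneg sum_nonneg) auto
  moreover have "fact n * (\<Prod>j<n. opoly_norm \<nu> j) > 0" using opoly_norm_pos[OF assms] by (simp add: prod_pos)
  ultimately show ?thesis by (simp add: zero_le_mult_iff)
qed

text \<open>The comparison of matrix and eigenvalue integrals is applied with \<open>h\<^sub>1 = tr X^(2k)\<close> in dimension \<open>n^2\<close> and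
\<open>h\<^sub>2 = \<Sum>\<^sub>i x\<^sub>i^(2k)\<close> times the squared Vandermonde product in dimension \<open>n\<close>; the latter has the additional degree \<open>n (n - 1)\<close>,
so dimension plus degree agrees. The eigenvalue integral is then the one-point function. The constant \<open>C\<close> does not depend on \<open>k\<close> and cancels
after normalization.\<close>

lemma matrix_moment_formula:
  assumes n: "n \<ge> 1" and \<mu>: "\<mu> > 0"
  shows "\<exists>C>0. \<forall>k. matrix_moment n \<mu> k = ennreal (C * (\<Sum>j<n. jac \<mu> k j j))"
proof -
  let ?A = "\<Pi>\<^sub>M p\<in>hidx n. wgauss 0" and ?B = "\<Pi>\<^sub>M i\<in>{..<n}. wgauss 0"
  let ?LB = "\<Pi>\<^sub>M i\<in>{..<n}. lborel :: real measure"
  define z1 where "z1 = measure ?A (space ?A)"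
  define z2 where "z2 = (\<integral>x. (vdm n x)\<^sup>2 \<partial>?B)"
  have \<mu>0: "\<mu> \<ge> 0" using \<mu> by simp
  \<comment> \<open>The total masses of the two Gaussian models are the constants of proportionality.\<close>
  have z1: "z1 > 0"
  proof -
    interpret product_sigma_finite "\<lambda>_::nat \<times> nat. wgauss 0"
      unfolding product_sigma_finite_def
      by (auto intro: finite_measure.axioms(1) finite_measure_wgauss)
    interpret W: finite_measure "wgauss 0" by (rule finite_measure_wgauss) simp
    have w: "measure (wgauss 0) UNIV > 0"
      using has_bochner_integral_integral_eq[OF wgauss_moment[of 0 0]] mom_0_pos[of 0] by simp
    have "emeasure ?A (space ?A) = (\<Prod>p\<in>hidx n. emeasure (wgauss 0) (space (wgauss 0)))"
      unfolding space_PiM by (rule emeasure_PiM) auto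
    also have "\<dots> = ennreal (\<Prod>p\<in>hidx n. measure (wgauss 0) UNIV)"
      by (simp add: W.emeasure_eq_measure ennreal_power)
    finally have "z1 = (\<Prod>p\<in>hidx n. measure (wgauss 0) UNIV)"
      unfolding z1_def measure_def using w by (simp add: enn2real_ennreal prod_nonneg less_imp_le)
    then show ?thesis using w by (simp add: prod_pos)
  qed
  note one = one_point_moment
  have z2: "z2 > 0"
  proof -
    have "real n * z2 = (\<integral>x. (\<Sum>i<n. x i ^ (2 * 0)) * (vdm n x)\<^sup>2 \<partial>?B)" by (simp add: z2_def)
    also have "\<dots> = fact n * (\<Prod>j<n. opoly_norm 0 j) * real n"
      using has_bochner_integral_integral_eq[OF one[of 0 n 0]] by simp
    finally have "z2 = fact n * (\<Prod>j<n. opoly_norm 0 j)" using n by simp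
    then show ?thesis using opoly_norm_pos[of 0] by (simp add: prod_pos)
  qed
  obtain fd where fd: "trace_poly fd" "\<And>u. complex_of_real (hdet n u) = fd (\<lambda>k. htr n k u)"
    "\<And>x. (\<Prod>i<n. complex_of_real (x i)) = fd (\<lambda>k. power_sum n k x)" using hdet_trace_poly by blast
  have htrR: "htr n (2 * k) u = complex_of_real (Re (htr n (2 * k) u))" "Re (htr n (2 * k) u) \<ge> 0" for k u
  proof -
    obtain U d where D: "is_diagonalization n (herm_of_coords n u) U d" by (rule obtain_eigenvalues)
    show "htr n (2 * k) u = complex_of_real (Re (htr n (2 * k) u))" "Re (htr n (2 * k) u) \<ge> 0"
      unfolding htr_eigenvalues[OF D] by (auto intro!: sum_nonneg)
  qed
  define C where "C = z1 / z2 * (fact n * (\<Prod>j<n. opoly_norm \<mu> j))"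
  have C: "C > 0" unfolding C_def using z1 z2 opoly_norm_pos[OF \<mu>0] by (simp add: prod_pos)
  have "matrix_moment n \<mu> k = ennreal (C * (\<Sum>j<n. jac \<mu> k j j))" for k
  proof -
    let ?h1 = "\<lambda>u. Re (htr n (2 * k) u)" and ?h2 = "\<lambda>x. (\<Sum>i<n. x i ^ (2 * k)) * (vdm n x)\<^sup>2"
    let ?D2 = "\<lambda>x. \<Prod>i<n. x i"
    let ?c = "2 * card {(i, j). i < j \<and> j < n}"
    have D2m [measurable]: "?D2 \<in> borel_measurable ?LB" by measurable
    have h2m [measurable]: "?h2 \<in> borel_measurable ?LB" by measurable
    have poly: "integrable ?A (\<lambda>u. ?h1 u * hdet n u ^ (2 * m))" "integrable ?B (\<lambda>x. (\<Sum>i<n. x i ^ (2 * k)) * ?D2 x ^ (2 * m) * (vdm n x)\<^sup>2)"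
      "z2 * (\<integral>u. ?h1 u * hdet n u ^ (2 * m) \<partial>?A) = z1 * (\<integral>x. (\<Sum>i<n. x i ^ (2 * k)) * ?D2 x ^ (2 * m) * (vdm n x)\<^sup>2 \<partial>?B)" for m
    proof -
      have tp: "trace_poly (\<lambda>t. t (2 * k) * fd t ^ (2 * m))" by (intro tp_mult tp_var trace_poly_power fd)
      have 1: "htr n (2 * k) u * fd (\<lambda>k. htr n k u) ^ (2 * m) = complex_of_real (?h1 u * hdet n u ^ (2 * m))" for u
        unfolding fd(2)[symmetric] using htrR(1)[of k u] by simp
      have 2: "power_sum n (2 * k) x * fd (\<lambda>k. power_sum n k x) ^ (2 * m) = complex_of_real ((\<Sum>i<n. x i ^ (2 * k)) * ?D2 x ^ (2 * m))" for x
        unfolding fd(3)[symmetric] by (simp add: power_sum_real)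
      from gauss_polynomial_transfer[OF tp 1 2]
      show "integrable ?A (\<lambda>u. ?h1 u * hdet n u ^ (2 * m))" "integrable ?B (\<lambda>x. (\<Sum>i<n. x i ^ (2 * k)) * ?D2 x ^ (2 * m) * (vdm n x)\<^sup>2)"
        "z2 * (\<integral>u. ?h1 u * hdet n u ^ (2 * m) \<partial>?A) = z1 * (\<integral>x. (\<Sum>i<n. x i ^ (2 * k)) * ?D2 x ^ (2 * m) * (vdm n x)\<^sup>2 \<partial>?B)"
        unfolding z1_def z2_def by blast+
    qed
    have n1: "(\<integral>\<^sup>+u. ennreal (?h1 u * hdet n u ^ (2 * m) * exp (- sqnorm (hidx n) u)) \<partial>(\<Pi>\<^sub>M p\<in>hidx n. lborel)) =
       ennreal (\<integral>u. ?h1 u * hdet n u ^ (2 * m) \<partial>?A)" for m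
    proof (rule nn_integral_PiM_wgauss_0[OF finite_hidx _ _ poly(1)])
      show "(\<lambda>u. ?h1 u * hdet n u ^ (2 * m)) \<in> borel_measurable (\<Pi>\<^sub>M p\<in>hidx n. lborel)" by measurable
      show "0 \<le> ?h1 u * hdet n u ^ (2 * m)" for u using htrR(2)[of k u] by (intro mult_nonneg_nonneg zero_le_even_power) auto
    qed
    have n2: "(\<integral>\<^sup>+x. ennreal (?h2 x * ?D2 x ^ (2 * m) * exp (- sqnorm {..<n} x)) \<partial>?LB) =
       ennreal (\<integral>x. (\<Sum>i<n. x i ^ (2 * k)) * ?D2 x ^ (2 * m) * (vdm n x)\<^sup>2 \<partial>?B)" for m
    proof -
      have "(\<integral>\<^sup>+x. ennreal ((\<Sum>i<n. x i ^ (2 * k)) * ?D2 x ^ (2 * m) * (vdm n x)\<^sup>2 * exp (- sqnorm {..<n} x)) \<partial>?LB) =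
         ennreal (\<integral>x. (\<Sum>i<n. x i ^ (2 * k)) * ?D2 x ^ (2 * m) * (vdm n x)\<^sup>2 \<partial>?B)"
      proof (rule nn_integral_PiM_wgauss_0[OF finite_lessThan _ _ poly(2)])
        show "(\<lambda>x. (\<Sum>i<n. x i ^ (2 * k)) * ?D2 x ^ (2 * m) * (vdm n x)\<^sup>2) \<in> borel_measurable ?LB" by measurable
        show "0 \<le> (\<Sum>i<n. x i ^ (2 * k)) * ?D2 x ^ (2 * m) * (vdm n x)\<^sup>2" for x :: "nat \<Rightarrow> real"
          by (intro mult_nonneg_nonneg zero_le_even_power sum_nonneg) auto
      qed
      then show ?thesis by (simp only: mult.assoc mult.commute[of "?D2 _ ^ _" "_\<^sup>2"])
    qed
    have "ennreal z2 * (\<integral>\<^sup>+u. ennreal (?h1 u * \<bar>hdet n u\<bar> powr (2 * \<mu>) * exp (- sqnorm (hidx n) u)) \<partial>(\<Pi>\<^sub>M p\<in>hidx n. lborel))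
       = ennreal z1 * (\<integral>\<^sup>+x. ennreal (?h2 x * \<bar>?D2 x\<bar> powr (2 * \<mu>) * exp (- sqnorm {..<n} x)) \<partial>?LB)"
    proof (rule homogeneous_weight_extension[where ?d1.0="real (2 * k)" and ?d2.0="real (2 * k + ?c)" and e=n])
      show "?h1 (\<lambda>i\<in>hidx n. r * u i) = r powr real (2 * k) * ?h1 u" if "r > 0" for r u
        using that by (simp add: htr_def hpow_scale powr_realpow sum_distrib_left del: of_real_power of_nat_mult)
      show "hdet n (\<lambda>i\<in>hidx n. r * u i) = r ^ n * hdet n u" for r u
        unfolding hdet_def herm_of_coords_scale by (simp add: det_smult del: of_real_power flip: of_real_power)
      show "?D2 (\<lambda>i\<in>{..<n}. r * u i) = r ^ n * ?D2 u" for r u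
        by (simp add: prod.distrib)
      show "?h2 (\<lambda>i\<in>{..<n}. r * u i) = r powr real (2 * k + ?c) * ?h2 u" if "r > 0" for r u
      proof -
        have "vdm n (\<lambda>i\<in>{..<n}. r * u i) = (\<Prod>(i, j)\<in>{(i, j). i < j \<and> j < n}. r * (u j - u i))"
          unfolding vdm_def by (intro prod.cong refl) (auto simp: right_diff_distrib)
        also have "\<dots> = r ^ card {(i, j). i < j \<and> j < n} * vdm n u"
          by (simp add: vdm_def case_prod_unfold prod.distrib)
        finally have v: "vdm n (\<lambda>i\<in>{..<n}. r * u i) = r ^ card {(i, j). i < j \<and> j < n} * vdm n u" .
        have "?h2 (\<lambda>i\<in>{..<n}. r * u i) = r ^ (2 * k + ?c) * ?h2 u"
          unfolding v by (simp add: power_mult_distrib sum_distrib_left power_add power_mult[symmetric] mult_ac)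
        then show ?thesis by (simp only: powr_realpow[OF that])
      qed
      show "\<bar>hdet n u\<bar> \<le> 1" if "sqnorm (hidx n) u \<le> 1" for u
      proof -
        obtain U d where D: "is_diagonalization n (herm_of_coords n u) U d" by (rule obtain_eigenvalues)
        show ?thesis using that abs_prod_le_1[of d n] unfolding hdet_eigenvalues(2)[OF D] sqnorm_eigenvalues[OF D] by simp
      qed
      show "\<bar>?D2 u\<bar> \<le> 1" if "sqnorm {..<n} u \<le> 1" for u
        using abs_prod_le_1[of u n] that by (simp add: sqnorm_def)
      show "real (card (hidx n)) + real (2 * k) = real (card {..<n}) + real (2 * k + ?c)"
        unfolding card_hidx two_card_pairs[symmetric] by simp
      show "(\<integral>\<^sup>+u. ennreal (?h1 u * exp (- sqnorm (hidx n) u)) \<partial>(\<Pi>\<^sub>M p\<in>hidx n. lborel)) < \<infinity>"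
        using n1[of 0] by simp
      show "(\<integral>\<^sup>+x. ennreal (?h2 x * exp (- sqnorm {..<n} x)) \<partial>?LB) < \<infinity>"
        using n2[of 0] by simp
      show "ennreal z2 * (\<integral>\<^sup>+u. ennreal (?h1 u * hdet n u ^ (2 * m) * exp (- sqnorm (hidx n) u)) \<partial>(\<Pi>\<^sub>M p\<in>hidx n. lborel))
        = ennreal z1 * (\<integral>\<^sup>+x. ennreal (?h2 x * ?D2 x ^ (2 * m) * exp (- sqnorm {..<n} x)) \<partial>?LB)" for m
        unfolding n1 n2 using arg_cong[OF poly(3)[of m], of ennreal] z1 z2
        by (simp add: ennreal_mult' less_imp_le)
    qed (use z1 z2 \<mu> htrR(2) in \<open>auto intro!: mult_nonneg_nonneg sum_nonneg\<close>)
    also have "(\<integral>\<^sup>+x. ennreal (?h2 x * \<bar>?D2 x\<bar> powr (2 * \<mu>) * exp (- sqnorm {..<n} x)) \<partial>?LB) = ennreal (fact n * (\<Prod>j<n. opoly_norm \<mu> j) * (\<Sum>j<n. jac \<mu> k j j))"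
      by (rule nn_integral_PiM_wgauss[OF finite_lessThan \<mu>0 h2m _ one[OF \<mu>0]]) (auto intro!: mult_nonneg_nonneg sum_nonneg)
    finally have e: "ennreal z2 * matrix_moment n \<mu> k = ennreal (z1 * (fact n * (\<Prod>j<n. opoly_norm \<mu> j) * (\<Sum>j<n. jac \<mu> k j j)))"
      unfolding matrix_moment_def using z1 by (simp add: ennreal_mult')
    have "z1 * (fact n * (\<Prod>j<n. opoly_norm \<mu> j) * (\<Sum>j<n. jac \<mu> k j j)) = z2 * (C * (\<Sum>j<n. jac \<mu> k j j))"
      using z2 by (simp add: C_def)
    then have "ennreal z2 * matrix_moment n \<mu> k = ennreal z2 * ennreal (C * (\<Sum>j<n. jac \<mu> k j j))"
      unfolding e by (simp only: ennreal_mult'[OF less_imp_le[OF z2]])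
    then show ?thesis using z2 by (subst (asm) ennreal_mult_cancel_left) auto
  qed
  then show ?thesis using C by blast
qed

section \<open>The mean eigenvalue distribution\<close>

text \<open>Some listing of the eigenvalues. Being chosen arbitrarily it need not be measurable; only symmetric
functions of the list are used, which do not depend on the choice.\<close>

definition eigs :: "complex mat \<Rightarrow> nat \<Rightarrow> real" where
  "eigs x = (SOME d. \<exists>U. is_diagonalization (dim_row x) x U d)"

lemma eigs_diagonalization:
  assumes "x \<in> herm n"
  shows "\<exists>U. is_diagonalization n x U (eigs x)"
proof -
  have "dim_row x = n" using assms by (auto simp: herm_def)
  moreover have "\<exists>d U. is_diagonalization n x U d" using hermitian_diagonalizable[OF assms] by blast
  ultimately show ?thesis unfolding eigs_def
    using someI_ex[of "\<lambda>d. \<exists>U. is_diagonalization n x U d"] by simp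
qed

lemma sum_eigs:
  assumes "x \<in> herm n"
  shows "(\<Sum>i<n. f (eigs x i)) = Re (tr (fun_calc f x))"
  using eigs_diagonalization[OF assms] tr_fun_calc[of n x _ "eigs x" f] by auto

lemma sum_eigs_diagonalization:
  fixes f :: "real \<Rightarrow> real"
  assumes D: "is_diagonalization n x U d" and x: "x \<in> herm n"
  shows "(\<Sum>i<n. f (eigs x i)) = (\<Sum>i<n. f (d i))"
  using sum_eigs[OF x, of f] tr_fun_calc[OF D, of f] by simp

lemma is_diagonalization_uminus:
  assumes D: "is_diagonalization n x U d"
  shows "is_diagonalization n (of_real (- 1) \<cdot>\<^sub>m x) U (\<lambda>i. - d i)"
proof -
  let ?D = "mat_diag n (\<lambda>i. complex_of_real (d i))"
  have c: "U \<in> carrier_mat n n" "mat_adjoint U \<in> carrier_mat n n" "?D \<in> carrier_mat n n" and U: "unitary n U"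
    and x: "x = U * ?D * mat_adjoint U"
    using D by (auto simp: unitary_def is_diagonalization_def)
  have "mat_diag n (\<lambda>i. complex_of_real (- d i)) = of_real (- 1) \<cdot>\<^sub>m ?D"
    by (rule eq_matI) (auto simp: mat_diag_def)
  then have "U * mat_diag n (\<lambda>i. complex_of_real (- d i)) * mat_adjoint U = of_real (- 1) \<cdot>\<^sub>m x"
    unfolding x using c by (simp add: mult_smult_distrib[of _ n n _ n] mult_smult_assoc_mat[of _ n n _ n])
  then show ?thesis using U by (simp add: is_diagonalization_def)
qed

text \<open>The inverse of \<open>herm_of_coords\<close>.\<close>

definition hcoords :: "nat \<Rightarrow> complex mat \<Rightarrow> nat \<times> nat \<Rightarrow> real" where
  "hcoords n x = (\<lambda>p\<in>hidx n. if fst p = snd p then Re (x $$ p)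
     else if fst p < snd p then sqrt 2 * Re (x $$ p) else sqrt 2 * Im (x $$ (snd p, fst p)))"

lemma herm_of_coords_hcoords:
  assumes x: "x \<in> herm n"
  shows "herm_of_coords n (hcoords n x) = x"
proof (rule eq_matI)
  have xc: "x \<in> carrier_mat n n" "mat_adjoint x = x" using x by (auto simp: herm_def)
  fix i j assume "i < dim_row x" "j < dim_col x"
  then have ij: "i < n" "j < n" using xc by auto
  have sym: "x $$ (i, j) = cnj (x $$ (j, i))" using adjoint_index[of i x j] xc ij by simp
  show "herm_of_coords n (hcoords n x) $$ (i, j) = x $$ (i, j)"
  proof (cases i j rule: linorder_cases)
    case less
    then show ?thesis using ij by (simp add: herm_of_coords_index hent_def hcoords_def hidx_def complex_eq_iff)
  next
    case equal
    then show ?thesis using ij sym by (simp add: herm_of_coords_index hent_def hcoords_def hidx_def complex_eq_iff)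
  next
    case greater
    then have "herm_of_coords n (hcoords n x) $$ (i, j) = cnj (x $$ (j, i))"
      using ij by (simp add: herm_of_coords_index hent_def hcoords_def hidx_def complex_eq_iff)
    then show ?thesis using sym by simp
  qed
qed (use x in \<open>auto simp: herm_def\<close>)

lemma space_herm_borel [simp]: "space (herm_borel n) = herm n"
  by (simp add: herm_borel_def)

lemma herm_entry_measurable:
  assumes "p \<in> hidx n"
  shows "(\<lambda>x. x $$ p) \<in> borel_measurable (herm_borel n)"
proof -
  have "(\<lambda>x. \<lambda>p\<in>{..<n} \<times> {..<n}. x $$ p) \<in> measurable (herm_borel n) (\<Pi>\<^sub>M p\<in>{..<n} \<times> {..<n}. borel :: complex measure)"
    unfolding herm_borel_def by (rule measurable_vimage_algebra1) (auto simp: space_PiM)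
  then have "(\<lambda>x. (\<lambda>p\<in>{..<n} \<times> {..<n}. x $$ p) p) \<in> borel_measurable (herm_borel n)"
    by (rule measurable_compose[OF _ measurable_component_singleton]) (use assms in \<open>simp add: hidx_def\<close>)
  then show ?thesis using assms by (simp add: hidx_def)
qed

lemma hcoords_measurable: "hcoords n \<in> measurable (herm_borel n) (\<Pi>\<^sub>M p\<in>hidx n. lborel)"
  unfolding hcoords_def
proof (rule measurable_restrict)
  fix p assume p: "p \<in> hidx n"
  then have [measurable]: "(\<lambda>x. x $$ p) \<in> borel_measurable (herm_borel n)" "(\<lambda>x. x $$ (snd p, fst p)) \<in> borel_measurable (herm_borel n)"
    by (auto intro!: herm_entry_measurable simp: hidx_def)
  show "(\<lambda>x. if fst p = snd p then Re (x $$ p)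
     else if fst p < snd p then sqrt 2 * Re (x $$ p) else sqrt 2 * Im (x $$ (snd p, fst p))) \<in> measurable (herm_borel n) lborel"
    by simp
qed

lemma herm_of_coords_measurable: "herm_of_coords n \<in> measurable (\<Pi>\<^sub>M p\<in>hidx n. lborel) (herm_borel n)"
  unfolding herm_borel_def
proof (rule measurable_vimage_algebra2)
  show "herm_of_coords n \<in> space (\<Pi>\<^sub>M p\<in>hidx n. lborel) \<rightarrow> herm n" by (simp add: herm_of_coords_herm)
  show "(\<lambda>x. \<lambda>p\<in>{..<n} \<times> {..<n}. herm_of_coords n x $$ p) \<in> measurable (\<Pi>\<^sub>M p\<in>hidx n. lborel) (\<Pi>\<^sub>M p\<in>{..<n} \<times> {..<n}. borel)"
  proof (rule measurable_restrict)
    fix p assume "p \<in> {..<n} \<times> {..<n}"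
    then obtain i j where p: "p = (i, j)" "i < n" "j < n" by auto
    have "hent i j \<in> borel_measurable (\<Pi>\<^sub>M p\<in>hidx n. lborel)"
      unfolding hidx_def by (rule pfun_measurable_lborel[OF pfun_hent[OF p(2,3)]])
    then show "(\<lambda>x. herm_of_coords n x $$ p) \<in> measurable (\<Pi>\<^sub>M p\<in>hidx n. lborel) borel"
      using p by (simp add: herm_of_coords_index)
  qed
qed

text \<open>Measurability on the space of Hermitian matrices can be checked in coordinates, since
\<open>hcoords\<close> is measurable and inverts \<open>herm_of_coords\<close>.\<close>

lemma herm_borel_measurableI:
  assumes "(\<lambda>u. g (herm_of_coords n u)) \<in> measurable (\<Pi>\<^sub>M p\<in>hidx n. lborel) N"
  shows "g \<in> measurable (herm_borel n) N"
proof -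
  have "(\<lambda>x. g (herm_of_coords n (hcoords n x))) \<in> measurable (herm_borel n) N"
    by (rule measurable_compose[OF hcoords_measurable assms])
  then show ?thesis
    by (rule measurable_cong[THEN iffD1, rotated]) (simp add: herm_of_coords_hcoords)
qed

text \<open>Power sums of the eigenvalues are traces of powers, hence polynomials in the coordinates. Limits extend
measurability to continuous functions and to indicators of half-lines in the next two lemmas.\<close>

lemma sum_eigs_power_measurable: "(\<lambda>x. \<Sum>i<n. eigs x i ^ k) \<in> borel_measurable (herm_borel n)"
proof (rule herm_borel_measurableI)
  have "(\<Sum>i<n. eigs (herm_of_coords n u) i ^ k) = Re (htr n k u)" for u
  proof -
    obtain U where "is_diagonalization n (herm_of_coords n u) U (eigs (herm_of_coords n u))"
      using eigs_diagonalization[OF herm_of_coords_herm] by blast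
    from htr_eigenvalues[OF this, of k] show ?thesis by simp
  qed
  then show "(\<lambda>u. \<Sum>i<n. eigs (herm_of_coords n u) i ^ k) \<in> borel_measurable (\<Pi>\<^sub>M p\<in>hidx n. lborel)"
    by simp
qed

lemma sum_eigs_continuous_measurable:
  fixes f :: "real \<Rightarrow> real"
  assumes f: "continuous_on UNIV f"
  shows "(\<lambda>x. \<Sum>i<n. f (eigs x i)) \<in> borel_measurable (herm_borel n)"
proof -
  have "\<exists>g. real_polynomial_function g \<and> (\<forall>t\<in>{- real m..real m}. \<bar>f t - g t\<bar> < 1 / real (Suc m))" for m
  proof -
    have "continuous_on {- real m..real m} f" by (rule continuous_on_subset[OF f]) simp
    from Stone_Weierstrass_real_polynomial_function[OF _ this, of "1 / real (Suc m)"]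
    obtain g where "real_polynomial_function g" "\<And>x. x \<in> {- real m..real m} \<Longrightarrow> \<bar>f x - g x\<bar> < 1 / real (Suc m)"
      by auto
    then show ?thesis by blast
  qed
  then obtain G where G: "\<And>m. real_polynomial_function (G m)"
    and Gf: "\<And>m t. t \<in> {- real m..real m} \<Longrightarrow> \<bar>f t - G m t\<bar> < 1 / real (Suc m)" by metis
  show ?thesis
  proof (rule borel_measurable_LIMSEQ_real)
    show "(\<lambda>x. \<Sum>i<n. G m (eigs x i)) \<in> borel_measurable (herm_borel n)" for m
    proof -
      obtain c d where g: "G m = (\<lambda>y. \<Sum>k\<le>d. c k * y ^ k)"
        using real_polynomial_function_imp_sum[OF G] by metis
      have "(\<Sum>i<n. G m (eigs x i)) = (\<Sum>k\<le>d. c k * (\<Sum>i<n. eigs x i ^ k))" for x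
        unfolding g sum_distrib_left by (rule sum.swap)
      then show ?thesis using sum_eigs_power_measurable by simp
    qed
    fix x
    have "(\<lambda>m. G m t) \<longlonglongrightarrow> f t" for t
    proof (rule Lim_transform_bound[of "\<lambda>m. G m t - f t" "\<lambda>m. 1 / real (Suc m)", THEN LIM_zero_cancel])
      show "eventually (\<lambda>m. norm (G m t - f t) \<le> norm (1 / real (Suc m))) sequentially"
        using eventually_ge_at_top[of "nat \<lceil>\<bar>t\<bar>\<rceil>"]
      proof eventually_elim
        case (elim m)
        then have "\<bar>t\<bar> \<le> real m" by linarith
        then show ?case using Gf[of t m] by (simp add: abs_minus_commute less_imp_le abs_le_iff)
      qed
      show "(\<lambda>m. 1 / real (Suc m)) \<longlonglongrightarrow> 0" by (rule LIMSEQ_Suc[OF lim_1_over_n])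
    qed
    then show "(\<lambda>m. \<Sum>i<n. G m (eigs x i)) \<longlonglongrightarrow> (\<Sum>i<n. f (eigs x i))"
      by (intro tendsto_sum)
  qed
qed

lemma sum_eigs_atMost_measurable: "(\<lambda>x. \<Sum>i<n. indicator {..a} (eigs x i) :: real) \<in> borel_measurable (herm_borel n)"
proof (rule borel_measurable_LIMSEQ_real)
  let ?f = "\<lambda>m t. max 0 (min 1 (1 - real m * (t - a)))"
  show "(\<lambda>x. \<Sum>i<n. ?f m (eigs x i)) \<in> borel_measurable (herm_borel n)" for m
    by (rule sum_eigs_continuous_measurable) (intro continuous_intros)
  fix x
  have "(\<lambda>m. ?f m t) \<longlonglongrightarrow> indicator {..a} t" for t
  proof (cases "t \<le> a")
    case True
    have "1 \<le> 1 - real m * (t - a)" for m using True by (simp add: mult_nonneg_nonpos)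
    then have "?f m t = 1" for m by (simp add: min_absorb1)
    then show ?thesis using True by simp
  next
    case False
    then have "eventually (\<lambda>m. real m > 1 / (t - a)) sequentially"
      using filterlim_real_sequentially by (simp add: filterlim_at_top_dense)
    then have "eventually (\<lambda>m. ?f m t = indicator {..a} t) sequentially"
    proof eventually_elim
      case (elim m)
      then have "1 < real m * (t - a)" using False by (simp add: field_simps)
      then show ?case using False by simp
    qed
    then show ?thesis by (rule tendsto_eventually)
  qed
  then show "(\<lambda>m. \<Sum>i<n. ?f m (eigs x i)) \<longlonglongrightarrow> (\<Sum>i<n. indicator {..a} (eigs x i))"
    by (intro tendsto_sum)
qed

text \<open>The uniform distribution on the spectrum, with multiplicities. Mixing it over the ensemble gives the
mean eigenvalue distribution directly as a measure.\<close>

definition eigen_kernel :: "nat \<Rightarrow> complex mat \<Rightarrow> real measure" where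
  "eigen_kernel n x = distr (uniform_count_measure {..<n}) borel (eigs x)"

lemma sets_eigen_kernel [simp]: "sets (eigen_kernel n x) = sets borel"
  by (simp add: eigen_kernel_def)

lemma nn_integral_eigen_kernel:
  assumes n: "n \<ge> 1" and f: "f \<in> borel_measurable borel" and pos: "\<And>t. f t \<ge> 0"
  shows "(\<integral>\<^sup>+t. ennreal (f t) \<partial>eigen_kernel n x) = ennreal (1 / real n * (\<Sum>i<n. f (eigs x i)))"
proof -
  have "(\<integral>\<^sup>+t. ennreal (f t) \<partial>eigen_kernel n x) = (\<integral>\<^sup>+i. ennreal (f (eigs x i)) \<partial>uniform_count_measure {..<n})"
    unfolding eigen_kernel_def by (rule nn_integral_distr) (use f in \<open>simp_all add: measurable_def[of "uniform_count_measure _"] sets_uniform_count_measure space_uniform_count_measure\<close>)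
  also have "\<dots> = (\<Sum>i<n. ennreal (1 / real n) * ennreal (f (eigs x i)))"
    unfolding uniform_count_measure_def by (subst nn_integral_point_measure_finite) auto
  also have "\<dots> = ennreal (1 / real n * (\<Sum>i<n. f (eigs x i)))"
    by (simp add: ennreal_mult''[symmetric] pos sum_ennreal sum_distrib_left)
  finally show ?thesis .
qed

lemma integral_eigen_kernel:
  assumes f: "f \<in> borel_measurable borel"
  shows "(\<integral>t. f t \<partial>eigen_kernel n x) = 1 / real n * (\<Sum>i<n. f (eigs x i))"
proof -
  have "(\<integral>t. f t \<partial>eigen_kernel n x) = (\<integral>i. f (eigs x i) \<partial>uniform_count_measure {..<n})"
    unfolding eigen_kernel_def by (rule integral_distr) (use f in \<open>auto simp: measurable_def sets_uniform_count_measure space_uniform_count_measure\<close>)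
  then show ?thesis by (simp add: integral_uniform_count_measure)
qed

lemma emeasure_eigen_kernel:
  assumes n: "n \<ge> 1" and A: "A \<in> sets borel"
  shows "emeasure (eigen_kernel n x) A = ennreal (1 / real n * (\<Sum>i<n. indicator A (eigs x i)))"
proof -
  have "emeasure (eigen_kernel n x) A = (\<integral>\<^sup>+t. ennreal (indicator A t) \<partial>eigen_kernel n x)"
    using A by (simp add: ennreal_indicator)
  also have "\<dots> = ennreal (1 / real n * (\<Sum>i<n. indicator A (eigs x i)))"
    by (rule nn_integral_eigen_kernel[OF n]) (use A in auto)
  finally show ?thesis .
qed

lemma prob_space_eigen_kernel: "n \<ge> 1 \<Longrightarrow> prob_space (eigen_kernel n x)"
  by (rule prob_spaceI) (simp add: sets_eq_imp_space_eq[OF sets_eigen_kernel] emeasure_eigen_kernel)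

text \<open>Half-lines generate the Borel sets and are stable under intersection.\<close>

lemma eigen_kernel_measurable:
  assumes n: "n \<ge> 1"
  shows "eigen_kernel n \<in> measurable (herm_borel n) (subprob_algebra borel)"
proof (rule measurable_subprob_algebra_generated[where \<Omega>=UNIV and G="range atMost"])
  show "sets (borel :: real measure) = sigma_sets UNIV (range atMost)"
    unfolding borel_eq_atMost by simp
  show "Int_stable (range (atMost :: real \<Rightarrow> real set))"
    unfolding Int_stable_def by (auto intro!: image_eqI[where x="min _ _"])
  show "subprob_space (eigen_kernel n a)" for a
    using prob_space_eigen_kernel[OF n] by (rule prob_space_imp_subprob_space)
  show "(\<lambda>a. emeasure (eigen_kernel n a) A) \<in> borel_measurable (herm_borel n)" if "A \<in> range atMost" for A
  proof -
    obtain b where A: "A = {..b}" using \<open>A \<in> range atMost\<close> by blast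
    have [measurable]: "(\<lambda>x. \<Sum>i<n. indicator {..b} (eigs x i) :: real) \<in> borel_measurable (herm_borel n)"
      by (rule sum_eigs_atMost_measurable)
    have e: "emeasure (eigen_kernel n x) A = ennreal (1 / real n * (\<Sum>i<n. indicator {..b} (eigs x i)))" for x
      unfolding A by (rule emeasure_eigen_kernel[OF n]) simp
    show ?thesis unfolding e by measurable
  qed
  show "(\<lambda>a. emeasure (eigen_kernel n a) UNIV) \<in> borel_measurable (herm_borel n)"
    by (simp add: emeasure_eigen_kernel[OF n])
qed auto

text \<open>The unnormalized density in coordinates.\<close>

definition hweight :: "nat \<Rightarrow> real \<Rightarrow> (nat \<times> nat \<Rightarrow> real) \<Rightarrow> real" where
  "hweight n \<mu> u = \<bar>hdet n u\<bar> powr (2 * \<mu>) * exp (- sqnorm (hidx n) u)"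

lemma hweight_measurable [measurable]: "hweight n \<mu> \<in> borel_measurable (\<Pi>\<^sub>M p\<in>hidx n. lborel)"
  unfolding hweight_def[abs_def] by measurable

lemma hweight_nonneg: "hweight n \<mu> u \<ge> 0"
  by (simp add: hweight_def)

lemma weight_herm_of_coords: "weight \<mu> (herm_of_coords n u) = hweight n \<mu> u"
proof -
  obtain U d where D: "is_diagonalization n (herm_of_coords n u) U d" by (rule obtain_eigenvalues)
  show ?thesis
    unfolding weight_def hweight_def hdet_eigenvalues(1)[OF D] tr_square_coords by simp
qed

lemma weight_measurable: "weight \<mu> \<in> borel_measurable (herm_borel n)"
  by (rule herm_borel_measurableI) (simp add: weight_herm_of_coords)

lemma sum_eigs_uminus:
  fixes f :: "real \<Rightarrow> real"
  shows
  "(\<Sum>i<n. f (eigs (herm_of_coords n (\<lambda>p\<in>hidx n. (- 1) * u p)) i)) = (\<Sum>i<n. f (- eigs (herm_of_coords n u) i))"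
proof -
  obtain U where D: "is_diagonalization n (herm_of_coords n u) U (eigs (herm_of_coords n u))"
    using eigs_diagonalization[OF herm_of_coords_herm] by blast
  have "is_diagonalization n (herm_of_coords n (\<lambda>p\<in>hidx n. (- 1) * u p)) U (\<lambda>i. - eigs (herm_of_coords n u) i)"
    unfolding herm_of_coords_scale by (rule is_diagonalization_uminus[OF D])
  from sum_eigs_diagonalization[OF this herm_of_coords_herm] show ?thesis .
qed

lemma hweight_uminus: "hweight n \<mu> (\<lambda>p\<in>hidx n. (- 1) * u p) = hweight n \<mu> u"
proof -
  have "\<bar>hdet n (\<lambda>p\<in>hidx n. (- 1) * u p)\<bar> = \<bar>hdet n u\<bar>"
    unfolding hdet_def herm_of_coords_scale by (cases "even n") (simp_all add: det_smult)
  moreover have "sqnorm (hidx n) (\<lambda>p\<in>hidx n. (- 1) * u p) = sqnorm (hidx n) u" by (simp add: sqnorm_def)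
  ultimately show ?thesis by (simp only: hweight_def)
qed

context
  fixes n :: nat and \<mu> :: real
  assumes n: "n \<ge> 1" and \<mu>: "\<mu> > 0"
begin

lemma jac_0_sum: "(\<Sum>j<n. jac \<mu> 0 j j) = real n" by simp

lemma hweight_integral:
  obtains C where "C > 0" "(\<integral>\<^sup>+u. ennreal (hweight n \<mu> u) \<partial>(\<Pi>\<^sub>M p\<in>hidx n. lborel)) = ennreal C"
    "norm_const n \<mu> = C" "\<And>k. matrix_moment n \<mu> k = ennreal (C * (\<Sum>j<n. jac \<mu> k j j))"
proof -
  obtain C where C: "C > 0" and m: "\<And>k. matrix_moment n \<mu> k = ennreal (C * (\<Sum>j<n. jac \<mu> k j j))"
    using matrix_moment_formula[OF n \<mu>] by blast
  let ?W = "\<integral>\<^sup>+u. ennreal (hweight n \<mu> u) \<partial>(\<Pi>\<^sub>M p\<in>hidx n. lborel)"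
  have "matrix_moment n \<mu> 0 = (\<integral>\<^sup>+u. ennreal (real n) * ennreal (hweight n \<mu> u) \<partial>(\<Pi>\<^sub>M p\<in>hidx n. lborel))"
    unfolding matrix_moment_def hweight_def
    by (intro nn_integral_cong) (simp add: htr_def ennreal_mult[symmetric] mult.assoc)
  also have "\<dots> = ennreal (real n) * ?W" by (rule nn_integral_cmult) measurable
  finally have "ennreal (real n) * ?W = ennreal (real n) * ennreal C"
    unfolding m jac_0_sum using C by (simp add: ennreal_mult[symmetric] mult.commute)
  then have W: "?W = ennreal C" using n by (subst (asm) ennreal_mult_cancel_left) auto
  have "norm_const n \<mu> = (\<integral>u. weight \<mu> (herm_of_coords n u) \<partial>(\<Pi>\<^sub>M p\<in>hidx n. lborel))"
    unfolding norm_const_def herm_lebesgue_def hidx_def[symmetric]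
    by (rule integral_distr[OF herm_of_coords_measurable weight_measurable])
  also have "\<dots> = enn2real ?W"
    unfolding weight_herm_of_coords by (rule integral_eq_nn_integral) (auto simp: hweight_nonneg)
  also have "\<dots> = C" using C by (simp add: W)
  finally have "norm_const n \<mu> = C" .
  then show ?thesis using that C W m by blast
qed

lemma nn_integral_ensemble:
  assumes g: "g \<in> borel_measurable (herm_borel n)"
  shows "(\<integral>\<^sup>+x. g x \<partial>ensemble n \<mu>) =
    (\<integral>\<^sup>+u. ennreal (1 / norm_const n \<mu> * hweight n \<mu> u) * g (herm_of_coords n u) \<partial>(\<Pi>\<^sub>M p\<in>hidx n. lborel))"
proof -
  have s: "sets (herm_lebesgue n) = sets (herm_borel n)" by (simp add: herm_lebesgue_def)
  have wm: "(\<lambda>x. ennreal (1 / norm_const n \<mu> * weight \<mu> x)) \<in> borel_measurable (herm_borel n)"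
    using weight_measurable by measurable
  have "(\<integral>\<^sup>+x. g x \<partial>ensemble n \<mu>) = (\<integral>\<^sup>+x. ennreal (1 / norm_const n \<mu> * weight \<mu> x) * g x \<partial>herm_lebesgue n)"
    unfolding ensemble_def by (rule nn_integral_density) (use wm g s in \<open>simp_all cong: measurable_cong_sets\<close>)
  also have "\<dots> = (\<integral>\<^sup>+u. ennreal (1 / norm_const n \<mu> * weight \<mu> (herm_of_coords n u)) * g (herm_of_coords n u) \<partial>(\<Pi>\<^sub>M p\<in>hidx n. lborel))"
    unfolding herm_lebesgue_def hidx_def[symmetric]
    by (rule nn_integral_distr[OF herm_of_coords_measurable]) (use wm g in measurable)
  finally show ?thesis by (simp only: weight_herm_of_coords)
qed

lemma sets_ensemble: "sets (ensemble n \<mu>) = sets (herm_borel n)" "space (ensemble n \<mu>) = herm n"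
  by (simp_all add: ensemble_def herm_lebesgue_def)

lemma prob_space_ensemble: "prob_space (ensemble n \<mu>)"
proof (rule prob_spaceI)
  obtain C where C: "C > 0" "(\<integral>\<^sup>+u. ennreal (hweight n \<mu> u) \<partial>(\<Pi>\<^sub>M p\<in>hidx n. lborel)) = ennreal C" "norm_const n \<mu> = C"
    by (rule hweight_integral)
  have "emeasure (ensemble n \<mu>) (space (ensemble n \<mu>)) = (\<integral>\<^sup>+x. 1 \<partial>ensemble n \<mu>)" by simp
  also have "\<dots> = (\<integral>\<^sup>+u. ennreal (1 / C * hweight n \<mu> u) * 1 \<partial>(\<Pi>\<^sub>M p\<in>hidx n. lborel))"
    unfolding C(3)[symmetric] by (rule nn_integral_ensemble) simp
  also have "\<dots> = (\<integral>\<^sup>+u. ennreal (1 / C) * ennreal (hweight n \<mu> u) \<partial>(\<Pi>\<^sub>M p\<in>hidx n. lborel))"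
    using C(1) by (simp add: ennreal_mult'[symmetric])
  also have "\<dots> = ennreal (1 / C) * ennreal C" unfolding C(2)[symmetric] by (rule nn_integral_cmult) measurable
  also have "\<dots> = 1" using C(1) by (simp add: ennreal_mult''[symmetric])
  finally show "emeasure (ensemble n \<mu>) (space (ensemble n \<mu>)) = 1" .
qed

definition eigen_distr :: "real measure" where
  "eigen_distr = ensemble n \<mu> \<bind> eigen_kernel n"

lemma kernel_ensemble_measurable: "eigen_kernel n \<in> measurable (ensemble n \<mu>) (subprob_algebra borel)"
  using eigen_kernel_measurable[OF n] sets_ensemble(1) by (simp cong: measurable_cong_sets)

lemma sets_eigen_distr: "sets eigen_distr = sets borel"
  unfolding eigen_distr_def
  by (rule sets_bind) (use prob_space.not_empty[OF prob_space_ensemble] in auto)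

lemma prob_space_eigen_distr: "prob_space eigen_distr"
  unfolding eigen_distr_def
  by (rule prob_space.prob_space_bind[OF prob_space_ensemble _ kernel_ensemble_measurable])
     (simp add: prob_space_eigen_kernel[OF n])

lemma eigen_distr_statistical: "is_statistical_distribution n \<mu> eigen_distr"
  unfolding is_statistical_distribution_def
proof (intro conjI ballI impI)
  fix f :: "real \<Rightarrow> real" assume f: "f \<in> borel_measurable borel" and "bounded (range f)"
  then obtain B where B: "\<And>t. \<bar>f t\<bar> \<le> B" by (auto simp: bounded_iff)
  have "(\<integral>t. f t \<partial>eigen_distr) = (\<integral>x. (\<integral>t. f t \<partial>eigen_kernel n x) \<partial>ensemble n \<mu>)"
    unfolding eigen_distr_def
  proof (rule integral_bind[OF f B kernel_ensemble_measurable])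
    show "finite_measure (ensemble n \<mu>)" using prob_space_ensemble by (rule prob_space.finite_measure)
    show "AE x in ensemble n \<mu>. emeasure (eigen_kernel n x) (space (eigen_kernel n x)) \<le> ennreal 1"
      using prob_space.emeasure_space_1[OF prob_space_eigen_kernel[OF n]] by simp
  qed
  also have "\<dots> = (\<integral>x. 1 / real n * Re (tr (fun_calc f x)) \<partial>ensemble n \<mu>)"
    by (rule Bochner_Integration.integral_cong[OF refl])
       (simp add: integral_eigen_kernel[OF f] sum_eigs sets_ensemble)
  finally show "(\<integral>t. f t \<partial>eigen_distr) = (\<integral>x. 1 / real n * Re (tr (fun_calc f x)) \<partial>ensemble n \<mu>)" .
qed (simp_all add: prob_space_eigen_distr sets_eigen_distr)

text \<open>The defining property, tested on indicator functions, determines the measure.\<close>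

lemma statistical_distribution_eq: "statistical_distribution n \<mu> = eigen_distr"
  unfolding statistical_distribution_def
proof (rule the_equality)
  show "is_statistical_distribution n \<mu> eigen_distr" by (rule eigen_distr_statistical)
  fix N assume N: "is_statistical_distribution n \<mu> N"
  show "N = eigen_distr"
  proof (rule measure_eqI)
    show s: "sets N = sets eigen_distr" using N by (simp add: is_statistical_distribution_def sets_eigen_distr)
    fix A assume "A \<in> sets N"
    then have A: "A \<in> sets borel" using s by (simp add: sets_eigen_distr)
    then have i: "indicator A \<in> borel_measurable borel" "bounded (range (indicator A :: real \<Rightarrow> real))"
      by (auto simp: bounded_iff indicator_def intro!: exI[of _ 1])
    have "(\<integral>t. indicator A t \<partial>N) = (\<integral>t. (indicator A t :: real) \<partial>eigen_distr)"
      using N eigen_distr_statistical i unfolding is_statistical_distribution_def by metis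
    then have e: "measure N A = measure eigen_distr A"
      using A \<open>A \<in> sets N\<close> s sets.sets_into_space by (simp add: sets_eq_imp_space_eq[OF s] Int_absorb2 sets_eigen_distr)
    interpret N: prob_space N using N by (simp add: is_statistical_distribution_def)
    interpret E: prob_space eigen_distr by (rule prob_space_eigen_distr)
    show "emeasure N A = emeasure eigen_distr A"
      by (simp add: e N.emeasure_eq_measure E.emeasure_eq_measure)
  qed
qed

lemma nn_integral_eigen_distr:
  assumes f: "f \<in> borel_measurable borel" and pos: "\<And>t. f t \<ge> 0"
  shows "(\<integral>\<^sup>+t. ennreal (f t) \<partial>eigen_distr) =
    (\<integral>\<^sup>+u. ennreal (1 / norm_const n \<mu> * hweight n \<mu> u) *
      ennreal (1 / real n * (\<Sum>i<n. f (eigs (herm_of_coords n u) i))) \<partial>(\<Pi>\<^sub>M p\<in>hidx n. lborel))"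
proof -
  have m: "(\<lambda>x. \<integral>\<^sup>+t. ennreal (f t) \<partial>eigen_kernel n x) \<in> borel_measurable (herm_borel n)"
    using nn_integral_measurable_subprob_algebra2[of "\<lambda>_ t. ennreal (f t)" "herm_borel n" borel "eigen_kernel n"] f eigen_kernel_measurable[OF n]
    by simp
  have "(\<integral>\<^sup>+t. ennreal (f t) \<partial>eigen_distr) = (\<integral>\<^sup>+x. (\<integral>\<^sup>+t. ennreal (f t) \<partial>eigen_kernel n x) \<partial>ensemble n \<mu>)"
    unfolding eigen_distr_def by (rule nn_integral_bind[OF _ kernel_ensemble_measurable]) (use f in measurable)
  also have "\<dots> = (\<integral>\<^sup>+u. ennreal (1 / norm_const n \<mu> * hweight n \<mu> u) *
      (\<integral>\<^sup>+t. ennreal (f t) \<partial>eigen_kernel n (herm_of_coords n u)) \<partial>(\<Pi>\<^sub>M p\<in>hidx n. lborel))"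
    by (rule nn_integral_ensemble[OF m])
  finally show ?thesis unfolding nn_integral_eigen_kernel[OF n f pos] .
qed

lemma eigen_distr_moment:
  "has_bochner_integral eigen_distr (\<lambda>t. t ^ (2 * k)) (1 / real n * (\<Sum>j<n. jac \<mu> k j j))"
proof -
  obtain C where C: "C > 0" "norm_const n \<mu> = C" "\<And>k. matrix_moment n \<mu> k = ennreal (C * (\<Sum>j<n. jac \<mu> k j j))"
    using hweight_integral by metis
  have e: "Re (htr n (2 * k) u) = (\<Sum>i<n. eigs (herm_of_coords n u) i ^ (2 * k))" for u
  proof -
    obtain U where "is_diagonalization n (herm_of_coords n u) U (eigs (herm_of_coords n u))"
      using eigs_diagonalization[OF herm_of_coords_herm] by blast
    from htr_eigenvalues[OF this] show ?thesis by simp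
  qed
  have "(\<integral>\<^sup>+t. ennreal (t ^ (2 * k)) \<partial>eigen_distr) = (\<integral>\<^sup>+u. ennreal (1 / C * hweight n \<mu> u) *
      ennreal (1 / real n * (\<Sum>i<n. eigs (herm_of_coords n u) i ^ (2 * k))) \<partial>(\<Pi>\<^sub>M p\<in>hidx n. lborel))"
    unfolding C(2)[symmetric] by (rule nn_integral_eigen_distr) auto
  also have "\<dots> = (\<integral>\<^sup>+u. ennreal (1 / (C * real n)) * ennreal (Re (htr n (2 * k) u) * \<bar>hdet n u\<bar> powr (2 * \<mu>) * exp (- sqnorm (hidx n) u)) \<partial>(\<Pi>\<^sub>M p\<in>hidx n. lborel))"
    unfolding e[symmetric]
  proof (rule nn_integral_cong)
    fix u
    have "ennreal (1 / C * hweight n \<mu> u) * ennreal (1 / real n * Re (htr n (2 * k) u))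
        = ennreal ((1 / C * hweight n \<mu> u) * (1 / real n * Re (htr n (2 * k) u)))"
      by (rule ennreal_mult'[symmetric]) (use C(1) hweight_nonneg in simp)
    also have "(1 / C * hweight n \<mu> u) * (1 / real n * Re (htr n (2 * k) u))
        = 1 / (C * real n) * (Re (htr n (2 * k) u) * \<bar>hdet n u\<bar> powr (2 * \<mu>) * exp (- sqnorm (hidx n) u))"
      by (simp add: hweight_def)
    also have "ennreal \<dots> = ennreal (1 / (C * real n)) * ennreal (Re (htr n (2 * k) u) * \<bar>hdet n u\<bar> powr (2 * \<mu>) * exp (- sqnorm (hidx n) u))"
      by (rule ennreal_mult') (use C(1) in simp)
    finally show "ennreal (1 / C * hweight n \<mu> u) * ennreal (1 / real n * Re (htr n (2 * k) u)) =
        ennreal (1 / (C * real n)) * ennreal (Re (htr n (2 * k) u) * \<bar>hdet n u\<bar> powr (2 * \<mu>) * exp (- sqnorm (hidx n) u))" .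
  qed
  also have "\<dots> = ennreal (1 / (C * real n)) * matrix_moment n \<mu> k"
    unfolding matrix_moment_def by (rule nn_integral_cmult) measurable
  also have "\<dots> = ennreal (1 / real n * (\<Sum>j<n. jac \<mu> k j j))"
    unfolding C(3) using C(1) by (simp add: ennreal_mult'[symmetric])
  finally have nn: "(\<integral>\<^sup>+t. ennreal (t ^ (2 * k)) \<partial>eigen_distr) = ennreal (1 / real n * (\<Sum>j<n. jac \<mu> k j j))" .
  have "0 \<le> (\<Sum>j<n. jac \<mu> k j j)" by (rule sum_jac_diag_nonneg) (use \<mu> in simp)
  then show ?thesis
    by (intro has_bochner_integral_nn_integral nn) (auto simp: sets_eigen_distr cong: measurable_cong_sets)
qed

text \<open>The map \<open>X \<mapsto> -X\<close> preserves the ensemble and negates the eigenvalues.\<close>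

lemma eigen_distr_symmetric:
  fixes f :: "real \<Rightarrow> real"
  assumes f: "f \<in> borel_measurable borel"
  shows "(\<integral>t. f (- t) \<partial>eigen_distr) = (\<integral>t. f t \<partial>eigen_distr)"
proof -
  note [measurable_cong] = sets_eigen_distr
  have nn: "(\<integral>\<^sup>+t. ennreal (g (- t)) \<partial>eigen_distr) = (\<integral>\<^sup>+t. ennreal (g t) \<partial>eigen_distr)"
    if g [measurable]: "g \<in> borel_measurable borel" and pos: "\<And>t. g t \<ge> 0" for g
  proof -
    let ?F = "\<lambda>u. ennreal (1 / norm_const n \<mu> * hweight n \<mu> u) * ennreal (1 / real n * (\<Sum>i<n. g (eigs (herm_of_coords n u) i)))"
    have m: "?F \<in> borel_measurable (\<Pi>\<^sub>M p\<in>hidx n. lborel)"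
    proof -
      have "(\<lambda>x. \<integral>\<^sup>+t. ennreal (g t) \<partial>eigen_kernel n x) \<in> borel_measurable (herm_borel n)"
        using nn_integral_measurable_subprob_algebra2[of "\<lambda>_ t. ennreal (g t)" "herm_borel n" borel "eigen_kernel n"] g eigen_kernel_measurable[OF n]
        by simp
      then have [measurable]: "(\<lambda>u. \<integral>\<^sup>+t. ennreal (g t) \<partial>eigen_kernel n (herm_of_coords n u)) \<in> borel_measurable (\<Pi>\<^sub>M p\<in>hidx n. lborel)"
        by (rule measurable_compose[OF herm_of_coords_measurable])
      show ?thesis unfolding nn_integral_eigen_kernel[OF n g pos, symmetric] by measurable
    qed
    have "(\<integral>\<^sup>+t. ennreal (g t) \<partial>eigen_distr) = (\<integral>\<^sup>+u. ?F u \<partial>(\<Pi>\<^sub>M p\<in>hidx n. lborel))"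
      by (rule nn_integral_eigen_distr[OF g pos])
    also have "\<dots> = ennreal (\<bar>- 1\<bar> ^ card (hidx n)) * (\<integral>\<^sup>+u. ?F (\<lambda>p\<in>hidx n. (- 1) * u p) \<partial>(\<Pi>\<^sub>M p\<in>hidx n. lborel))"
      by (rule nn_integral_PiM_lborel_scale[OF finite_hidx _ m]) simp
    also have "\<dots> = (\<integral>\<^sup>+u. ennreal (1 / norm_const n \<mu> * hweight n \<mu> u) * ennreal (1 / real n * (\<Sum>i<n. g (- eigs (herm_of_coords n u) i))) \<partial>(\<Pi>\<^sub>M p\<in>hidx n. lborel))"
      unfolding hweight_uminus sum_eigs_uminus by simp
    also have "\<dots> = (\<integral>\<^sup>+t. ennreal (g (- t)) \<partial>eigen_distr)"
      by (rule nn_integral_eigen_distr[symmetric]) (use pos in auto)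
    finally show ?thesis ..
  qed
  have "distr eigen_distr borel uminus = eigen_distr"
  proof (rule measure_eqI)
    show "sets (distr eigen_distr borel uminus) = sets eigen_distr" by (simp add: sets_eigen_distr)
    fix A assume "A \<in> sets (distr eigen_distr borel uminus)"
    then have A [measurable]: "A \<in> sets borel" by simp
    have "emeasure (distr eigen_distr borel uminus) A = (\<integral>\<^sup>+t. indicator A t \<partial>distr eigen_distr borel uminus)" by simp
    also have "\<dots> = (\<integral>\<^sup>+t. indicator A (- t) \<partial>eigen_distr)" by (rule nn_integral_distr) auto
    also have "\<dots> = (\<integral>\<^sup>+t. indicator A t \<partial>eigen_distr)"
      using nn[of "indicator A"] by (simp add: ennreal_indicator)
    also have "\<dots> = emeasure eigen_distr A" by (simp add: sets_eigen_distr)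
    finally show "emeasure (distr eigen_distr borel uminus) A = emeasure eigen_distr A" .
  qed
  then have "(\<integral>t. f t \<partial>eigen_distr) = (\<integral>t. f t \<partial>distr eigen_distr borel uminus)" by simp
  also have "\<dots> = (\<integral>t. f (- t) \<partial>eigen_distr)" by (rule integral_distr) (use f in auto)
  finally show ?thesis ..
qed

end

section \<open>Convergence to the limit measure\<close>

lemma sets_limit_measure [simp]: "sets (limit_measure c) = sets borel" "space (limit_measure c) = UNIV"
  by (simp_all add: limit_measure_def)

lemma limit_density_measurable [measurable]: "(\<lambda>t. indicator (limit_support c) t * limit_density c t) \<in> borel_measurable borel"
  unfolding limit_support_def limit_density_def by simp

text \<open>The total mass is the moment of order zero, and for \<open>k = 0\<close> the limit of the averages is the integral of \<open>1\<close>
over \<open>[0, 1)\<close>.\<close>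

lemma prob_space_limit_measure:
  assumes c: "c \<ge> 0"
  shows "prob_space (limit_measure c)"
proof (rule prob_spaceI)
  have "1 / pi * integral {0..pi} (limit_integrand c 0) = (\<integral>s. indicator {0..<1::real} s \<partial>lborel)"
    using lim_jac_average[OF c, of 0] by simp
  then have v: "1 / pi * integral {0..pi} (limit_integrand c 0) = 1" by simp
  have h: "has_bochner_integral (limit_measure c) (\<lambda>t. 1) (1 :: real)"
    using limit_measure_moment[OF c, of 0] unfolding v by simp
  have "emeasure (limit_measure c) (space (limit_measure c)) = (\<integral>\<^sup>+t. ennreal 1 \<partial>limit_measure c)" by simp
  also have "\<dots> = ennreal 1"
    using h by (subst nn_integral_eq_integral) (auto simp: has_bochner_integral_iff)
  finally show "emeasure (limit_measure c) (space (limit_measure c)) = 1" by simp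
qed

lemma limit_measure_AE_support: "AE t in limit_measure c. t \<in> limit_support c"
proof -
  have m: "(\<lambda>t. ennreal (indicator (limit_support c) t * limit_density c t)) \<in> borel_measurable lborel" by measurable
  show ?thesis unfolding limit_measure_def AE_density[OF m] by (auto simp: indicator_def)
qed

lemma limit_measure_symmetric:
  fixes f :: "real \<Rightarrow> real"
  assumes f [measurable]: "f \<in> borel_measurable borel"
  shows "(\<integral>t. f (- t) \<partial>limit_measure c) = (\<integral>t. f t \<partial>limit_measure c)"
proof -
  let ?d = "\<lambda>t. indicator (limit_support c) t * limit_density c t"
  have ev: "?d (- t) = ?d t" for t by (auto simp: limit_support_def limit_density_def indicator_def)
  let ?p = "\<lambda>t. enn2real (ennreal (?d t))"
  have pm [measurable]: "?p \<in> borel_measurable borel" by measurable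
  have L: "(\<integral>t. g t \<partial>limit_measure c) = (\<integral>t. ?p t * g t \<partial>lborel)" if [measurable]: "g \<in> borel_measurable borel" for g :: "real \<Rightarrow> real"
  proof -
    have "limit_measure c = density lborel (\<lambda>t. ennreal (?p t))"
      unfolding limit_measure_def by (rule density_cong) (use limit_density_measurable[of c] in auto)
    moreover have "(\<integral>t. g t \<partial>density lborel (\<lambda>t. ennreal (?p t))) = (\<integral>t. ?p t * g t \<partial>lborel)"
      by (rule integral_real_density) (use that pm in auto)
    ultimately show ?thesis by simp
  qed
  have "(\<integral>t. ?p t * f t \<partial>lborel) = \<bar>- 1\<bar> *\<^sub>R (\<integral>t. ?p (0 + (- 1) * t) * f (0 + (- 1) * t) \<partial>lborel)"
    by (rule lborel_integral_real_affine) simp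
  then have "(\<integral>t. ?p t * f t \<partial>lborel) = (\<integral>t. ?p t * f (- t) \<partial>lborel)" by (simp add: ev)
  then show ?thesis by (simp add: L)
qed

theorem theorem2p1:
  fixes \<mu> :: "nat \<Rightarrow> real" and c :: real
  assumes pos: "\<And>n. n \<ge> 1 \<Longrightarrow> \<mu> n > 0"
    and lim: "(\<lambda>n. \<mu> n / real n) \<longlonglongrightarrow> c"
    and c: "c \<ge> 0"
  shows "(\<forall>n\<ge>1. is_statistical_distribution n (\<mu> n) (statistical_distribution n (\<mu> n))) \<and>
    (\<forall>\<phi> :: real \<Rightarrow> real. continuous_on UNIV \<phi> \<longrightarrow> bounded (range \<phi>) \<longrightarrow>
       (\<lambda>n. \<integral>u. \<phi> (u / sqrt (real n)) \<partial>statistical_distribution n (\<mu> n))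
         \<longlonglongrightarrow> (LINT u:limit_support c|limit_measure c. \<phi> u))"
proof (intro conjI allI impI)
  fix n :: nat assume "n \<ge> 1"
  then show "is_statistical_distribution n (\<mu> n) (statistical_distribution n (\<mu> n))"
    using statistical_distribution_eq[OF _ pos] eigen_distr_statistical[OF _ pos] by simp
next
  fix \<phi> :: "real \<Rightarrow> real" assume \<phi>: "continuous_on UNIV \<phi>" and \<phi>b: "bounded (range \<phi>)"
  have \<phi>m [measurable]: "\<phi> \<in> borel_measurable borel" by (rule borel_measurable_continuous_onI[OF \<phi>])
  \<comment> \<open>The index is shifted by one, since nothing is assumed about \<open>\<mu> 0\<close> and there is no scaling at \<open>n = 0\<close>.\<close>
  define N where "N n = eigen_distr (Suc n) (\<mu> (Suc n))" for n
  define M where "M n = distr (N n) borel (\<lambda>t. t / sqrt (real (Suc n)))" for n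
  have p: "Suc n \<ge> 1" "\<mu> (Suc n) > 0" for n using pos[of "Suc n"] by auto
  have sN: "sets (N n) = sets borel" for n unfolding N_def by (rule sets_eigen_distr[OF p])
  note [measurable_cong] = sN
  have pN: "prob_space (N n)" for n unfolding N_def by (rule prob_space_eigen_distr[OF p])
  have iM: "(\<integral>t. g t \<partial>M n) = (\<integral>t. g (t / sqrt (real (Suc n))) \<partial>N n)" if [measurable]: "g \<in> borel_measurable borel" for g :: "real \<Rightarrow> real" and n
    unfolding M_def by (rule integral_distr) measurable
  have momM: "has_bochner_integral (M n) (\<lambda>t. t ^ (2 * k)) (1 / real (Suc n) * (\<Sum>j<Suc n. jac (\<mu> (Suc n)) k j j / real (Suc n) ^ k))" for n k
  proof -
    have "has_bochner_integral (N n) (\<lambda>t. (t / sqrt (real (Suc n))) ^ (2 * k)) (1 / real (Suc n) * (\<Sum>j<Suc n. jac (\<mu> (Suc n)) k j j) / real (Suc n) ^ k)"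
    proof -
      have "(t / sqrt (real (Suc n))) ^ (2 * k) = t ^ (2 * k) / real (Suc n) ^ k" for t
        by (simp add: power_divide power_mult)
      then show ?thesis
        using has_bochner_integral_divide[OF eigen_distr_moment[OF p(1)[of n] p(2)[of n], of k], of "real (Suc n) ^ k"] by (simp add: N_def)
    qed
    then show ?thesis
      unfolding M_def
      by (subst has_bochner_integral_distr)
        (auto simp: sum_divide_distrib[symmetric] simp del: sum.lessThan_Suc of_nat_Suc)
  qed
  have "(\<lambda>n. \<integral>t. \<phi> t \<partial>M n) \<longlonglongrightarrow> (\<integral>t. \<phi> t \<partial>limit_measure c)"
  proof (rule even_moments_weak_convergence[where b="edge_b c"])
    show "prob_space (M n)" for n unfolding M_def by (rule prob_space.prob_space_distr[OF pN]) measurable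
    show "sets (M n) = sets borel" for n by (simp add: M_def)
    show "prob_space (limit_measure c)" by (rule prob_space_limit_measure[OF c])
    show "(\<integral>t. \<phi> (- t) \<partial>M n) = (\<integral>t. \<phi> t \<partial>M n)" if [measurable]: "\<phi> \<in> borel_measurable borel" for n and \<phi> :: "real \<Rightarrow> real"
      using eigen_distr_symmetric[OF p, of "\<lambda>t. \<phi> (t / sqrt (real (Suc n)))" n]
      by (simp add: iM N_def)
    show "(\<integral>t. \<phi> (- t) \<partial>limit_measure c) = (\<integral>t. \<phi> t \<partial>limit_measure c)" if "\<phi> \<in> borel_measurable borel" for \<phi> :: "real \<Rightarrow> real"
      by (rule limit_measure_symmetric[OF that])
    show "integrable (M n) (\<lambda>t. t ^ (2 * k))" for n k using momM by (auto simp: has_bochner_integral_iff)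
    show "integrable (limit_measure c) (\<lambda>t. t ^ (2 * k))" for k
      using limit_measure_moment[OF c] by (auto simp: has_bochner_integral_iff)
    show "AE t in limit_measure c. \<bar>t\<bar> \<le> edge_b c"
      using limit_measure_AE_support[of c] by eventually_elim (use edges(3,4)[OF c] in \<open>auto simp: limit_support_def\<close>)
    show "edge_b c \<ge> 0" using edges(3,4)[OF c] by simp
    show "(\<lambda>n. \<integral>t. t ^ (2 * k) \<partial>M n) \<longlonglongrightarrow> (\<integral>t. t ^ (2 * k) \<partial>limit_measure c)" for k
      unfolding has_bochner_integral_integral_eq[OF momM] has_bochner_integral_integral_eq[OF limit_measure_moment[OF c]]
        lim_jac_average[OF c, symmetric]
      by (rule LIMSEQ_Suc[OF jac_average_tendsto[OF lim c pos]])
  qed (simp_all add: \<phi> \<phi>b)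
  then have "(\<lambda>n. \<integral>t. \<phi> (t / sqrt (real (Suc n))) \<partial>statistical_distribution (Suc n) (\<mu> (Suc n))) \<longlonglongrightarrow> (\<integral>t. \<phi> t \<partial>limit_measure c)"
    unfolding iM[OF \<phi>m] N_def statistical_distribution_eq[OF p] .
  then have "(\<lambda>n. \<integral>t. \<phi> (t / sqrt (real n)) \<partial>statistical_distribution n (\<mu> n)) \<longlonglongrightarrow> (\<integral>t. \<phi> t \<partial>limit_measure c)"
    by (rule LIMSEQ_imp_Suc)
  moreover have "(LINT u:limit_support c|limit_measure c. \<phi> u) = (\<integral>t. \<phi> t \<partial>limit_measure c)"
    unfolding set_lebesgue_integral_def
  proof (rule integral_cong_AE)
    show "(\<lambda>t. indicator (limit_support c) t *\<^sub>R \<phi> t) \<in> borel_measurable (limit_measure c)"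
      unfolding limit_support_def by (simp add: limit_measure_def)
    show "AE t in limit_measure c. indicator (limit_support c) t *\<^sub>R \<phi> t = \<phi> t"
      using limit_measure_AE_support[of c] by eventually_elim simp
  qed (simp add: limit_measure_def)
  ultimately show "(\<lambda>n. \<integral>u. \<phi> (u / sqrt (real n)) \<partial>statistical_distribution n (\<mu> n))
         \<longlonglongrightarrow> (LINT u:limit_support c|limit_measure c. \<phi> u)" by simp
qed

end
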